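(* Let $\alpha:B\to B\otimes A$ be an action of a compact quantum group $\mathcal{G}=(A,\Delta)$ on a unital $C^*$-algebra $B$. Then $\alpha$ is ergodic if and only if there is a unique $\alpha$-invariant state on $B$.
   Context: Unital $C^*$-algebras are nonzero, and $\otimes$ denotes the minimal tensor product of $C^*$-algebras. A compact quantum group $\mathcal{G}$ is a pair $(A,\Delta)$ with $A$ a unital $C^*$-algebra and $\Delta:A\to A\otimes A$ a unital $*$-homomorphism such that $(id\otimes\Delta)\Delta=(\Delta\otimes id)\Delta$ and the linear spans of $\Delta(A)(1\otimes A)$ and of $\Delta(A)(A\otimes 1)$ are dense in $A\otimes A$. An action of $\mathcal{G}$ on a unital $C^*$-algebra $B$ is a unital $*$-homomorphism $\alpha:B\to B\otimes A$ with $(\alpha\otimes id)\alpha=(id\otimes\Delta)\alpha$ and such that the linear span of $\alpha(B)(1\otimes A)$ is dense in $B\otimes A$. The action is ergodic if $\{b\in B:\alpha(b)=b\otimes 1\}=\mathbb{C}1_B$. A state $\mu$ on $B$ is $\alpha$-invariant if $(\mu\otimes id)\alpha(b)=\mu(b)1_A$ for all $b\in B$. *)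

theory Defs
  imports "HOL-Analysis.Analysis"
begin

section \<open>Unital C*-algebras\<close>

class scaleC =
  fixes scaleC :: "complex \<Rightarrow> 'a \<Rightarrow> 'a" (infixr "*\<^sub>C" 75)

class star =
  fixes star :: "'a \<Rightarrow> 'a"

class star_algebra = real_algebra + monoid_mult + scaleC + star +
  assumes scaleC_add_right: "c *\<^sub>C (x + y) = c *\<^sub>C x + c *\<^sub>C y"
    and scaleC_add_left: "(c + d) *\<^sub>C x = c *\<^sub>C x + d *\<^sub>C x"
    and scaleC_scaleC: "c *\<^sub>C d *\<^sub>C x = (c * d) *\<^sub>C x"
    and scaleC_of_real: "complex_of_real r *\<^sub>C x = r *\<^sub>R x"
    and mult_scaleC_left: "(c *\<^sub>C x) * y = c *\<^sub>C (x * y)"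
    and mult_scaleC_right: "x * (c *\<^sub>C y) = c *\<^sub>C (x * y)"
    and star_add: "star (x + y) = star x + star y"
    and star_scaleC: "star (c *\<^sub>C x) = cnj c *\<^sub>C star x"
    and star_mult: "star (x * y) = star y * star x"
    and star_star: "star (star x) = x"

text \<open>
  The zero algebra satisfies the axioms of the next class: only \<open>unital_cstar_algebra\<close> demands
  \<open>0 \<noteq> 1\<close>. This way the minimal tensor product is an instance of \<open>cstar_algebra\<close> without
  any appeal to the existence of states.
\<close>

class cstar_algebra = star_algebra + banach + real_normed_algebra +
  assumes norm_scaleC: "norm (c *\<^sub>C x) = cmod c * norm x"
    and cstar_identity: "norm (star x * x) = (norm x)\<^sup>2"

lemma square_eq_self: "r = r\<^sup>2 \<Longrightarrow> r \<noteq> 0 \<Longrightarrow> r = (1::real)"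
  by (simp add: power2_eq_square)

class unital_cstar_algebra = cstar_algebra + zero_neq_one
begin

subclass real_algebra_1 ..

subclass real_normed_algebra_1
proof
  have s1: "star 1 = 1"
    by (metis mult_1_left mult_1_right star_mult star_star)
  have "norm 1 = (norm 1)\<^sup>2"
    using cstar_identity[of 1] s1 by simp
  moreover have "norm 1 \<noteq> 0"
    using norm_eq_zero zero_neq_one by metis
  ultimately show "norm 1 = 1"
    by (rule square_eq_self)
qed

end

global_interpretation complex_vector: vector_space "scaleC :: complex \<Rightarrow> 'a \<Rightarrow> 'a::star_algebra"
  defines cspan = complex_vector.span
proof
  fix x :: 'a
  show "1 *\<^sub>C x = x"
    using scaleC_of_real[of 1 x] by simp
qed (simp_all add: scaleC_add_right scaleC_add_left scaleC_scaleC)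

instantiation complex :: unital_cstar_algebra
begin
definition scaleC_complex_def [simp]: "scaleC_complex = ((*) :: complex \<Rightarrow> _)"
definition star_complex_def [simp]: "star_complex = cnj"
instance
  by standard (simp_all add: algebra_simps norm_mult power2_eq_square scaleR_conv_of_real)
end

definition clinear :: "('a::star_algebra \<Rightarrow> 'b::star_algebra) \<Rightarrow> bool" where
  "clinear f \<longleftrightarrow> (\<forall>x y. f (x + y) = f x + f y) \<and> (\<forall>c x. f (c *\<^sub>C x) = c *\<^sub>C f x)"

definition unital_star_hom :: "('a::star_algebra \<Rightarrow> 'b::star_algebra) \<Rightarrow> bool" where
  "unital_star_hom f \<longleftrightarrow> clinear f \<and> (\<forall>x y. f (x * y) = f x * f y) \<and>
     (\<forall>x. f (star x) = star (f x)) \<and> f 1 = 1"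

text \<open>
  Boundedness of \<open>\<phi>\<close> is automatic for positive functionals on a C*-algebra, and for these
  \<open>\<phi> 1 = 1\<close> says that \<open>\<phi>\<close> has norm one.
\<close>

definition state :: "('a::cstar_algebra \<Rightarrow> complex) \<Rightarrow> bool" where
  "state \<phi> \<longleftrightarrow> clinear \<phi> \<and> bounded_linear \<phi> \<and> (\<forall>x. \<phi> (star x * x) \<in> \<real>\<^sub>\<ge>\<^sub>0) \<and> \<phi> 1 = 1"


section \<open>The algebraic tensor product\<close>

text \<open>
  A list \<open>[(a\<^sub>1, b\<^sub>1), \<dots>, (a\<^sub>n, b\<^sub>n)]\<close> stands for \<open>\<Sum>i. a\<^sub>i \<otimes> b\<^sub>i\<close>. Since
  the dual of the algebraic tensor product is the space of bilinear forms, two such sums are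
  equal iff all complex bilinear forms agree on them.
\<close>

definition cbilinear :: "('a::star_algebra \<Rightarrow> 'b::star_algebra \<Rightarrow> complex) \<Rightarrow> bool" where
  "cbilinear \<beta> \<longleftrightarrow> (\<forall>b. clinear (\<lambda>a. \<beta> a b)) \<and> (\<forall>a. clinear (\<beta> a))"

definition tsum :: "('a \<Rightarrow> 'b \<Rightarrow> complex) \<Rightarrow> ('a \<times> 'b) list \<Rightarrow> complex" where
  "tsum \<beta> xs = (\<Sum>(a, b)\<leftarrow>xs. \<beta> a b)"

definition tensor_eq :: "('a::star_algebra \<times> 'b::star_algebra) list \<Rightarrow> ('a \<times> 'b) list \<Rightarrow> bool" where
  "tensor_eq xs ys \<longleftrightarrow> (\<forall>\<beta>. cbilinear \<beta> \<longrightarrow> tsum \<beta> xs = tsum \<beta> ys)"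

quotient_type (overloaded) ('a, 'b) alg_tensor =
  "('a::star_algebra \<times> 'b::star_algebra) list" / tensor_eq
  by (auto intro!: equivpI reflpI sympI transpI simp: tensor_eq_def)

lemma tsum_simps [simp]:
  "tsum \<beta> [] = 0" "tsum \<beta> ((a, b) # xs) = \<beta> a b + tsum \<beta> xs"
  "tsum \<beta> (xs @ ys) = tsum \<beta> xs + tsum \<beta> ys"
  by (simp_all add: tsum_def)

lemma tsum_map: "tsum \<beta> (map (\<lambda>(a, b). (f a, g b)) xs) = tsum (\<lambda>a b. \<beta> (f a) (g b)) xs"
  by (induction xs) auto

definition times_list :: "('a::times \<times> 'b::times) list \<Rightarrow> ('a \<times> 'b) list \<Rightarrow> ('a \<times> 'b) list" where
  "times_list xs ys = concat (map (\<lambda>(a, b). map (\<lambda>(c, d). (a * c, b * d)) ys) xs)"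

lemma times_list_simps [simp]: "times_list [] ys = []"
  "times_list ((a, b) # xs) ys = map (\<lambda>(c, d). (a * c, b * d)) ys @ times_list xs ys"
  by (simp_all add: times_list_def)

lemma tsum_times: "tsum \<beta> (times_list xs ys) = tsum (\<lambda>a b. tsum (\<lambda>c d. \<beta> (a * c) (b * d)) ys) xs"
  by (induction xs) (auto simp: tsum_map)

lemma tsum_zero: "tsum (\<lambda>a b. 0) xs = 0"
  by (induction xs) auto

lemma tsum_add: "tsum (\<lambda>a b. \<beta> a b + \<gamma> a b) xs = tsum \<beta> xs + tsum \<gamma> xs"
  by (induction xs) (auto simp: algebra_simps)

lemma tsum_scale: "tsum (\<lambda>a b. c * \<beta> a b) xs = c * tsum \<beta> xs"
  by (induction xs) (auto simp: algebra_simps)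

lemma tsum_cnj: "tsum (\<lambda>a b. cnj (\<beta> a b)) xs = cnj (tsum \<beta> xs)"
  by (induction xs) auto

lemma tsum_swap: "tsum (\<lambda>a b. tsum (\<lambda>c d. \<beta> a b c d) ys) xs = tsum (\<lambda>c d. tsum (\<lambda>a b. \<beta> a b c d) xs) ys"
  by (induction xs) (auto simp: tsum_add tsum_zero)

lemma cbilinear_iff: "cbilinear \<beta> \<longleftrightarrow>
   (\<forall>a a' b. \<beta> (a + a') b = \<beta> a b + \<beta> a' b) \<and> (\<forall>a b b'. \<beta> a (b + b') = \<beta> a b + \<beta> a b') \<and>
   (\<forall>c a b. \<beta> (c *\<^sub>C a) b = c * \<beta> a b) \<and> (\<forall>c a b. \<beta> a (c *\<^sub>C b) = c * \<beta> a b)"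
  by (auto simp: cbilinear_def clinear_def)

lemma cbilinear_simps:
  assumes "cbilinear \<beta>"
  shows "\<beta> (a + a') b = \<beta> a b + \<beta> a' b" "\<beta> a (b + b') = \<beta> a b + \<beta> a b'"
   "\<beta> (c *\<^sub>C a) b = c * \<beta> a b" "\<beta> a (c *\<^sub>C b) = c * \<beta> a b"
  using assms by (auto simp: cbilinear_iff)

lemma tensor_eq_append: "tensor_eq xs xs' \<Longrightarrow> tensor_eq ys ys' \<Longrightarrow> tensor_eq (xs @ ys) (xs' @ ys')"
  by (simp add: tensor_eq_def)

lemma tensor_eq_scale: "tensor_eq xs ys \<Longrightarrow>
    tensor_eq (map (\<lambda>(a, b). (c *\<^sub>C a, b)) xs) (map (\<lambda>(a, b). (c *\<^sub>C a, b)) ys)"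
  by (auto simp: tensor_eq_def tsum_map cbilinear_simps tsum_scale)

lemma tsum_scale_map: "cbilinear \<beta> \<Longrightarrow> tsum \<beta> (map (\<lambda>(a, b). (c *\<^sub>C a, b)) xs) = c * tsum \<beta> xs"
  by (auto simp: tsum_map cbilinear_simps tsum_scale)

lemma tensor_eq_star:
  assumes "tensor_eq xs ys"
  shows "tensor_eq (map (\<lambda>(a, b). (star a, star b)) xs) (map (\<lambda>(a, b). (star a, star b)) ys)"
  unfolding tensor_eq_def
proof (intro allI impI)
  fix \<beta> :: "'a \<Rightarrow> 'b \<Rightarrow> complex" assume "cbilinear \<beta>"
  then have "cbilinear (\<lambda>a b. cnj (\<beta> (star a) (star b)))"
    by (auto simp: cbilinear_iff star_add star_scaleC)
  then have "cnj (tsum (\<lambda>a b. \<beta> (star a) (star b)) xs) = cnj (tsum (\<lambda>a b. \<beta> (star a) (star b)) ys)"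
    using assms unfolding tensor_eq_def tsum_cnj[symmetric] by blast
  then show "tsum \<beta> (map (\<lambda>(a, b). (star a, star b)) xs) = tsum \<beta> (map (\<lambda>(a, b). (star a, star b)) ys)"
    by (simp add: tsum_map)
qed

lemma tensor_eq_times:
  assumes "tensor_eq xs xs'" "tensor_eq ys ys'"
  shows "tensor_eq (times_list xs ys) (times_list xs' ys')"
  unfolding tensor_eq_def
proof (intro allI impI)
  fix \<beta> :: "'a \<Rightarrow> 'b \<Rightarrow> complex" assume b: "cbilinear \<beta>"
  have b1: "cbilinear (\<lambda>c d. \<beta> (a * c) (b * d))" for a b
    using b by (auto simp: cbilinear_iff distrib_left mult_scaleC_right)
  have b2: "cbilinear (\<lambda>a b. tsum (\<lambda>c d. \<beta> (a * c) (b * d)) ys)"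
    using b by (auto simp: cbilinear_iff distrib_right mult_scaleC_left tsum_add tsum_scale)
  show "tsum \<beta> (times_list xs ys) = tsum \<beta> (times_list xs' ys')"
    using assms b1 b2 by (simp add: tensor_eq_def tsum_times)
qed

instantiation alg_tensor :: (star_algebra, star_algebra) star_algebra
begin

lift_definition zero_alg_tensor :: "('a, 'b) alg_tensor" is "[]" .
lift_definition one_alg_tensor :: "('a, 'b) alg_tensor" is "[(1, 1)]" .
lift_definition plus_alg_tensor :: "('a, 'b) alg_tensor \<Rightarrow> ('a, 'b) alg_tensor \<Rightarrow> ('a, 'b) alg_tensor"
  is "(@)" by (rule tensor_eq_append)
lift_definition scaleC_alg_tensor :: "complex \<Rightarrow> ('a, 'b) alg_tensor \<Rightarrow> ('a, 'b) alg_tensor"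
  is "\<lambda>c. map (\<lambda>(a, b). (c *\<^sub>C a, b))" by (rule tensor_eq_scale)
lift_definition times_alg_tensor :: "('a, 'b) alg_tensor \<Rightarrow> ('a, 'b) alg_tensor \<Rightarrow> ('a, 'b) alg_tensor"
  is times_list by (rule tensor_eq_times)
lift_definition star_alg_tensor :: "('a, 'b) alg_tensor \<Rightarrow> ('a, 'b) alg_tensor"
  is "map (\<lambda>(a, b). (star a, star b))" by (rule tensor_eq_star)
definition uminus_alg_tensor :: "('a, 'b) alg_tensor \<Rightarrow> ('a, 'b) alg_tensor" where
  "uminus_alg_tensor x = (-1) *\<^sub>C x"
definition minus_alg_tensor :: "('a, 'b) alg_tensor \<Rightarrow> ('a, 'b) alg_tensor \<Rightarrow> ('a, 'b) alg_tensor" where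
  "minus_alg_tensor x y = x + (-1) *\<^sub>C y"
definition scaleR_alg_tensor :: "real \<Rightarrow> ('a, 'b) alg_tensor \<Rightarrow> ('a, 'b) alg_tensor" where
  "scaleR_alg_tensor r x = complex_of_real r *\<^sub>C x"

instance
proof
  fix x y z :: "('a, 'b) alg_tensor" and c d :: complex and r s :: real
  show 1: "x + y + z = x + (y + z)" by transfer (simp add: tensor_eq_def)
  show 2: "x + y = y + x" by transfer (simp add: tensor_eq_def)
  show 3: "0 + x = x" by transfer (simp add: tensor_eq_def)
  show "- x + x = 0" unfolding uminus_alg_tensor_def
    by transfer (simp add: tensor_eq_def tsum_scale_map del: complex_vector.scale_minus_left)
  show "x - y = x + - y" by (simp add: minus_alg_tensor_def uminus_alg_tensor_def)
  show C1: "c *\<^sub>C (x + y) = c *\<^sub>C x + c *\<^sub>C y" by transfer (simp add: tensor_eq_def)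
  show C2: "(c + d) *\<^sub>C x = c *\<^sub>C x + d *\<^sub>C x" for c d
    by transfer (simp add: tensor_eq_def tsum_scale_map distrib_right del: complex_vector.scale_left_distrib)
  show C3: "c *\<^sub>C d *\<^sub>C x = (c * d) *\<^sub>C x" for c d
    by transfer (simp add: tensor_eq_def tsum_scale_map mult.assoc del: map_map complex_vector.scale_scale)
  show "complex_of_real r *\<^sub>C x = r *\<^sub>R x" by (simp add: scaleR_alg_tensor_def)
  show "r *\<^sub>R (x + y) = r *\<^sub>R x + r *\<^sub>R y" unfolding scaleR_alg_tensor_def
    by transfer (simp add: tensor_eq_def)
  show "(r + s) *\<^sub>R x = r *\<^sub>R x + s *\<^sub>R x" by (simp add: scaleR_alg_tensor_def C2)
  show "r *\<^sub>R s *\<^sub>R x = (r * s) *\<^sub>R x" by (simp add: scaleR_alg_tensor_def C3)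
  show "1 *\<^sub>R x = x" unfolding scaleR_alg_tensor_def
    by transfer (simp add: tensor_eq_def tsum_scale_map)
  show M1: "(c *\<^sub>C x) * y = c *\<^sub>C (x * y)" for c
    by transfer (simp add: tensor_eq_def tsum_scale_map tsum_times tsum_map mult_scaleC_left cbilinear_simps tsum_scale)
  show M2: "x * (c *\<^sub>C y) = c *\<^sub>C (x * y)" for c
    by transfer (simp add: tensor_eq_def tsum_scale_map tsum_times tsum_map mult_scaleC_right cbilinear_simps tsum_scale)
  show "(r *\<^sub>R x) * y = r *\<^sub>R (x * y)" "x * (r *\<^sub>R y) = r *\<^sub>R (x * y)"
    by (simp_all add: scaleR_alg_tensor_def M1 M2)
  show "x * y * z = x * (y * z)"
    by transfer (simp add: tensor_eq_def tsum_times mult.assoc)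
  show "(x + y) * z = x * z + y * z"
    by transfer (simp add: tensor_eq_def tsum_times)
  show "x * (y + z) = x * y + x * z"
    by transfer (simp add: tensor_eq_def tsum_times tsum_add)
  show "1 * x = x"
    by transfer (simp add: tensor_eq_def tsum_map)
  show "x * 1 = x"
    by transfer (simp add: tensor_eq_def tsum_times)
  show "star (x + y) = star x + star y"
    by transfer (simp add: tensor_eq_def)
  show "star (c *\<^sub>C x) = cnj c *\<^sub>C star x"
    by transfer (simp add: tensor_eq_def tsum_map star_scaleC cbilinear_simps tsum_scale del: map_map)
  show "star (x * y) = star y * star x"
    by transfer (simp add: tensor_eq_def tsum_map tsum_times star_mult, intro allI impI, rule tsum_swap)
  show "star (star x) = x"
    by transfer (simp add: tensor_eq_def tsum_map star_star del: map_map)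
qed

end


lift_definition alg_pure :: "'a::star_algebra \<Rightarrow> 'b::star_algebra \<Rightarrow> ('a, 'b) alg_tensor"
  is "\<lambda>a b. [(a, b)]" .

definition alg_lift :: "('a::star_algebra \<Rightarrow> 'b::star_algebra \<Rightarrow> complex) \<Rightarrow> ('a, 'b) alg_tensor \<Rightarrow> complex" where
  "alg_lift \<beta> t = tsum \<beta> (rep_alg_tensor t)"

definition prod_functional :: "('a::star_algebra \<Rightarrow> complex) \<Rightarrow> ('b::star_algebra \<Rightarrow> complex) \<Rightarrow>
    ('a, 'b) alg_tensor \<Rightarrow> complex" where
  "prod_functional \<phi> \<psi> = alg_lift (\<lambda>a b. \<phi> a * \<psi> b)"

lemma alg_lift_abs: "cbilinear \<beta> \<Longrightarrow> alg_lift \<beta> (abs_alg_tensor xs) = tsum \<beta> xs"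
proof -
  assume b: "cbilinear \<beta>"
  have "abs_alg_tensor (rep_alg_tensor (abs_alg_tensor xs)) = abs_alg_tensor xs"
    by (rule Quotient3_abs_rep[OF Quotient3_alg_tensor])
  then show "alg_lift \<beta> (abs_alg_tensor xs) = tsum \<beta> xs"
    using b by (simp add: alg_tensor.abs_eq_iff alg_lift_def tensor_eq_def)
qed

lemma clinear_alg_lift: "cbilinear \<beta> \<Longrightarrow> clinear (alg_lift \<beta>)"
  unfolding clinear_def
proof (intro conjI allI)
  assume b: "cbilinear \<beta>"
  fix x y :: "('a, 'b) alg_tensor" and c
  obtain xs where x: "x = abs_alg_tensor xs" by (metis Quotient3_abs_rep Quotient3_alg_tensor)
  obtain ys where y: "y = abs_alg_tensor ys" by (metis Quotient3_abs_rep Quotient3_alg_tensor)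
  show "alg_lift \<beta> (x + y) = alg_lift \<beta> x + alg_lift \<beta> y"
    using b by (simp add: x y plus_alg_tensor.abs_eq alg_lift_abs)
  show "alg_lift \<beta> (c *\<^sub>C x) = c *\<^sub>C alg_lift \<beta> x"
    using b by (simp add: x scaleC_alg_tensor.abs_eq alg_lift_abs tsum_scale_map)
qed

lemma alg_lift_pure: "cbilinear \<beta> \<Longrightarrow> alg_lift \<beta> (alg_pure a b) = \<beta> a b"
  by (simp add: alg_pure.abs_eq alg_lift_abs)

lemma alg_pure_simps:
  "alg_pure a b * alg_pure c d = alg_pure (a * c) (b * d)"
  "star (alg_pure a b) = alg_pure (star a) (star b)"
  "alg_pure 1 1 = 1"
  by (transfer, simp add: tensor_eq_def)+

lemma alg_pure_linear:
  "alg_pure (a + a') b = alg_pure a b + alg_pure a' b"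
  "alg_pure a (b + b') = alg_pure a b + alg_pure a b'"
  "alg_pure (c *\<^sub>C a) b = c *\<^sub>C alg_pure a b"
  "alg_pure a (c *\<^sub>C b) = c *\<^sub>C alg_pure a b"
  by (transfer, simp add: tensor_eq_def cbilinear_simps)+

lemma abs_alg_tensor_Cons: "abs_alg_tensor ((a, b) # xs) = alg_pure a b + abs_alg_tensor xs"
  by (simp add: alg_pure.abs_eq plus_alg_tensor.abs_eq)

lemma abs_alg_tensor_Nil: "abs_alg_tensor [] = 0"
  by (simp add: zero_alg_tensor_def)

lemma alg_tensor_induct [case_names zero add]:
  assumes "P 0" "\<And>a b t. P t \<Longrightarrow> P (alg_pure a b + t)"
  shows "P t"
proof -
  obtain xs where "t = abs_alg_tensor xs" by (metis Quotient3_abs_rep Quotient3_alg_tensor)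
  moreover have "P (abs_alg_tensor xs)"
    by (induction xs) (auto simp: abs_alg_tensor_Cons abs_alg_tensor_Nil assms)
  ultimately show ?thesis by simp
qed


section \<open>Positive functionals\<close>

definition positive_functional :: "('a::star_algebra \<Rightarrow> complex) \<Rightarrow> bool" where
  "positive_functional \<tau> \<longleftrightarrow> clinear \<tau> \<and> (\<forall>x. \<tau> (star x * x) \<in> \<real>\<^sub>\<ge>\<^sub>0)"

text \<open>
  \<open>gns_norm \<tau> x\<close> is the norm of the class of \<open>x\<close> in the GNS space of \<open>\<tau>\<close>, whose inner
  product is \<open>\<langle>x, y\<rangle> = \<tau> (star y * x)\<close>.
\<close>

definition gns_norm :: "('a::star_algebra \<Rightarrow> complex) \<Rightarrow> 'a \<Rightarrow> real" where
  "gns_norm \<tau> x = sqrt (Re (\<tau> (star x * x)))"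

lemma clinear_simps:
  assumes "clinear f"
  shows "f (x + y) = f x + f y" "f (c *\<^sub>C x) = c *\<^sub>C f x" "f 0 = 0" "f (- x) = - f x" "f (x - y) = f x - f y"
proof -
  show a: "f (x + y) = f x + f y" for x y using assms by (simp add: clinear_def)
  show s: "f (c *\<^sub>C x) = c *\<^sub>C f x" for c x using assms by (simp add: clinear_def)
  show "f 0 = 0" using s[of 0 0] by simp
  show m: "f (- x) = - f x" for x using s[of "-1" x] by simp
  show "f (x - y) = f x - f y" using a[of x "-y"] m by simp
qed

lemma star_simps: "star 0 = (0::'a::star_algebra)" "star (- x) = - star (x::'a)" "star (x - y) = star x - star (y::'a)"
  "star 1 = (1::'a)"
proof -
  show z: "star 0 = (0::'a)" using star_scaleC[of 0 "0::'a"] by simp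
  show m: "star (- x) = - star (x::'a)" for x using star_scaleC[of "-1" x] by simp
  show "star (x - y) = star x - star (y::'a)" using star_add[of x "-y"] m by simp
  show "star 1 = (1::'a)" by (metis mult_1_left mult_1_right star_mult star_star)
qed

lemma pos_nonneg: "positive_functional \<tau> \<Longrightarrow> Re (\<tau> (star x * x)) \<ge> 0 \<and> Im (\<tau> (star x * x)) = 0"
  by (simp add: positive_functional_def complex_nonneg_Reals_iff)

lemma pos_herm:
  assumes "positive_functional \<tau>"
  shows "\<tau> (star y * x) = cnj (\<tau> (star x * y))"
proof -
  have l: "clinear \<tau>" using assms by (simp add: positive_functional_def)
  have *: "Im (\<tau> (star x * y)) + Im (\<tau> (star y * x)) = 0" for x y
    using pos_nonneg[OF assms, of "x + y"] pos_nonneg[OF assms, of x] pos_nonneg[OF assms, of y]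
    by (simp add: star_add distrib_left distrib_right clinear_simps[OF l])
  from *[of x y] *[of x "\<i> *\<^sub>C y"] show ?thesis
    by (simp add: complex_eq_iff star_scaleC mult_scaleC_left mult_scaleC_right clinear_simps[OF l])
qed

lemma pos_expand:
  assumes "positive_functional \<tau>"
  shows "Re (\<tau> (star (x + c *\<^sub>C y) * (x + c *\<^sub>C y))) =
    Re (\<tau> (star x * x)) + 2 * Re (c * \<tau> (star x * y)) + (cmod c)\<^sup>2 * Re (\<tau> (star y * y))"
proof -
  have l: "clinear \<tau>" using assms by (simp add: positive_functional_def)
  have "cnj c * c = complex_of_real ((cmod c)\<^sup>2)"
    by (metis complex_norm_square mult.commute)
  then have e: "cnj c * (c * z) = complex_of_real ((cmod c)\<^sup>2) * z" for z by (simp add: mult.assoc[symmetric])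
  have "\<tau> (star (x + c *\<^sub>C y) * (x + c *\<^sub>C y)) = \<tau> (star x * x) + c * \<tau> (star x * y) +
     cnj (c * \<tau> (star x * y)) + complex_of_real ((cmod c)\<^sup>2) * \<tau> (star y * y)"
    by (simp add: star_add distrib_left distrib_right clinear_simps[OF l] star_scaleC mult_scaleC_left
       mult_scaleC_right pos_herm[OF assms, of y x] e[symmetric] del: of_real_power)
  then show ?thesis by simp
qed

lemma pos_CS:
  assumes "positive_functional \<tau>"
  shows "(cmod (\<tau> (star x * y)))\<^sup>2 \<le> Re (\<tau> (star x * x)) * Re (\<tau> (star y * y))"
proof -
  define p q r where "p = Re (\<tau> (star x * x))" and "q = Re (\<tau> (star y * y))" and "r = \<tau> (star x * y)"
  have ex: "0 \<le> p - 2 * s * (cmod r)\<^sup>2 + s\<^sup>2 * (cmod r)\<^sup>2 * q" for s :: real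
  proof -
    let ?c = "- complex_of_real s * cnj r"
    have "Re (?c * r) = - s * (cmod r)\<^sup>2"
      unfolding cmod_power2 by (simp add: power2_eq_square algebra_simps)
    moreover have "(cmod ?c)\<^sup>2 = s\<^sup>2 * (cmod r)\<^sup>2" by (simp add: norm_mult power_mult_distrib)
    moreover have "0 \<le> p + 2 * Re (?c * r) + (cmod ?c)\<^sup>2 * q"
      using pos_nonneg[OF assms, of "x + ?c *\<^sub>C y"]
      unfolding pos_expand[OF assms] p_def[symmetric] q_def[symmetric] r_def[symmetric] by blast
    ultimately show ?thesis by (simp only: mult.assoc)
  qed
  have q0: "q \<ge> 0" and p0: "p \<ge> 0" using pos_nonneg[OF assms] by (auto simp: p_def q_def)
  have "(cmod r)\<^sup>2 \<le> p * q"
  proof (cases "q = 0")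
    case True
    have "(cmod r)\<^sup>2 = 0"
    proof (rule ccontr)
      assume "(cmod r)\<^sup>2 \<noteq> 0"
      then have "(cmod r)\<^sup>2 > 0" by simp
      then show False using ex[of "(p + 1) / (cmod r)\<^sup>2"] True p0 by simp
    qed
    then show ?thesis using True by simp
  next
    case False
    then have "q > 0" using q0 by simp
    have "(1/q)\<^sup>2 * (cmod r)\<^sup>2 * q = (cmod r)\<^sup>2 / q"
      using False by (simp add: power2_eq_square)
    then have "0 \<le> p - (cmod r)\<^sup>2 / q" using ex[of "1/q"] by simp
    then show ?thesis using \<open>q > 0\<close> by (simp add: field_simps)
  qed
  then show ?thesis by (simp add: p_def q_def r_def)
qed

lemma gns_norm_nonneg: "positive_functional \<tau> \<Longrightarrow> gns_norm \<tau> x \<ge> 0"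
  by (simp add: gns_norm_def pos_nonneg)

lemma gns_norm_sq: "positive_functional \<tau> \<Longrightarrow> (gns_norm \<tau> x)\<^sup>2 = Re (\<tau> (star x * x))"
  by (simp add: gns_norm_def pos_nonneg)

lemma gns_CS: "positive_functional \<tau> \<Longrightarrow> cmod (\<tau> (star x * y)) \<le> gns_norm \<tau> x * gns_norm \<tau> y"
  by (rule power2_le_imp_le)
    (simp_all add: power_mult_distrib gns_norm_sq pos_CS gns_norm_nonneg)

lemma gns_norm_triangle:
  assumes "positive_functional \<tau>"
  shows "gns_norm \<tau> (x + y) \<le> gns_norm \<tau> x + gns_norm \<tau> y"
proof (rule power2_le_imp_le)
  show "(gns_norm \<tau> (x + y))\<^sup>2 \<le> (gns_norm \<tau> x + gns_norm \<tau> y)\<^sup>2"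
    using pos_expand[OF assms, of x 1 y] complex_Re_le_cmod[of "\<tau> (star x * y)"] gns_CS[OF assms, of x y]
    by (simp add: gns_norm_sq[OF assms] power2_sum)
qed (use gns_norm_nonneg[OF assms] in auto)

lemma gns_norm_scaleC:
  assumes "positive_functional \<tau>"
  shows "gns_norm \<tau> (c *\<^sub>C x) = cmod c * gns_norm \<tau> x"
proof -
  have "clinear \<tau>" using assms by (simp add: positive_functional_def)
  then show ?thesis
    using pos_expand[OF assms, of 0 c x]
    by (simp add: gns_norm_def real_sqrt_mult star_simps clinear_simps)
qed

lemma pos_bounded:
  fixes \<tau> :: "'a::cstar_algebra \<Rightarrow> complex"
  assumes "positive_functional \<tau>" "bounded_linear \<tau>"
  shows "Re (\<tau> (star x * x)) \<le> (norm x)\<^sup>2 * Re (\<tau> 1)"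
proof -
  let ?K = "onorm \<tau>"
  have s0: "0 \<le> Re (\<tau> 1)" using pos_nonneg[OF assms(1), of 1] by (simp add: star_simps)
  have K0: "0 \<le> ?K" using onorm_pos_le[OF assms(2)] .
  have b: "Re (\<tau> (star z * z)) \<le> ?K * (norm z)\<^sup>2" for z
    using onorm[OF assms(2), of "star z * z"] complex_Re_le_cmod[of "\<tau> (star z * z)"] by (simp add: cstar_identity)
  have "cmod (\<tau> z) \<le> sqrt (Re (\<tau> 1) * ?K) * norm z" for z
  proof -
    have "(cmod (\<tau> z))\<^sup>2 \<le> Re (\<tau> 1) * Re (\<tau> (star z * z))"
      using pos_CS[OF assms(1), of 1 z] by (simp add: star_simps)
    also have "\<dots> \<le> Re (\<tau> 1) * (?K * (norm z)\<^sup>2)"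
      by (intro mult_left_mono b s0)
    finally have "sqrt ((cmod (\<tau> z))\<^sup>2) \<le> sqrt (Re (\<tau> 1) * ?K * (norm z)\<^sup>2)"
      by (intro real_sqrt_le_mono) (simp add: mult.assoc)
    then show ?thesis by (simp add: real_sqrt_mult)
  qed
  then have "?K \<le> sqrt (Re (\<tau> 1) * ?K)" by (intro onorm_bound) (use s0 K0 in auto)
  then have "?K\<^sup>2 \<le> Re (\<tau> 1) * ?K"
    using power_mono[OF _ K0, of "sqrt (Re (\<tau> 1) * ?K)" 2] s0 K0 by simp
  then have "?K \<le> Re (\<tau> 1)"
    using K0 s0 by (cases "?K = 0") (auto simp: power2_eq_square)
  then have "?K * (norm x)\<^sup>2 \<le> Re (\<tau> 1) * (norm x)\<^sup>2" by (intro mult_right_mono) auto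
  with b[of x] show ?thesis by (simp add: mult.commute)
qed

lemma cbilinear_prod: "clinear \<phi> \<Longrightarrow> clinear \<psi> \<Longrightarrow> cbilinear (\<lambda>a b. \<phi> a * \<psi> b)"
  by (auto simp: cbilinear_iff clinear_simps algebra_simps)

lemma prod_functional_pure:
  "clinear \<phi> \<Longrightarrow> clinear \<psi> \<Longrightarrow> prod_functional \<phi> \<psi> (alg_pure a b) = \<phi> a * \<psi> b"
  by (simp add: prod_functional_def alg_lift_pure cbilinear_prod)

lemma clinear_prod_functional: "clinear \<phi> \<Longrightarrow> clinear \<psi> \<Longrightarrow> clinear (prod_functional \<phi> \<psi>)"
  by (simp add: prod_functional_def clinear_alg_lift cbilinear_prod)

lemma orthogonal_decomp:
  assumes "positive_functional \<psi>"
  shows "\<exists>a' xs'. length xs' = length xs \<and> (\<forall>(c, d)\<in>set xs'. \<psi> (star b0 * d) = 0) \<and>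
     abs_alg_tensor xs = alg_pure a' b0 + abs_alg_tensor xs'"
proof (induction xs)
  case Nil
  have "alg_pure 0 b0 = 0" using alg_pure_linear(3)[of 0 0 b0] by simp
  then show ?case by (intro exI[of _ 0] exI[of _ "[]"]) auto
next
  case (Cons p xs)
  obtain c d where p: "p = (c, d)" by fastforce
  have l: "clinear \<psi>" using assms by (simp add: positive_functional_def)
  from Cons obtain a' xs' where IH: "length xs' = length xs" "\<forall>(c, d)\<in>set xs'. \<psi> (star b0 * d) = 0"
     "abs_alg_tensor xs = alg_pure a' b0 + abs_alg_tensor xs'" by blast
  define k where "k = \<psi> (star b0 * d) / \<psi> (star b0 * b0)"
  have orth: "\<psi> (star b0 * (d - k *\<^sub>C b0)) = 0"
  proof (cases "\<psi> (star b0 * b0) = 0")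
    case True
    then have "\<psi> (star b0 * d) = 0" using pos_CS[OF assms, of b0 d] by simp
    then show ?thesis by (simp add: k_def)
  next
    case False
    then show ?thesis by (simp add: right_diff_distrib clinear_simps[OF l] mult_scaleC_right k_def)
  qed
  have "alg_pure c d = alg_pure (k *\<^sub>C c) b0 + alg_pure c (d - k *\<^sub>C b0)"
    using alg_pure_linear(2)[of c "k *\<^sub>C b0" "d - k *\<^sub>C b0"] by (simp add: alg_pure_linear)
  then have "abs_alg_tensor (p # xs) = alg_pure (k *\<^sub>C c + a') b0 + abs_alg_tensor ((c, d - k *\<^sub>C b0) # xs')"
    by (simp add: p abs_alg_tensor_Cons IH alg_pure_linear algebra_simps)
  then show ?case using IH orth
    by (intro exI[of _ "k *\<^sub>C c + a'"] exI[of _ "(c, d - k *\<^sub>C b0) # xs'"]) auto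
qed

lemma positive_prod_functional:
  fixes \<phi> :: "'a::star_algebra \<Rightarrow> complex" and \<psi> :: "'b::star_algebra \<Rightarrow> complex"
  assumes "positive_functional \<phi>" "positive_functional \<psi>"
  shows "positive_functional (prod_functional \<phi> \<psi>)"
proof -
  have l: "clinear \<phi>" "clinear \<psi>" using assms by (auto simp: positive_functional_def)
  note L = clinear_prod_functional[OF l]
  have main: "prod_functional \<phi> \<psi> (star (abs_alg_tensor xs) * abs_alg_tensor xs) \<in> \<real>\<^sub>\<ge>\<^sub>0" for xs
  proof (induction "length xs" arbitrary: xs)
    case 0
    then show ?case by (simp add: abs_alg_tensor_Nil star_simps clinear_simps[OF L])
  next
    case (Suc n)
    then obtain a b ys where xs: "xs = (a, b) # ys" and n: "n = length ys"
      by (metis length_Suc_conv surj_pair)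
    obtain a' zs where z: "length zs = length ys" "\<forall>(c, d)\<in>set zs. \<psi> (star b * d) = 0"
      "abs_alg_tensor ys = alg_pure a' b + abs_alg_tensor zs"
      using orthogonal_decomp[OF assms(2)] by blast
    let ?A = "alg_pure (a + a') b" and ?t = "abs_alg_tensor zs"
    have e: "abs_alg_tensor xs = ?A + ?t"
      by (simp add: xs abs_alg_tensor_Cons z alg_pure_linear algebra_simps)
    have c1: "prod_functional \<phi> \<psi> (star ?A * ?t) = 0" using z(2)
      by (induction zs) (auto simp: abs_alg_tensor_Cons abs_alg_tensor_Nil distrib_left clinear_simps[OF L]
        alg_pure_simps prod_functional_pure[OF l])
    have c2: "prod_functional \<phi> \<psi> (star ?t * ?A) = 0" using z(2)
      by (induction zs) (auto simp: abs_alg_tensor_Cons abs_alg_tensor_Nil distrib_right clinear_simps[OF L]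
        alg_pure_simps prod_functional_pure[OF l] star_add star_simps pos_herm[OF assms(2), of _ b])
    have "prod_functional \<phi> \<psi> (star ?A * ?A) = \<phi> (star (a + a') * (a + a')) * \<psi> (star b * b)"
      by (simp add: alg_pure_simps prod_functional_pure[OF l])
    moreover have "\<phi> (star (a + a') * (a + a')) \<in> \<real>\<^sub>\<ge>\<^sub>0" "\<psi> (star b * b) \<in> \<real>\<^sub>\<ge>\<^sub>0"
      using assms by (auto simp: positive_functional_def)
    ultimately have "prod_functional \<phi> \<psi> (star ?A * ?A) \<in> \<real>\<^sub>\<ge>\<^sub>0"
      by (simp add: nonneg_Reals_mult_I)
    moreover have "prod_functional \<phi> \<psi> (star ?t * ?t) \<in> \<real>\<^sub>\<ge>\<^sub>0" using Suc z n by simp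
    ultimately show ?case
      by (simp add: e star_add distrib_left distrib_right clinear_simps[OF L] c1 c2 nonneg_Reals_add_I)
  qed
  show ?thesis
    unfolding positive_functional_def
    using L main by (metis Quotient3_abs_rep Quotient3_alg_tensor)
qed

lemma state_positive: "state \<phi> \<Longrightarrow> positive_functional \<phi>"
  by (simp add: state_def positive_functional_def)


section \<open>The spatial norm\<close>

text \<open>
  The spatial (= minimal) C*-norm of \<open>t\<close> is the operator norm of \<open>(\<pi> \<otimes> \<rho>) t\<close>, where \<open>\<pi>\<close>
  and \<open>\<rho>\<close> are the universal representations, i.e. the direct sums of the GNS representations
  \<open>\<pi>\<^sub>\<phi>\<close>, \<open>\<pi>\<^sub>\<psi>\<close> over all states \<open>\<phi>\<close>, \<open>\<psi>\<close>. The class of an algebraic tensor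
  \<open>y\<close> in the tensor product of the two GNS spaces has norm
  \<open>gns_norm (prod_functional \<phi> \<psi>) y\<close>, such classes form a dense subspace, and \<open>(\<pi>\<^sub>\<phi> \<otimes> \<pi>\<^sub>\<psi>) t\<close> acts on it as multiplication by
  \<open>t\<close> from the left. Hence the operator norm is the least \<open>c\<close> below.
\<close>

definition spatial_bounds :: "('a::cstar_algebra, 'b::cstar_algebra) alg_tensor \<Rightarrow> real set" where
  "spatial_bounds t = {c. 0 \<le> c \<and> (\<forall>\<phi> \<psi> y. state \<phi> \<longrightarrow> state \<psi> \<longrightarrow>
     gns_norm (prod_functional \<phi> \<psi>) (t * y) \<le> c * gns_norm (prod_functional \<phi> \<psi>) y)}"

definition spatial_norm :: "('a::cstar_algebra, 'b::cstar_algebra) alg_tensor \<Rightarrow> real" where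
  "spatial_norm t = Inf (spatial_bounds t)"

lemma state_prod_positive: "state \<phi> \<Longrightarrow> state \<psi> \<Longrightarrow> positive_functional (prod_functional \<phi> \<psi>)"
  by (simp add: state_positive positive_prod_functional)

lemma gns_bound_by_slice:
  fixes f :: "'c::cstar_algebra \<Rightarrow> ('a::cstar_algebra, 'b::cstar_algebra) alg_tensor"
  assumes \<tau>: "positive_functional \<tau>" and f: "unital_star_hom f"
    and bd: "bounded_linear (\<lambda>z. \<tau> (star y * f z * y))"
  shows "gns_norm \<tau> (f a * y) \<le> norm a * gns_norm \<tau> y"
proof -
  let ?\<sigma> = "\<lambda>z. \<tau> (star y * f z * y)"
  have l: "clinear \<tau>" using \<tau> by (simp add: positive_functional_def)
  have fl: "clinear f" and fm: "\<And>x y. f (x * y) = f x * f y" "\<And>x. f (star x) = star (f x)" "f 1 = 1"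
    using f by (auto simp: unital_star_hom_def)
  have eq: "?\<sigma> (star z * z) = \<tau> (star (f z * y) * (f z * y))" for z
    by (simp add: fm star_mult mult.assoc)
  have "positive_functional ?\<sigma>"
    unfolding positive_functional_def eq
    using \<tau> by (auto simp: positive_functional_def clinear_def clinear_simps[OF fl] clinear_simps[OF l]
      distrib_left distrib_right mult_scaleC_left mult_scaleC_right)
  from pos_bounded[OF this bd, of a]
  have "(gns_norm \<tau> (f a * y))\<^sup>2 \<le> (norm a * gns_norm \<tau> y)\<^sup>2"
    by (simp add: power_mult_distrib gns_norm_sq[OF \<tau>] fm star_mult mult.assoc)
  then show ?thesis by (rule power2_le_imp_le) (simp add: gns_norm_nonneg[OF \<tau>])
qed

lemma bounded_linear_const_mult_comp:
  "bounded_linear (\<phi> :: 'a::real_normed_algebra \<Rightarrow> complex) \<Longrightarrow> bounded_linear (\<lambda>z. \<phi> (a * z * c) * k)"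
  by (rule bounded_linear_compose[OF bounded_linear_mult_left])
    (rule bounded_linear_compose[of \<phi>], assumption,
      rule bounded_linear_compose[OF bounded_linear_mult_left bounded_linear_mult_right])

lemma slice_bounded1:
  assumes "state \<phi>" "state \<psi>"
  shows "bounded_linear (\<lambda>z. prod_functional \<phi> \<psi> (u * alg_pure z 1 * v))"
proof -
  have l: "clinear \<phi>" "clinear \<psi>" and b: "bounded_linear \<phi>" using assms by (auto simp: state_def)
  note L = clinear_prod_functional[OF l]
  show ?thesis
  proof (induction u rule: alg_tensor_induct)
    case (add a b u)
    have "bounded_linear (\<lambda>z. prod_functional \<phi> \<psi> (alg_pure a b * alg_pure z 1 * v))"
    proof (induction v rule: alg_tensor_induct)
      case (add c d v)
      then show ?case
        by (simp add: distrib_left clinear_simps[OF L] alg_pure_simps prod_functional_pure[OF l]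
          bounded_linear_add bounded_linear_const_mult_comp[OF b])
    qed (simp add: clinear_simps[OF L])
    with add show ?case
      by (simp add: distrib_right clinear_simps[OF L] bounded_linear_add)
  qed (simp add: clinear_simps[OF L])
qed

lemma slice_bounded2:
  assumes "state \<phi>" "state \<psi>"
  shows "bounded_linear (\<lambda>z. prod_functional \<phi> \<psi> (u * alg_pure 1 z * v))"
proof -
  have l: "clinear \<phi>" "clinear \<psi>" and b: "bounded_linear \<psi>" using assms by (auto simp: state_def)
  note L = clinear_prod_functional[OF l]
  show ?thesis
  proof (induction u rule: alg_tensor_induct)
    case (add a b u)
    have "bounded_linear (\<lambda>z. prod_functional \<phi> \<psi> (alg_pure a b * alg_pure 1 z * v))"
    proof (induction v rule: alg_tensor_induct)
      case (add c d v)
      then show ?case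
        by (simp add: distrib_left clinear_simps[OF L] alg_pure_simps prod_functional_pure[OF l]
          bounded_linear_add bounded_linear_const_mult_comp[OF b] mult.commute[of "\<phi> _"])
    qed (simp add: clinear_simps[OF L])
    with add show ?case
      by (simp add: distrib_right clinear_simps[OF L] bounded_linear_add)
  qed (simp add: clinear_simps[OF L])
qed

lemma spatial_bounds_pure:
  "norm a * norm b \<in> spatial_bounds (alg_pure a b)"
  unfolding spatial_bounds_def
proof (clarsimp)
  fix \<phi> :: "'a \<Rightarrow> complex" and \<psi> :: "'b \<Rightarrow> complex" and y
  assume st: "state \<phi>" "state \<psi>"
  note P = state_prod_positive[OF st]
  let ?q = "gns_norm (prod_functional \<phi> \<psi>)"
  have h1: "unital_star_hom (\<lambda>a::'a. alg_pure a (1::'b))" and h2: "unital_star_hom (\<lambda>b::'b. alg_pure (1::'a) b)"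
    by (auto simp: unital_star_hom_def clinear_def alg_pure_linear alg_pure_simps star_simps)
  have "?q (alg_pure a b * y) = ?q (alg_pure a 1 * (alg_pure 1 b * y))"
    by (simp add: mult.assoc[symmetric] alg_pure_simps)
  also have "\<dots> \<le> norm a * ?q (alg_pure 1 b * y)"
    by (rule gns_bound_by_slice[OF P h1 slice_bounded1[OF st]])
  also have "\<dots> \<le> norm a * (norm b * ?q y)"
    by (intro mult_left_mono gns_bound_by_slice[OF P h2 slice_bounded2[OF st]]) simp
  finally show "?q (alg_pure a b * y) \<le> norm a * norm b * ?q y" by (simp add: mult.assoc)
qed

lemma spatial_bounds_add:
  assumes "c \<in> spatial_bounds s" "d \<in> spatial_bounds t"
  shows "c + d \<in> spatial_bounds (s + t)"
  using assms unfolding spatial_bounds_def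
proof (clarsimp)
  fix \<phi> :: "'a \<Rightarrow> complex" and \<psi> :: "'b \<Rightarrow> complex" and y
  let ?q = "gns_norm (prod_functional \<phi> \<psi>)"
  assume st: "state \<phi>" "state \<psi>"
  assume a: "\<forall>\<phi>. state \<phi> \<longrightarrow> (\<forall>\<psi>. state \<psi> \<longrightarrow>
     (\<forall>y. gns_norm (prod_functional \<phi> \<psi>) (s * y) \<le> c * gns_norm (prod_functional \<phi> \<psi>) y))"
    "\<forall>\<phi>. state \<phi> \<longrightarrow> (\<forall>\<psi>. state \<psi> \<longrightarrow>
     (\<forall>y. gns_norm (prod_functional \<phi> \<psi>) (t * y) \<le> d * gns_norm (prod_functional \<phi> \<psi>) y))"
  have "?q ((s + t) * y) \<le> ?q (s * y) + ?q (t * y)"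
    by (simp add: distrib_right gns_norm_triangle[OF state_prod_positive[OF st]])
  also have "\<dots> \<le> c * ?q y + d * ?q y" using a st by (meson add_mono)
  finally show "?q ((s + t) * y) \<le> (c + d) * ?q y" by (simp add: distrib_right)
qed

lemma spatial_bounds_nonempty: "spatial_bounds t \<noteq> {}"
proof (induction t rule: alg_tensor_induct)
  case zero
  have "gns_norm (prod_functional \<phi> \<psi>) 0 = 0" if "state \<phi>" "state \<psi>"
    for \<phi> :: "'a \<Rightarrow> complex" and \<psi> :: "'b \<Rightarrow> complex"
    using gns_norm_scaleC[OF state_prod_positive[OF that], of 0 0] by simp
  then have "0 \<in> spatial_bounds (0 :: ('a, 'b) alg_tensor)" by (simp add: spatial_bounds_def)
  then show ?case by blast
next
  case (add a b t)
  then show ?case using spatial_bounds_add spatial_bounds_pure by blast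
qed

lemma spatial_norm_le: "c \<in> spatial_bounds t \<Longrightarrow> spatial_norm t \<le> c"
  unfolding spatial_norm_def by (rule cInf_lower) (auto simp: bdd_below_def spatial_bounds_def)

lemma spatial_norm_nonneg: "0 \<le> spatial_norm t"
  unfolding spatial_norm_def by (rule cInf_greatest[OF spatial_bounds_nonempty]) (auto simp: spatial_bounds_def)

lemma spatial_norm_bound:
  assumes "state \<phi>" "state \<psi>"
  shows "gns_norm (prod_functional \<phi> \<psi>) (t * y) \<le> spatial_norm t * gns_norm (prod_functional \<phi> \<psi>) y"
proof -
  let ?q = "gns_norm (prod_functional \<phi> \<psi>)"
  note P = state_prod_positive[OF assms]
  have le: "?q (t * y) \<le> c * ?q y" if "c \<in> spatial_bounds t" for c
    using that assms by (simp add: spatial_bounds_def)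
  show ?thesis
  proof (cases "?q y = 0")
    case True
    then show ?thesis using le spatial_bounds_nonempty[of t] by fastforce
  next
    case False
    then have pos: "?q y > 0" using gns_norm_nonneg[OF P, of y] by simp
    then have "?q (t * y) / ?q y \<le> spatial_norm t"
      unfolding spatial_norm_def
      by (intro cInf_greatest spatial_bounds_nonempty) (simp add: divide_le_eq le)
    then show ?thesis using pos by (simp add: divide_le_eq)
  qed
qed

lemma spatial_norm_mem: "spatial_norm t \<in> spatial_bounds t"
  by (simp add: spatial_bounds_def spatial_norm_nonneg spatial_norm_bound)

lemma spatial_norm_triangle: "spatial_norm (s + t) \<le> spatial_norm s + spatial_norm t"
  by (intro spatial_norm_le spatial_bounds_add spatial_norm_mem)

lemma spatial_norm_scaleC_le: "spatial_norm (c *\<^sub>C t) \<le> cmod c * spatial_norm t"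
proof (rule spatial_norm_le)
  show "cmod c * spatial_norm t \<in> spatial_bounds (c *\<^sub>C t)"
    by (auto simp: spatial_bounds_def spatial_norm_nonneg mult_scaleC_left gns_norm_scaleC
      state_prod_positive mult.assoc intro!: mult_left_mono spatial_norm_bound)
qed

lemma spatial_norm_scaleC: "spatial_norm (c *\<^sub>C t) = cmod c * spatial_norm t"
proof (cases "c = 0")
  case True
  then show ?thesis using spatial_norm_scaleC_le[of c t] spatial_norm_nonneg[of "c *\<^sub>C t"] by simp
next
  case False
  have "spatial_norm (inverse c *\<^sub>C (c *\<^sub>C t)) \<le> cmod (inverse c) * spatial_norm (c *\<^sub>C t)"
    by (rule spatial_norm_scaleC_le)
  then have "cmod c * spatial_norm t \<le> spatial_norm (c *\<^sub>C t)"
    using False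
    by (simp add: norm_inverse inverse_eq_divide[of "cmod c"] pos_le_divide_eq mult.commute del: inverse_eq_divide)
  then show ?thesis using spatial_norm_scaleC_le[of c t] by simp
qed

lemma spatial_norm_mult: "spatial_norm (s * t) \<le> spatial_norm s * spatial_norm t"
proof (rule spatial_norm_le)
  have "gns_norm (prod_functional \<phi> \<psi>) (s * t * y) \<le> spatial_norm s * spatial_norm t * gns_norm (prod_functional \<phi> \<psi>) y"
    if "state \<phi>" "state \<psi>" for \<phi> :: "'a \<Rightarrow> complex" and \<psi> :: "'b \<Rightarrow> complex" and y
    using spatial_norm_bound[OF that, of s "t * y"]
      mult_left_mono[OF spatial_norm_bound[OF that, of t y] spatial_norm_nonneg[of s]]
    by (simp add: mult.assoc)
  then show "spatial_norm s * spatial_norm t \<in> spatial_bounds (s * t)"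
    by (simp add: spatial_bounds_def spatial_norm_nonneg)
qed

lemma spatial_norm_star_le: "spatial_norm (star t) \<le> spatial_norm t"
proof (rule spatial_norm_le)
  have "gns_norm (prod_functional \<phi> \<psi>) (star t * y) \<le> spatial_norm t * gns_norm (prod_functional \<phi> \<psi>) y"
    if st: "state \<phi>" "state \<psi>" for \<phi> :: "'a \<Rightarrow> complex" and \<psi> :: "'b \<Rightarrow> complex" and y
  proof -
    note P = state_prod_positive[OF st]
    let ?q = "gns_norm (prod_functional \<phi> \<psi>)"
    let ?z = "star t * y"
    have "(?q ?z)\<^sup>2 = Re (prod_functional \<phi> \<psi> (star y * (t * ?z)))"
      by (simp add: gns_norm_sq[OF P] star_mult star_star mult.assoc)
    also have "\<dots> \<le> ?q y * ?q (t * ?z)"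
      using gns_CS[OF P, of y "t * ?z"] complex_Re_le_cmod order_trans by blast
    also have "\<dots> \<le> ?q y * (spatial_norm t * ?q ?z)"
      by (intro mult_left_mono spatial_norm_bound[OF st] gns_norm_nonneg[OF P])
    finally have "?q ?z * ?q ?z \<le> (spatial_norm t * ?q y) * ?q ?z"
      by (simp add: power2_eq_square mult_ac)
    then show ?thesis
      using gns_norm_nonneg[OF P, of ?z] gns_norm_nonneg[OF P, of y] spatial_norm_nonneg[of t]
      by (cases "?q ?z = 0") auto
  qed
  then show "spatial_norm t \<in> spatial_bounds (star t)"
    by (simp add: spatial_bounds_def spatial_norm_nonneg)
qed

lemma spatial_norm_star: "spatial_norm (star t) = spatial_norm t"
  using spatial_norm_star_le[of t] spatial_norm_star_le[of "star t"] by (simp add: star_star)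

lemma spatial_norm_cstar: "spatial_norm (star t * t) = (spatial_norm t)\<^sup>2"
proof (rule antisym)
  show "spatial_norm (star t * t) \<le> (spatial_norm t)\<^sup>2"
    using spatial_norm_mult[of "star t" t] by (simp add: spatial_norm_star power2_eq_square)
  have "spatial_norm t \<le> sqrt (spatial_norm (star t * t))"
  proof (rule spatial_norm_le)
    have "gns_norm (prod_functional \<phi> \<psi>) (t * y) \<le> sqrt (spatial_norm (star t * t)) * gns_norm (prod_functional \<phi> \<psi>) y"
      if st: "state \<phi>" "state \<psi>" for \<phi> :: "'a \<Rightarrow> complex" and \<psi> :: "'b \<Rightarrow> complex" and y
    proof -
      note P = state_prod_positive[OF st]
      let ?q = "gns_norm (prod_functional \<phi> \<psi>)"
      have "(?q (t * y))\<^sup>2 = Re (prod_functional \<phi> \<psi> (star y * ((star t * t) * y)))"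
        by (simp add: gns_norm_sq[OF P] star_mult mult.assoc)
      also have "\<dots> \<le> ?q y * ?q ((star t * t) * y)"
        using gns_CS[OF P, of y "star t * t * y"] complex_Re_le_cmod order_trans by blast
      also have "\<dots> \<le> ?q y * (spatial_norm (star t * t) * ?q y)"
        by (intro mult_left_mono spatial_norm_bound[OF st] gns_norm_nonneg[OF P])
      also have "\<dots> = (sqrt (spatial_norm (star t * t)) * ?q y)\<^sup>2"
        by (simp add: power_mult_distrib spatial_norm_nonneg power2_eq_square[of "?q y"] mult_ac)
      finally show ?thesis
        by (rule power2_le_imp_le) (simp add: spatial_norm_nonneg gns_norm_nonneg[OF P])
    qed
    then show "sqrt (spatial_norm (star t * t)) \<in> spatial_bounds t"
      by (simp add: spatial_bounds_def spatial_norm_nonneg)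
  qed
  then have "(spatial_norm t)\<^sup>2 \<le> (sqrt (spatial_norm (star t * t)))\<^sup>2"
    by (intro power_mono spatial_norm_nonneg)
  then show "(spatial_norm t)\<^sup>2 \<le> spatial_norm (star t * t)" by (simp add: spatial_norm_nonneg)
qed


lemma spatial_norm_0 [simp]: "spatial_norm 0 = 0"
  using spatial_norm_scaleC[of 0 0] by simp

lemma spatial_norm_minus: "spatial_norm (- t) = spatial_norm t"
  using spatial_norm_scaleC[of "-1" t] by simp

lemma spatial_norm_diff_commute: "spatial_norm (s - t) = spatial_norm (t - s)"
  using spatial_norm_minus[of "s - t"] by simp

lemma spatial_norm_triangle3: "spatial_norm (s - u) \<le> spatial_norm (s - t) + spatial_norm (t - u)"
  using spatial_norm_triangle[of "s - t" "t - u"] by simp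

lemma spatial_norm_triangle_diff: "\<bar>spatial_norm s - spatial_norm t\<bar> \<le> spatial_norm (s - t)"
  using spatial_norm_triangle[of "s - t" t] spatial_norm_triangle[of "t - s" s] spatial_norm_diff_commute[of s t]
  by simp

lemma spatial_norm_mult_diff:
  "spatial_norm (s * t - s' * t') \<le> spatial_norm s * spatial_norm (t - t') + spatial_norm (s - s') * spatial_norm t'"
proof -
  have "s * t - s' * t' = s * (t - t') + (s - s') * t'" by (simp add: algebra_simps)
  then show ?thesis
    using spatial_norm_triangle[of "s * (t - t')" "(s - s') * t'"]
      spatial_norm_mult[of s "t - t'"] spatial_norm_mult[of "s - s'" t'] by simp
qed


section \<open>The minimal tensor product\<close>

text \<open>
  The completion of the algebraic tensor product in the spatial norm: Cauchy sequences modulo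
  sequences whose difference tends to zero.
\<close>

definition spatial_Cauchy :: "(nat \<Rightarrow> ('a::cstar_algebra, 'b::cstar_algebra) alg_tensor) \<Rightarrow> bool" where
  "spatial_Cauchy X \<longleftrightarrow> (\<forall>e>0. \<exists>N. \<forall>m\<ge>N. \<forall>n\<ge>N. spatial_norm (X m - X n) < e)"

definition same_limit :: "(nat \<Rightarrow> ('a::cstar_algebra, 'b::cstar_algebra) alg_tensor) \<Rightarrow> (nat \<Rightarrow> ('a, 'b) alg_tensor) \<Rightarrow> bool" where
  "same_limit X Y \<longleftrightarrow> spatial_Cauchy X \<and> spatial_Cauchy Y \<and> (\<lambda>n. spatial_norm (X n - Y n)) \<longlonglongrightarrow> 0"

lemma spatial_Cauchy_const [simp]: "spatial_Cauchy (\<lambda>n. t)"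
  by (simp add: spatial_Cauchy_def)

lemma spatial_Cauchy_dominated:
  assumes X: "spatial_Cauchy X" and Y: "spatial_Cauchy Y" and K: "K \<ge> 0"
    and le: "\<And>m n. spatial_norm (Z m - Z n) \<le> K * (spatial_norm (X m - X n) + spatial_norm (Y m - Y n))"
  shows "spatial_Cauchy Z"
  unfolding spatial_Cauchy_def
proof (intro allI impI)
  fix e :: real assume e: "e > 0"
  define d where "d = e / (2 * (K + 1))"
  have d: "d > 0" using e K by (simp add: d_def)
  obtain M where M: "\<And>m n. m \<ge> M \<Longrightarrow> n \<ge> M \<Longrightarrow> spatial_norm (X m - X n) < d"
    using X d unfolding spatial_Cauchy_def by blast
  obtain N where N: "\<And>m n. m \<ge> N \<Longrightarrow> n \<ge> N \<Longrightarrow> spatial_norm (Y m - Y n) < d"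
    using Y d unfolding spatial_Cauchy_def by blast
  have "spatial_norm (Z m - Z n) < e" if "m \<ge> max M N" "n \<ge> max M N" for m n
  proof -
    have "spatial_norm (Z m - Z n) \<le> K * (2 * d)"
      using le[of m n] M[of m n] N[of m n] that K
        mult_left_mono[of "spatial_norm (X m - X n) + spatial_norm (Y m - Y n)" "2 * d" K] by simp
    also have "\<dots> < (K + 1) * (2 * d)" using d by simp
    also have "\<dots> = e" using K by (simp add: d_def field_simps)
    finally show ?thesis .
  qed
  then show "\<exists>N. \<forall>m\<ge>N. \<forall>n\<ge>N. spatial_norm (Z m - Z n) < e" by blast
qed

lemma spatial_Cauchy_norm: "spatial_Cauchy X \<Longrightarrow> Cauchy (\<lambda>n. spatial_norm (X n))"
proof (rule metric_CauchyI)
  fix e :: real assume "spatial_Cauchy X" "e > 0"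
  then obtain N where N: "\<And>m n. m \<ge> N \<Longrightarrow> n \<ge> N \<Longrightarrow> spatial_norm (X m - X n) < e"
    unfolding spatial_Cauchy_def by blast
  have "dist (spatial_norm (X m)) (spatial_norm (X n)) < e" if "m \<ge> N" "n \<ge> N" for m n
    using spatial_norm_triangle_diff[of "X m" "X n"] N[OF that] by (simp add: dist_real_def)
  then show "\<exists>N. \<forall>m\<ge>N. \<forall>n\<ge>N. dist (spatial_norm (X m)) (spatial_norm (X n)) < e" by blast
qed

lemma spatial_Cauchy_norm_lim: "spatial_Cauchy X \<Longrightarrow> (\<lambda>n. spatial_norm (X n)) \<longlonglongrightarrow> lim (\<lambda>n. spatial_norm (X n))"
  using spatial_Cauchy_norm Cauchy_convergent convergent_LIMSEQ_iff by blast

lemma spatial_Cauchy_bounded: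
  assumes "spatial_Cauchy X"
  obtains K where "K \<ge> 0" "\<And>n. spatial_norm (X n) \<le> K"
proof -
  have "Bseq (\<lambda>n. spatial_norm (X n))"
    using Cauchy_Bseq[OF spatial_Cauchy_norm[OF assms]] .
  then obtain K where "K > 0" "\<And>n. norm (spatial_norm (X n)) \<le> K" by (auto elim: BseqE)
  then show ?thesis using that[of K] by (simp add: spatial_norm_nonneg)
qed

lemma spatial_Cauchy_add: "spatial_Cauchy X \<Longrightarrow> spatial_Cauchy Y \<Longrightarrow> spatial_Cauchy (\<lambda>n. X n + Y n)"
proof (rule spatial_Cauchy_dominated[of X Y 1])
  fix m n
  have "X m + Y m - (X n + Y n) = (X m - X n) + (Y m - Y n)" by (simp add: algebra_simps)
  then show "spatial_norm (X m + Y m - (X n + Y n)) \<le> 1 * (spatial_norm (X m - X n) + spatial_norm (Y m - Y n))"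
    using spatial_norm_triangle[of "X m - X n" "Y m - Y n"] by (simp only: mult_1_left)
qed auto

lemma spatial_Cauchy_scaleC: "spatial_Cauchy X \<Longrightarrow> spatial_Cauchy (\<lambda>n. c *\<^sub>C X n)"
  by (rule spatial_Cauchy_dominated[of X X "cmod c / 2"])
    (simp_all add: spatial_norm_scaleC complex_vector.scale_right_diff_distrib[symmetric])

lemma spatial_Cauchy_star: "spatial_Cauchy X \<Longrightarrow> spatial_Cauchy (\<lambda>n. star (X n))"
  by (rule spatial_Cauchy_dominated[of X X "1 / 2"])
    (simp_all add: spatial_norm_star star_simps(3)[symmetric])

lemma spatial_Cauchy_mult:
  assumes "spatial_Cauchy X" "spatial_Cauchy Y"
  shows "spatial_Cauchy (\<lambda>n. X n * Y n)"
proof -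
  obtain K where K: "K \<ge> 0" "\<And>n. spatial_norm (X n) \<le> K" using spatial_Cauchy_bounded[OF assms(1)] by blast
  obtain L where L: "L \<ge> 0" "\<And>n. spatial_norm (Y n) \<le> L" using spatial_Cauchy_bounded[OF assms(2)] by blast
  show ?thesis
  proof (rule spatial_Cauchy_dominated[OF assms, of "K + L"])
    fix m n
    have "spatial_norm (X m * Y m - X n * Y n) \<le>
        spatial_norm (X m) * spatial_norm (Y m - Y n) + spatial_norm (X m - X n) * spatial_norm (Y n)"
      by (rule spatial_norm_mult_diff)
    also have "\<dots> \<le> (K + L) * spatial_norm (Y m - Y n) + spatial_norm (X m - X n) * (K + L)"
      using K L spatial_norm_nonneg by (intro add_mono mult_mono) (auto intro: add_increasing add_increasing2)
    finally show "spatial_norm (X m * Y m - X n * Y n) \<le>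
        (K + L) * (spatial_norm (X m - X n) + spatial_norm (Y m - Y n))" by (simp add: algebra_simps)
  qed (use K L in auto)
qed

lemma same_limit_refl: "same_limit X X \<longleftrightarrow> spatial_Cauchy X"
  by (simp add: same_limit_def)

lemma same_limitI:
  assumes "spatial_Cauchy X" "spatial_Cauchy Y" "F \<longlonglongrightarrow> (0::real)" "\<And>n. spatial_norm (X n - Y n) \<le> F n"
  shows "same_limit X Y"
  using assms unfolding same_limit_def
  by (auto intro!: tendsto_sandwich[of "\<lambda>n. 0" "\<lambda>n. spatial_norm (X n - Y n)" sequentially F 0]
    simp: spatial_norm_nonneg)

lemma same_limit_sym: "same_limit X Y \<Longrightarrow> same_limit Y X"
  by (simp add: same_limit_def spatial_norm_diff_commute)

lemma same_limit_trans: "same_limit X Y \<Longrightarrow> same_limit Y Z \<Longrightarrow> same_limit X Z"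
proof -
  assume a: "same_limit X Y" "same_limit Y Z"
  then have "(\<lambda>n. spatial_norm (X n - Y n) + spatial_norm (Y n - Z n)) \<longlonglongrightarrow> 0 + 0"
    by (intro tendsto_add) (auto simp: same_limit_def)
  then show ?thesis
    using a spatial_norm_triangle3
    by (intro same_limitI[where F = "\<lambda>n. spatial_norm (X n - Y n) + spatial_norm (Y n - Z n)"])
      (auto simp: same_limit_def)
qed

quotient_type (overloaded) ('a, 'b) min_tensor (infixr "\<otimes>" 75) =
  "nat \<Rightarrow> ('a::cstar_algebra, 'b::cstar_algebra) alg_tensor" / partial: same_limit
proof (rule part_equivpI)
  show "\<exists>X :: nat \<Rightarrow> ('a, 'b) alg_tensor. same_limit X X"
    by (rule exI[of _ "\<lambda>n. 0"]) (simp add: same_limit_refl)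
  show "symp (same_limit :: (nat \<Rightarrow> ('a, 'b) alg_tensor) \<Rightarrow> _)"
    by (rule sympI) (rule same_limit_sym)
  show "transp (same_limit :: (nat \<Rightarrow> ('a, 'b) alg_tensor) \<Rightarrow> _)"
    by (rule transpI) (rule same_limit_trans)
qed

lemma min_tensor_exhaust: "\<exists>X. spatial_Cauchy X \<and> x = abs_min_tensor X"
  using Quotient3_abs_rep[OF Quotient3_min_tensor, of x] Quotient3_rep_reflp[OF Quotient3_min_tensor, of x]
  by (metis same_limit_refl)

lemma abs_min_tensor_eqI: "same_limit X Y \<Longrightarrow> abs_min_tensor X = abs_min_tensor Y"
  by (rule Quotient3_rel_abs[OF Quotient3_min_tensor])

lemma same_limit_rep_abs: "spatial_Cauchy X \<Longrightarrow> same_limit (rep_min_tensor (abs_min_tensor X)) X"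
  using rep_abs_rsp_left[OF Quotient3_min_tensor, of X X] by (simp add: same_limit_refl)

lemma same_limit_add:
  assumes "same_limit X X'" "same_limit Y Y'"
  shows "same_limit (\<lambda>n. X n + Y n) (\<lambda>n. X' n + Y' n)"
proof (rule same_limitI)
  show "(\<lambda>n. spatial_norm (X n - X' n) + spatial_norm (Y n - Y' n)) \<longlonglongrightarrow> 0"
    using assms tendsto_add[of "\<lambda>n. spatial_norm (X n - X' n)" 0 _ "\<lambda>n. spatial_norm (Y n - Y' n)" 0]
    by (simp add: same_limit_def)
  fix n
  have "X n + Y n - (X' n + Y' n) = (X n - X' n) + (Y n - Y' n)" by (simp add: algebra_simps)
  then show "spatial_norm (X n + Y n - (X' n + Y' n)) \<le> spatial_norm (X n - X' n) + spatial_norm (Y n - Y' n)"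
    using spatial_norm_triangle[of "X n - X' n" "Y n - Y' n"] by (simp only:)
qed (use assms in \<open>auto simp: same_limit_def intro: spatial_Cauchy_add\<close>)

lemma same_limit_scaleC:
  assumes "same_limit X Y"
  shows "same_limit (\<lambda>n. c *\<^sub>C X n) (\<lambda>n. c *\<^sub>C Y n)"
  using assms tendsto_mult_left[of "\<lambda>n. spatial_norm (X n - Y n)" 0 sequentially "cmod c"]
  by (simp add: same_limit_def spatial_Cauchy_scaleC spatial_norm_scaleC
     complex_vector.scale_right_diff_distrib[symmetric])

lemma same_limit_star: "same_limit X Y \<Longrightarrow> same_limit (\<lambda>n. star (X n)) (\<lambda>n. star (Y n))"
  by (simp add: same_limit_def spatial_Cauchy_star spatial_norm_star star_simps(3)[symmetric])

lemma same_limit_mult: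
  assumes "same_limit X X'" "same_limit Y Y'"
  shows "same_limit (\<lambda>n. X n * Y n) (\<lambda>n. X' n * Y' n)"
proof -
  have C: "spatial_Cauchy X" "spatial_Cauchy Y'" using assms by (auto simp: same_limit_def)
  obtain K where K: "K \<ge> 0" "\<And>n. spatial_norm (X n) \<le> K" using spatial_Cauchy_bounded[OF C(1)] by blast
  obtain L where L: "L \<ge> 0" "\<And>n. spatial_norm (Y' n) \<le> L" using spatial_Cauchy_bounded[OF C(2)] by blast
  show ?thesis
  proof (rule same_limitI)
    have "(\<lambda>n. K * spatial_norm (Y n - Y' n) + spatial_norm (X n - X' n) * L) \<longlonglongrightarrow> K * 0 + 0 * L"
      using assms by (intro tendsto_intros) (auto simp: same_limit_def)
    then show "(\<lambda>n. K * spatial_norm (Y n - Y' n) + spatial_norm (X n - X' n) * L) \<longlonglongrightarrow> 0" by simp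
    show "spatial_norm (X n * Y n - X' n * Y' n) \<le> K * spatial_norm (Y n - Y' n) + spatial_norm (X n - X' n) * L" for n
      by (rule order_trans[OF spatial_norm_mult_diff add_mono[OF mult_right_mono mult_left_mono]])
        (auto simp: K L spatial_norm_nonneg)
  qed (use assms in \<open>auto simp: same_limit_def intro: spatial_Cauchy_mult\<close>)
qed

lemma same_limit_norm:
  assumes "same_limit X Y"
  shows "lim (\<lambda>n. spatial_norm (X n)) = lim (\<lambda>n. spatial_norm (Y n))"
proof -
  have C: "spatial_Cauchy X" "spatial_Cauchy Y" and 0: "(\<lambda>n. spatial_norm (X n - Y n)) \<longlonglongrightarrow> 0"
    using assms by (auto simp: same_limit_def)
  have "(\<lambda>n. spatial_norm (X n) - spatial_norm (Y n)) \<longlonglongrightarrow> 0"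
    by (rule tendsto_rabs_zero_cancel, rule tendsto_sandwich[OF _ _ tendsto_const 0])
      (auto simp: spatial_norm_triangle_diff)
  moreover have "(\<lambda>n. spatial_norm (X n) - spatial_norm (Y n)) \<longlonglongrightarrow>
     lim (\<lambda>n. spatial_norm (X n)) - lim (\<lambda>n. spatial_norm (Y n))"
    by (intro tendsto_diff spatial_Cauchy_norm_lim C)
  ultimately show ?thesis using LIMSEQ_unique by fastforce
qed

instantiation min_tensor :: (cstar_algebra, cstar_algebra) star_algebra
begin

definition zero_min_tensor :: "'a \<otimes> 'b" where
  "zero_min_tensor = abs_min_tensor (\<lambda>n. 0)"
definition one_min_tensor :: "'a \<otimes> 'b" where
  "one_min_tensor = abs_min_tensor (\<lambda>n. 1)"
definition plus_min_tensor :: "'a \<otimes> 'b \<Rightarrow> 'a \<otimes> 'b \<Rightarrow> 'a \<otimes> 'b" where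
  "plus_min_tensor x y = abs_min_tensor (\<lambda>n. rep_min_tensor x n + rep_min_tensor y n)"
definition scaleC_min_tensor :: "complex \<Rightarrow> 'a \<otimes> 'b \<Rightarrow> 'a \<otimes> 'b" where
  "scaleC_min_tensor c x = abs_min_tensor (\<lambda>n. c *\<^sub>C rep_min_tensor x n)"
definition times_min_tensor :: "'a \<otimes> 'b \<Rightarrow> 'a \<otimes> 'b \<Rightarrow> 'a \<otimes> 'b" where
  "times_min_tensor x y = abs_min_tensor (\<lambda>n. rep_min_tensor x n * rep_min_tensor y n)"
definition star_min_tensor :: "'a \<otimes> 'b \<Rightarrow> 'a \<otimes> 'b" where
  "star_min_tensor x = abs_min_tensor (\<lambda>n. star (rep_min_tensor x n))"
definition uminus_min_tensor :: "'a \<otimes> 'b \<Rightarrow> 'a \<otimes> 'b" where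
  "uminus_min_tensor x = (-1) *\<^sub>C x"
definition minus_min_tensor :: "'a \<otimes> 'b \<Rightarrow> 'a \<otimes> 'b \<Rightarrow> 'a \<otimes> 'b" where
  "minus_min_tensor x y = x + (-1) *\<^sub>C y"
definition scaleR_min_tensor :: "real \<Rightarrow> 'a \<otimes> 'b \<Rightarrow> 'a \<otimes> 'b" where
  "scaleR_min_tensor r x = complex_of_real r *\<^sub>C x"

lemma plus_min_tensor_abs: "spatial_Cauchy X \<Longrightarrow> spatial_Cauchy Y \<Longrightarrow>
    abs_min_tensor X + abs_min_tensor Y = (abs_min_tensor (\<lambda>n. X n + Y n) :: 'a \<otimes> 'b)"
  unfolding plus_min_tensor_def by (intro abs_min_tensor_eqI same_limit_add same_limit_rep_abs)

lemma times_min_tensor_abs: "spatial_Cauchy X \<Longrightarrow> spatial_Cauchy Y \<Longrightarrow>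
    abs_min_tensor X * abs_min_tensor Y = (abs_min_tensor (\<lambda>n. X n * Y n) :: 'a \<otimes> 'b)"
  unfolding times_min_tensor_def by (intro abs_min_tensor_eqI same_limit_mult same_limit_rep_abs)

lemma scaleC_min_tensor_abs: "spatial_Cauchy X \<Longrightarrow>
    c *\<^sub>C abs_min_tensor X = (abs_min_tensor (\<lambda>n. c *\<^sub>C X n) :: 'a \<otimes> 'b)"
  unfolding scaleC_min_tensor_def by (intro abs_min_tensor_eqI same_limit_scaleC same_limit_rep_abs)

lemma star_min_tensor_abs: "spatial_Cauchy X \<Longrightarrow>
    star (abs_min_tensor X) = (abs_min_tensor (\<lambda>n. star (X n)) :: 'a \<otimes> 'b)"
  unfolding star_min_tensor_def by (intro abs_min_tensor_eqI same_limit_star same_limit_rep_abs)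

instance
proof
  fix x y z :: "'a \<otimes> 'b" and c :: complex and r s :: real
  obtain X where X: "spatial_Cauchy X" "x = abs_min_tensor X" using min_tensor_exhaust by blast
  obtain Y where Y: "spatial_Cauchy Y" "y = abs_min_tensor Y" using min_tensor_exhaust by blast
  obtain Z where Z: "spatial_Cauchy Z" "z = abs_min_tensor Z" using min_tensor_exhaust by blast
  note abs = plus_min_tensor_abs times_min_tensor_abs scaleC_min_tensor_abs star_min_tensor_abs
    zero_min_tensor_def one_min_tensor_def
  note eqs = X Y Z abs same_limit_refl spatial_Cauchy_add spatial_Cauchy_mult spatial_Cauchy_scaleC
    spatial_Cauchy_star spatial_Cauchy_const
  show "x + y + z = x + (y + z)" by (simp add: eqs add.assoc)
  show "x + y = y + x" by (simp add: eqs add.commute)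
  show "0 + x = x" by (simp add: eqs)
  show "- x + x = 0" unfolding uminus_min_tensor_def by (simp only: eqs) simp
  show "x - y = x + - y" by (simp add: minus_min_tensor_def uminus_min_tensor_def)
  show C1: "c *\<^sub>C (x + y) = c *\<^sub>C x + c *\<^sub>C y" for c by (simp add: eqs scaleC_add_right)
  show C2: "(c + d) *\<^sub>C x = c *\<^sub>C x + d *\<^sub>C x" for c d by (simp add: eqs scaleC_add_left)
  show C3: "c *\<^sub>C d *\<^sub>C x = (c * d) *\<^sub>C x" for c d by (simp add: eqs)
  show "complex_of_real r *\<^sub>C x = r *\<^sub>R x" by (simp add: scaleR_min_tensor_def)
  show "r *\<^sub>R (x + y) = r *\<^sub>R x + r *\<^sub>R y" by (simp add: scaleR_min_tensor_def C1)
  show "(r + s) *\<^sub>R x = r *\<^sub>R x + s *\<^sub>R x" by (simp add: scaleR_min_tensor_def C2)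
  show "r *\<^sub>R s *\<^sub>R x = (r * s) *\<^sub>R x" by (simp add: scaleR_min_tensor_def C3)
  show "1 *\<^sub>R x = x" by (simp add: scaleR_min_tensor_def eqs)
  show M1: "(c *\<^sub>C x) * y = c *\<^sub>C (x * y)" for c by (simp add: eqs mult_scaleC_left)
  show M2: "x * (c *\<^sub>C y) = c *\<^sub>C (x * y)" for c by (simp add: eqs mult_scaleC_right)
  show "(r *\<^sub>R x) * y = r *\<^sub>R (x * y)" "x * (r *\<^sub>R y) = r *\<^sub>R (x * y)"
    by (simp_all add: scaleR_min_tensor_def M1 M2)
  show "x * y * z = x * (y * z)" by (simp add: eqs mult.assoc)
  show "(x + y) * z = x * z + y * z" by (simp add: eqs distrib_right)
  show "x * (y + z) = x * y + x * z" by (simp add: eqs distrib_left)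
  show "1 * x = x" by (simp add: eqs)
  show "x * 1 = x" by (simp add: eqs)
  show "star (x + y) = star x + star y" by (simp add: eqs star_add)
  show "star (c *\<^sub>C x) = cnj c *\<^sub>C star x" by (simp add: eqs star_scaleC)
  show "star (x * y) = star y * star x" by (simp add: eqs star_mult)
  show "star (star x) = x" by (simp add: eqs star_star)
qed

end

definition alg_embed :: "('a::cstar_algebra, 'b::cstar_algebra) alg_tensor \<Rightarrow> 'a \<otimes> 'b" where
  "alg_embed t = abs_min_tensor (\<lambda>n. t)"

lemma minus_min_tensor_abs:
  "spatial_Cauchy X \<Longrightarrow> spatial_Cauchy Y \<Longrightarrow> abs_min_tensor X - abs_min_tensor Y = abs_min_tensor (\<lambda>n. X n - Y n)"
proof -
  assume C: "spatial_Cauchy X" "spatial_Cauchy Y"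
  have "abs_min_tensor X - abs_min_tensor Y = abs_min_tensor X + (-1) *\<^sub>C abs_min_tensor Y"
    by (rule minus_min_tensor_def)
  also have "\<dots> = abs_min_tensor (\<lambda>n. X n + (-1) *\<^sub>C Y n)"
    by (simp only: scaleC_min_tensor_abs plus_min_tensor_abs spatial_Cauchy_scaleC C)
  finally show ?thesis by simp
qed

instantiation min_tensor :: (cstar_algebra, cstar_algebra) real_normed_algebra
begin

definition norm_min_tensor :: "'a \<otimes> 'b \<Rightarrow> real" where
  "norm_min_tensor x = lim (\<lambda>n. spatial_norm (rep_min_tensor x n))"

definition dist_min_tensor :: "'a \<otimes> 'b \<Rightarrow> 'a \<otimes> 'b \<Rightarrow> real" where
  "dist_min_tensor x y = norm (x - y)"

definition sgn_min_tensor :: "'a \<otimes> 'b \<Rightarrow> 'a \<otimes> 'b" where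
  "sgn_min_tensor x = x /\<^sub>R norm x"

definition uniformity_min_tensor :: "(('a \<otimes> 'b) \<times> ('a \<otimes> 'b)) filter" where
  "uniformity_min_tensor = (INF e\<in>{0<..}. principal {(x, y). dist x y < e})"

definition open_min_tensor :: "('a \<otimes> 'b) set \<Rightarrow> bool" where
  "open_min_tensor U \<longleftrightarrow> (\<forall>x\<in>U. eventually (\<lambda>(x', y). x' = x \<longrightarrow> y \<in> U) uniformity)"

lemma norm_min_tensor_abs: "spatial_Cauchy X \<Longrightarrow>
    norm (abs_min_tensor X :: 'a \<otimes> 'b) = lim (\<lambda>n. spatial_norm (X n))"
  unfolding norm_min_tensor_def by (intro same_limit_norm same_limit_rep_abs)

instance
proof
  fix x y :: "'a \<otimes> 'b" and r :: real and U :: "('a \<otimes> 'b) set"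
  show "dist x y = norm (x - y)" by (rule dist_min_tensor_def)
  show "sgn x = x /\<^sub>R norm x" by (rule sgn_min_tensor_def)
  show "uniformity = (INF e\<in>{0<..}. principal {(x, y::'a \<otimes> 'b). dist x y < e})"
    by (rule uniformity_min_tensor_def)
  show "open U \<longleftrightarrow> (\<forall>x\<in>U. eventually (\<lambda>(x', y). x' = x \<longrightarrow> y \<in> U) uniformity)"
    by (rule open_min_tensor_def)
  obtain X where X: "spatial_Cauchy X" "x = abs_min_tensor X" using min_tensor_exhaust by blast
  obtain Y where Y: "spatial_Cauchy Y" "y = abs_min_tensor Y" using min_tensor_exhaust by blast
  note C = X(1) Y(1) and xy = X(2) Y(2)
  note lim = spatial_Cauchy_norm_lim[OF C(1)] spatial_Cauchy_norm_lim[OF C(2)]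
  note abs = xy C same_limit_refl norm_min_tensor_abs plus_min_tensor_abs times_min_tensor_abs
    scaleC_min_tensor_abs spatial_Cauchy_add spatial_Cauchy_mult spatial_Cauchy_scaleC
  have "x = 0 \<longleftrightarrow> same_limit X (\<lambda>n. 0)"
    using Quotient3_rel[OF Quotient3_min_tensor, of X "\<lambda>n. 0"] C by (simp add: xy zero_min_tensor_def same_limit_refl)
  moreover have "same_limit X (\<lambda>n. 0) \<longleftrightarrow> (\<lambda>n. spatial_norm (X n)) \<longlonglongrightarrow> 0"
    by (simp add: same_limit_def C)
  moreover have "\<dots> \<longleftrightarrow> norm x = 0"
    using lim(1) limI by (auto simp: xy norm_min_tensor_abs C)
  ultimately show "norm x = 0 \<longleftrightarrow> x = 0" by simp
  have "lim (\<lambda>n. spatial_norm (X n + Y n)) \<le> lim (\<lambda>n. spatial_norm (X n)) + lim (\<lambda>n. spatial_norm (Y n))"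
    using spatial_norm_triangle
    by (intro LIMSEQ_le[OF spatial_Cauchy_norm_lim[OF spatial_Cauchy_add[OF C]] tendsto_add[OF lim]]) blast
  then show "norm (x + y) \<le> norm x + norm y" by (simp add: abs)
  have "lim (\<lambda>n. \<bar>r\<bar> * spatial_norm (X n)) = \<bar>r\<bar> * lim (\<lambda>n. spatial_norm (X n))"
    by (intro limI tendsto_mult_left lim)
  then show "norm (r *\<^sub>R x) = \<bar>r\<bar> * norm x"
    by (simp add: scaleR_min_tensor_def abs spatial_norm_scaleC)
  have "lim (\<lambda>n. spatial_norm (X n * Y n)) \<le> lim (\<lambda>n. spatial_norm (X n)) * lim (\<lambda>n. spatial_norm (Y n))"
    using spatial_norm_mult
    by (intro LIMSEQ_le[OF spatial_Cauchy_norm_lim[OF spatial_Cauchy_mult[OF C]] tendsto_mult[OF lim]]) blast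
  then show "norm (x * y) \<le> norm x * norm y" by (simp add: abs)
qed

end

lemma norm_alg_embed: "norm (alg_embed t) = spatial_norm t"
  by (simp add: alg_embed_def norm_min_tensor_abs same_limit_refl)

lemma alg_embed_diff: "alg_embed (s - t) = alg_embed s - alg_embed t"
  by (simp add: alg_embed_def minus_min_tensor_abs)

lemma abs_min_tensor_limit:
  assumes C: "spatial_Cauchy X"
  shows "(\<lambda>n. alg_embed (X n)) \<longlonglongrightarrow> abs_min_tensor X"
proof (rule metric_LIMSEQ_I)
  fix e :: real assume e: "e > 0"
  obtain N where N: "\<And>m n. m \<ge> N \<Longrightarrow> n \<ge> N \<Longrightarrow> spatial_norm (X m - X n) < e / 2"
    using C e unfolding spatial_Cauchy_def by (meson half_gt_zero)
  have "dist (alg_embed (X m)) (abs_min_tensor X) < e" if "m \<ge> N" for m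
  proof -
    have C': "spatial_Cauchy (\<lambda>n. X m - X n)"
      using spatial_Cauchy_add[OF spatial_Cauchy_const[of "X m"] spatial_Cauchy_scaleC[OF C, of "-1"]] by simp
    have "dist (alg_embed (X m)) (abs_min_tensor X) = lim (\<lambda>n. spatial_norm (X m - X n))"
      using C C' by (simp add: dist_norm alg_embed_def minus_min_tensor_abs norm_min_tensor_abs same_limit_refl)
    also have "\<dots> \<le> e / 2"
      using N[OF that] by (intro LIMSEQ_le_const2[OF spatial_Cauchy_norm_lim[OF C']]) (meson less_imp_le)
    finally show ?thesis using e by simp
  qed
  then show "\<exists>N. \<forall>n\<ge>N. dist (alg_embed (X n)) (abs_min_tensor X) < e" by blast
qed

lemma alg_embed_approx:
  assumes "e > 0"
  shows "\<exists>t. dist (alg_embed t) x < e"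
proof -
  obtain X where "spatial_Cauchy X" "x = abs_min_tensor X" using min_tensor_exhaust by blast
  then have "(\<lambda>n. alg_embed (X n)) \<longlonglongrightarrow> x" by (simp add: abs_min_tensor_limit same_limit_refl)
  then show ?thesis using assms by (auto dest!: metric_LIMSEQ_D)
qed

instance min_tensor :: (cstar_algebra, cstar_algebra) cstar_algebra
proof
  fix x :: "'a \<otimes> 'b" and c :: complex
  obtain X where C: "spatial_Cauchy X" and x: "x = abs_min_tensor X" using min_tensor_exhaust by blast
  note lim = spatial_Cauchy_norm_lim[OF C]
  note abs = x C same_limit_refl norm_min_tensor_abs times_min_tensor_abs scaleC_min_tensor_abs
    star_min_tensor_abs spatial_Cauchy_mult spatial_Cauchy_scaleC spatial_Cauchy_star
  have "lim (\<lambda>n. cmod c * spatial_norm (X n)) = cmod c * lim (\<lambda>n. spatial_norm (X n))"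
    by (intro limI tendsto_mult_left lim)
  then show "norm (c *\<^sub>C x) = cmod c * norm x" by (simp add: abs spatial_norm_scaleC)
  have "lim (\<lambda>n. (spatial_norm (X n))\<^sup>2) = (lim (\<lambda>n. spatial_norm (X n)))\<^sup>2"
    by (intro limI tendsto_power lim)
  then show "norm (star x * x) = (norm x)\<^sup>2" by (simp add: abs spatial_norm_cstar)
next
  fix X :: "nat \<Rightarrow> 'a \<otimes> 'b" assume X: "Cauchy X"
  have "\<exists>t. dist (alg_embed t) (X n) < 1 / real (Suc n)" for n by (rule alg_embed_approx) simp
  then obtain t where t: "\<And>n. dist (alg_embed (t n)) (X n) < 1 / real (Suc n)" by metis
  have le: "norm (alg_embed (t n) - X n) \<le> inverse (real (Suc n))" for n
    using less_imp_le[OF t[of n]] unfolding dist_norm inverse_eq_divide .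
  have d: "(\<lambda>n. alg_embed (t n) - X n) \<longlonglongrightarrow> 0"
    by (rule Lim_null_comparison[OF always_eventually LIMSEQ_inverse_real_of_nat]) (use le in blast)
  have C: "Cauchy (\<lambda>n. alg_embed (t n))"
  proof (rule metric_CauchyI)
    fix e :: real assume "e > 0"
    then have e: "e / 3 > 0" by simp
    obtain M where M: "\<And>m n. m \<ge> M \<Longrightarrow> n \<ge> M \<Longrightarrow> dist (X m) (X n) < e / 3"
      using metric_CauchyD[OF X e] by blast
    obtain N where N: "\<And>n. n \<ge> N \<Longrightarrow> dist (alg_embed (t n) - X n) 0 < e / 3"
      using metric_LIMSEQ_D[OF d e] by blast
    have "dist (alg_embed (t m)) (alg_embed (t n)) < e" if "m \<ge> max M N" "n \<ge> max M N" for m n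
    proof -
      have "dist (alg_embed (t m)) (X m) < e / 3" "dist (alg_embed (t n)) (X n) < e / 3"
        using N[of m] N[of n] that unfolding dist_norm diff_zero by auto
      moreover have "dist (X m) (X n) < e / 3" using M that by simp
      ultimately show ?thesis
        using dist_triangle[of "alg_embed (t m)" "alg_embed (t n)" "X m"]
          dist_triangle[of "X m" "alg_embed (t n)" "X n"]
        unfolding dist_commute[of "X n"] by linarith
    qed
    then show "\<exists>N. \<forall>m\<ge>N. \<forall>n\<ge>N. dist (alg_embed (t m)) (alg_embed (t n)) < e" by blast
  qed
  have "spatial_Cauchy t"
    using C unfolding Cauchy_def spatial_Cauchy_def dist_norm alg_embed_diff[symmetric] norm_alg_embed .
  then have "(\<lambda>n. alg_embed (t n)) \<longlonglongrightarrow> abs_min_tensor t" by (rule abs_min_tensor_limit)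
  then have "(\<lambda>n. alg_embed (t n) - (alg_embed (t n) - X n)) \<longlonglongrightarrow> abs_min_tensor t - 0"
    by (rule tendsto_diff[OF _ d])
  then have "X \<longlonglongrightarrow> abs_min_tensor t" by simp
  then show "convergent X" by (rule convergentI)
qed

definition pure_tensor :: "'a::cstar_algebra \<Rightarrow> 'b::cstar_algebra \<Rightarrow> 'a \<otimes> 'b" (infixr "\<otimes>" 75) where
  "a \<otimes> b = alg_embed (alg_pure a b)"

text \<open>
  \<open>tensor_lift \<beta>\<close> is the extension to the minimal tensor product of the linear map determined
  by \<open>a \<otimes> b \<mapsto> \<beta> a b\<close>. The elementary tensors span a dense subspace, so there is at most one
  bounded such map; it exists (and is contractive) for the maps it is applied to below, namely
  \<open>f \<otimes> g\<close> for unital *-homomorphisms \<open>f\<close>, \<open>g\<close> and \<open>\<mu> \<otimes> id\<close> for a state \<open>\<mu>\<close>.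
  Real linearity suffices in the description, because the values on \<open>(\<i> *\<^sub>C a) \<otimes> b\<close> are
  prescribed as well. The same remarks apply to \<open>tensor_assoc\<close>, the canonical isomorphism.
\<close>

definition tensor_lift :: "('a::cstar_algebra \<Rightarrow> 'b::cstar_algebra \<Rightarrow> 'c::cstar_algebra) \<Rightarrow> 'a \<otimes> 'b \<Rightarrow> 'c" where
  "tensor_lift \<beta> = (THE h. bounded_linear h \<and> (\<forall>a b. h (a \<otimes> b) = \<beta> a b))"

definition tensor_map :: "('a::cstar_algebra \<Rightarrow> 'c::cstar_algebra) \<Rightarrow> ('b::cstar_algebra \<Rightarrow> 'd::cstar_algebra) \<Rightarrow>
    'a \<otimes> 'b \<Rightarrow> 'c \<otimes> 'd" where
  "tensor_map f g = tensor_lift (\<lambda>a b. f a \<otimes> g b)"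

definition slice_left :: "('a::cstar_algebra \<Rightarrow> complex) \<Rightarrow> 'a \<otimes> 'b::cstar_algebra \<Rightarrow> 'b" where
  "slice_left \<mu> = tensor_lift (\<lambda>a b. \<mu> a *\<^sub>C b)"

definition tensor_assoc :: "('a::cstar_algebra \<otimes> 'b::cstar_algebra) \<otimes> 'c::cstar_algebra \<Rightarrow> 'a \<otimes> 'b \<otimes> 'c" where
  "tensor_assoc = (THE h. bounded_linear h \<and> (\<forall>a b c. h ((a \<otimes> b) \<otimes> c) = a \<otimes> b \<otimes> c))"


section \<open>Compact quantum groups and their actions\<close>

locale compact_quantum_group =
  fixes \<Delta> :: "'a::unital_cstar_algebra \<Rightarrow> 'a \<otimes> 'a"
  assumes comult_hom: "unital_star_hom \<Delta>"
    and coassociative: "tensor_map id \<Delta> (\<Delta> a) = tensor_assoc (tensor_map \<Delta> id (\<Delta> a))"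
    and density_right: "closure (cspan {\<Delta> a * (1 \<otimes> b) | a b. True}) = UNIV"
    and density_left: "closure (cspan {\<Delta> a * (b \<otimes> 1) | a b. True}) = UNIV"

locale quantum_group_action = compact_quantum_group \<Delta>
  for \<Delta> :: "'a::unital_cstar_algebra \<Rightarrow> 'a \<otimes> 'a" +
  fixes \<alpha> :: "'b::unital_cstar_algebra \<Rightarrow> 'b \<otimes> 'a"
  assumes action_hom: "unital_star_hom \<alpha>"
    and action_coassociative: "tensor_assoc (tensor_map \<alpha> id (\<alpha> b)) = tensor_map id \<Delta> (\<alpha> b)"
    and action_density: "closure (cspan {\<alpha> b * (1 \<otimes> a) | a b. True}) = UNIV"

definition ergodic :: "('b::unital_cstar_algebra \<Rightarrow> 'b \<otimes> 'a::unital_cstar_algebra) \<Rightarrow> bool" where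
  "ergodic \<alpha> \<longleftrightarrow> {b. \<alpha> b = b \<otimes> 1} = range (\<lambda>c. c *\<^sub>C 1)"

definition invariant_state :: "('b::unital_cstar_algebra \<Rightarrow> 'b \<otimes> 'a::unital_cstar_algebra) \<Rightarrow> ('b \<Rightarrow> complex) \<Rightarrow> bool" where
  "invariant_state \<alpha> \<mu> \<longleftrightarrow> state \<mu> \<and> (\<forall>b. slice_left \<mu> (\<alpha> b) = \<mu> b *\<^sub>C 1)"

end

theory Submission
  imports Defs
begin

text \<open>
  For a state \<open>h\<close> of \<open>A\<close> put \<open>E b = (id \<otimes> h) (\<alpha> b)\<close>. If \<open>h\<close> is left-invariant, then \<open>E\<close> takes values
  in the fixed points and every invariant state \<open>\<mu>\<close> satisfies \<open>\<mu> = \<mu> \<circ> E\<close>; for ergodic \<open>\<alpha>\<close> this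
  determines \<open>\<mu>\<close>. If \<open>h\<close> is right-invariant, then \<open>\<nu> \<circ> E\<close> is an invariant state for every state \<open>\<nu>\<close>
  of \<open>B\<close>, and it agrees with \<open>\<nu>\<close> on the fixed points; if the invariant state is unique, all states
  agree at a fixed point, which is therefore a scalar.

  One-sided invariant states exist by the argument of Maes and Van Daele: for finitely many states
  with average \<open>\<omega>\<close>, Cesaro means give states fixed by convolution with \<open>\<omega>\<close>, a Cauchy-Schwarz
  argument and the density conditions make them invariant under each of the finitely many states,
  and a limit over finite sets of states finishes the construction.

  On the C*-algebraic side this needs enough states (Hahn-Banach, and the positivity of \<open>x\<^sup>*x\<close>) and
  the boundedness of slice maps, of tensor products of homomorphisms and of the associativity map
  for the minimal norm.
\<close>

section \<open>A Hahn-Banach theorem\<close>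

text \<open>The obstacle is that \<open>tensor_lift\<close> and \<open>tensor_assoc\<close> are
  definite descriptions: nothing is known about \<open>tensor_map\<close>, \<open>slice_left\<close>
  or coassociativity before a norm estimate shows that the prescribed values on elementary tensors
  extend. The minimal norm is accessible only through product states, so such estimates are tested
  on vectors of their GNS spaces; the prescribed map is handled as the real span of its graph, and
  the estimate itself makes that relation single-valued. Associativity is the hardest case, because
  the norm of \<open>'a \<otimes> 'b \<otimes> 'c\<close> involves states of
  \<open>'b \<otimes> 'c\<close> that are not products.

  Positivity rests on the condition \<parallel>t - x\<parallel> \<le> t and on the power series of
  sqrt (1 - z), which take the place of spectral theory. A limit of states is a Hahn-Banach
  functional and recovers a value only where the net converges; the invariance arguments are
  therefore arranged so that the net tends to 0 at \<open>T a - a\<close>.\<close>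

definition sublinear :: "('a::real_vector \<Rightarrow> real) \<Rightarrow> bool" where
  "sublinear p \<longleftrightarrow> (\<forall>x y. p (x + y) \<le> p x + p y) \<and> (\<forall>r x. 0 \<le> r \<longrightarrow> p (r *\<^sub>R x) = r * p x)"

lemma sublinear_add: "sublinear p \<Longrightarrow> p (x + y) \<le> p x + p y"
  by (simp add: sublinear_def)

lemma sublinear_scaleR: "sublinear p \<Longrightarrow> 0 \<le> r \<Longrightarrow> p (r *\<^sub>R x) = r * p x"
  by (simp add: sublinear_def)

lemma sublinear_zero: "sublinear p \<Longrightarrow> p 0 = 0"
  using sublinear_scaleR[of p 0 0] by simp

lemma sublinear_minus: "sublinear p \<Longrightarrow> - p (- x) \<le> p x"
  using sublinear_add[of p x "- x"] sublinear_zero[of p] by simp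

text \<open>Taking the infimum of \<open>p (x + t *\<^sub>R v) - t * p v\<close> over
  \<open>t\<close> \<ge> 0 makes the direction \<open>v\<close> odd: a linear functional below
  \<open>q\<close> is at least \<open>p v\<close> at \<open>v\<close>, hence equal to it. This
  serves both to show that minimal sublinear functionals are odd and to prescribe a touching
  point.\<close>

lemma sublinear_shrink:
  fixes p :: "'a::real_vector \<Rightarrow> real"
  assumes p: "sublinear p"
  obtains q where "sublinear q" "q \<le> p" "q (- v) \<le> - p v"
proof
  define S where "S x = {p (x + t *\<^sub>R v) - t * p v | t. 0 \<le> t}" for x
  define q where "q x = Inf (S x)" for x
  have ne: "S x \<noteq> {}" for x by (auto simp: S_def)
  have low: "- p (- x) \<le> s" if s: "s \<in> S x" for s x
  proof -
    obtain t where "s = p (x + t *\<^sub>R v) - t * p v" "0 \<le> t" using s by (auto simp: S_def)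
    then show ?thesis
      using sublinear_add[OF p, of "x + t *\<^sub>R v" "- x"] sublinear_scaleR[OF p, of t v] by simp
  qed
  have le: "q x \<le> p (x + t *\<^sub>R v) - t * p v" if "0 \<le> t" for x t
    unfolding q_def by (rule cInf_lower) (use that low in \<open>auto simp: S_def bdd_below_def\<close>)
  have ge: "c \<le> q x" if "\<And>t. 0 \<le> t \<Longrightarrow> c \<le> p (x + t *\<^sub>R v) - t * p v" for c x
    unfolding q_def by (rule cInf_greatest[OF ne]) (use that in \<open>auto simp: S_def\<close>)
  have le0: "q x \<le> p x" for x using le[of 0 x] by simp
  then show "q \<le> p" by (simp add: le_fun_def)
  show "q (- v) \<le> - p v" using le[of 1 "- v"] sublinear_zero[OF p] by simp
  have add: "q (x + y) \<le> q x + q y" for x y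
  proof -
    have 1: "q (x + y) \<le> p (x + s *\<^sub>R v) - s * p v + (p (y + t *\<^sub>R v) - t * p v)" if "0 \<le> s" "0 \<le> t" for s t
      using le[of "s + t" "x + y"] sublinear_add[OF p, of "x + s *\<^sub>R v" "y + t *\<^sub>R v"] that
      by (simp add: algebra_simps)
    have "q (x + y) - (p (y + t *\<^sub>R v) - t * p v) \<le> q x" if "0 \<le> t" for t
      using 1 that by (intro ge) (simp add: algebra_simps)
    then have "q (x + y) - q x \<le> q y"
      by (intro ge) (simp add: algebra_simps)
    then show ?thesis by simp
  qed
  have pos: "r * q x \<le> q (r *\<^sub>R x)" if "0 < r" for r x
  proof (rule ge)
    fix t :: real assume "0 \<le> t"
    then have "q x \<le> p (x + (t / r) *\<^sub>R v) - t / r * p v" using that by (intro le) simp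
    then have "r * q x \<le> r * p (x + (t / r) *\<^sub>R v) - t * p v"
      using that mult_left_mono[of "q x" _ r] by (fastforce simp: algebra_simps)
    also have "r * p (x + (t / r) *\<^sub>R v) = p (r *\<^sub>R x + t *\<^sub>R v)"
      using that by (simp add: sublinear_scaleR[OF p, symmetric] scaleR_add_right)
    finally show "r * q x \<le> p (r *\<^sub>R x + t *\<^sub>R v) - t * p v" .
  qed
  have "q (r *\<^sub>R x) = r * q x" if "0 \<le> r" for r x
  proof (cases "r = 0")
    case True
    have "0 \<le> q 0" by (rule ge) (simp add: sublinear_scaleR[OF p])
    then show ?thesis using le0[of 0] True sublinear_zero[OF p] by simp
  next
    case False
    then show ?thesis using pos[of r x] pos[of "1 / r" "r *\<^sub>R x"] that
      by (simp add: field_simps)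
  qed
  with add show "sublinear q" by (simp add: sublinear_def)
qed

text \<open>\<open>sublinear_shrink\<close> cannot lower a minimal \<open>p\<close>, so
  \<open>p\<close> is odd, and subadditivity at \<open>- x\<close> and \<open>- y\<close> gives the
  reverse inequality.\<close>

lemma minimal_sublinear_linear:
  fixes p :: "'a::real_vector \<Rightarrow> real"
  assumes p: "sublinear p" and min: "\<And>q. sublinear q \<Longrightarrow> q \<le> p \<Longrightarrow> q = p"
  shows "linear p"
proof -
  have odd: "p (- v) = - p v" for v
  proof -
    obtain q where "sublinear q" "q \<le> p" "q (- v) \<le> - p v" by (rule sublinear_shrink[OF p])
    then show ?thesis using min[of q] sublinear_minus[OF p, of v] by simp
  qed
  have add: "p (x + y) = p x + p y" for x y
    using sublinear_add[OF p, of x y] sublinear_add[OF p, of "- x" "- y"] odd[of "x + y"] odd[of x] odd[of y]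
    by (simp add: algebra_simps)
  have "p (r *\<^sub>R x) = r * p x" for r x
    using sublinear_scaleR[OF p, of r x] sublinear_scaleR[OF p, of "- r" x] odd[of "r *\<^sub>R x"]
    by (cases "0 \<le> r") auto
  with add show ?thesis by (intro linearI) auto
qed

text \<open>The common lower bound \<open>- p (- x)\<close> keeps the infima finite. Subadditivity
  needs comparability: two members \<open>q\<close>, \<open>q'\<close> are replaced by the smaller
  one before \<open>sublinear_add\<close> applies.\<close>

lemma sublinear_chain_inf:
  fixes C :: "('a::real_vector \<Rightarrow> real) set"
  assumes C: "C \<noteq> {}" "\<And>q. q \<in> C \<Longrightarrow> sublinear q" "\<And>q q'. q \<in> C \<Longrightarrow> q' \<in> C \<Longrightarrow> q \<le> q' \<or> q' \<le> q"
    and le: "\<And>q. q \<in> C \<Longrightarrow> q \<le> p"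
  shows "sublinear (\<lambda>x. INF q\<in>C. q x) \<and> (\<forall>q\<in>C. (\<lambda>x. INF q\<in>C. q x) \<le> q)"
proof -
  define m where "m x = (INF q\<in>C. q x)" for x
  have low: "- p (- x) \<le> q x" if "q \<in> C" for q x
    using sublinear_minus[OF C(2)[OF that], of x] le_funD[OF le[OF that], of "- x"] by simp
  have bdd: "bdd_below ((\<lambda>q. q x) ` C)" for x using low by (auto simp: bdd_below_def)
  have mle: "m x \<le> q x" if "q \<in> C" for q x
    unfolding m_def by (rule cINF_lower[OF bdd that])
  have mge: "c \<le> m x" if "\<And>q. q \<in> C \<Longrightarrow> c \<le> q x" for c x
    unfolding m_def by (rule cINF_greatest[OF C(1) that])
  have add: "m (x + y) \<le> m x + m y" for x y
  proof -
    have 1: "m (x + y) \<le> q x + q' y" if q: "q \<in> C" "q' \<in> C" for q q'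
    proof -
      have "m (x + y) \<le> r x + r y" if "r \<in> C" for r
        using mle[OF that] sublinear_add[OF C(2)[OF that]] by (rule order_trans)
      then show ?thesis using C(3)[OF q] q
        by (meson add_left_mono add_right_mono le_funD order_trans)
    qed
    have "m (x + y) - q' y \<le> m x" if "q' \<in> C" for q'
      using 1 that by (intro mge) (simp add: algebra_simps)
    then have "m (x + y) - m x \<le> m y" by (intro mge) (simp add: algebra_simps)
    then show ?thesis by simp
  qed
  have pos: "r * m x \<le> m (r *\<^sub>R x)" if "0 \<le> r" for r x
    using mult_left_mono[OF mle that] by (intro mge) (simp add: sublinear_scaleR[OF C(2)] that)
  have "m (r *\<^sub>R x) = r * m x" if "0 \<le> r" for r x
  proof (cases "r = 0")
    case True
    obtain q where "q \<in> C" using C(1) by blast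
    then show ?thesis using mle[of q 0] mge[of 0 0] True sublinear_zero[OF C(2)] by force
  next
    case False
    then show ?thesis using pos[of r x] pos[of "1 / r" "r *\<^sub>R x"] that
      by (simp add: field_simps)
  qed
  with add mle show ?thesis unfolding m_def sublinear_def le_fun_def by blast
qed

lemma sublinear_above_linear:
  fixes p :: "'a::real_vector \<Rightarrow> real"
  assumes "sublinear p"
  obtains f where "linear f" "f \<le> p"
proof -
  define A where "A = {q. sublinear q \<and> q \<le> p}"
  \<comment> \<open>The order is reversed, so that Zorn's maximal element is a minimal sublinear
    functional below \<open>p\<close>.\<close>
  let ?P = "\<lambda>q q'. q' \<le> q"
  have po: "partial_order_on A (relation_of ?P A)"
    by (rule partial_order_on_relation_ofI) auto
  have "\<exists>m\<in>A. \<forall>a\<in>A. ?P m a \<longrightarrow> a = m"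
  proof (rule predicate_Zorn[OF po])
    fix C assume "C \<in> Chains (relation_of ?P A)"
    then have C: "C \<subseteq> A" "\<And>q q'. q \<in> C \<Longrightarrow> q' \<in> C \<Longrightarrow> q \<le> q' \<or> q' \<le> q"
      by (auto simp: Chains_def relation_of_def)
    show "\<exists>u\<in>A. \<forall>a\<in>C. ?P a u"
    proof (cases "C = {}")
      case True
      then show ?thesis using assms by (auto simp: A_def)
    next
      case False
      then have "sublinear (\<lambda>x. INF q\<in>C. q x) \<and> (\<forall>q\<in>C. (\<lambda>x. INF q\<in>C. q x) \<le> q)"
        using C by (intro sublinear_chain_inf[where p = p]) (auto simp: A_def)
      moreover obtain q where "q \<in> C" using False by blast
      ultimately show ?thesis using C(1) by (intro bexI[of _ "\<lambda>x. INF q\<in>C. q x"]) (auto simp: A_def intro: order_trans)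
    qed
  qed
  then obtain m where m: "sublinear m" "m \<le> p" "\<And>q. sublinear q \<Longrightarrow> q \<le> p \<Longrightarrow> q \<le> m \<Longrightarrow> q = m"
    by (auto simp: A_def)
  have "linear m" by (rule minimal_sublinear_linear) (use m in \<open>auto intro: order_trans\<close>)
  then show ?thesis using that m(2) by blast
qed

theorem sublinear_above_linear_touching:
  fixes p :: "'a::real_vector \<Rightarrow> real"
  assumes "sublinear p"
  obtains f where "linear f" "\<forall>x. f x \<le> p x" "f v = p v"
proof -
  obtain q where q: "sublinear q" "q \<le> p" "q (- v) \<le> - p v" by (rule sublinear_shrink[OF assms])
  obtain f where f: "linear f" "f \<le> q" by (rule sublinear_above_linear[OF q(1)])
  have "f x \<le> p x" for x using f(2) q(2) by (meson le_funD order_trans)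
  moreover have "p v \<le> f v"
    using le_funD[OF f(2), of "- v"] q(3) linear_neg[OF f(1), of v] by simp
  ultimately show ?thesis using that f(1) by (meson antisym)
qed


section \<open>Square roots in Banach algebras\<close>

text \<open>Taylor coefficients of sqrt (1 - z) at 0. With this sign all coefficients after the
  first are non-positive, which yields absolute summability.\<close>

definition sqrt_coeff :: "nat \<Rightarrow> real" where
  "sqrt_coeff n = (1/2 gchoose n) * (-1) ^ n"

lemma sqrt_coeff_0 [simp]: "sqrt_coeff 0 = 1"
  by (simp add: sqrt_coeff_def)

lemma sqrt_coeff_Suc: "sqrt_coeff (Suc n) = sqrt_coeff n * ((real n - 1/2) / real (Suc n))"
  by (simp add: sqrt_coeff_def gbinomial_prod_rev field_simps)

lemma sqrt_coeff_neg: "sqrt_coeff (Suc n) \<le> 0"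
proof (induction n)
  case (Suc n)
  then show ?case
    by (subst sqrt_coeff_Suc) (intro mult_nonpos_nonneg divide_nonneg_nonneg, auto)
qed (simp add: sqrt_coeff_Suc)

lemma sqrt_coeff_sums: "\<bar>z\<bar> < 1 \<Longrightarrow> (\<lambda>n. sqrt_coeff n * z ^ n) sums sqrt (1 - z)"
  using gen_binomial_real[of "- z" "1/2"]
  by (simp add: sqrt_coeff_def powr_half_sqrt power_minus[of z] mult_ac)

text \<open>The bound on the partial sums at \<open>z < 1\<close> passes to \<open>z = 1\<close>, so the series converges
  absolutely on the closed unit disc.\<close>

lemma sqrt_coeff_partial: "(\<Sum>n<N. \<bar>sqrt_coeff (Suc n)\<bar>) \<le> 1"
proof -
  have 1: "(\<Sum>n<N. \<bar>sqrt_coeff (Suc n)\<bar> * z ^ Suc n) \<le> 1" if z: "0 \<le> z" "z < 1" for z :: real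
  proof -
    have "(\<lambda>n. sqrt_coeff (Suc n) * z ^ Suc n) sums (sqrt (1 - z) - 1)"
      using sqrt_coeff_sums[of z] z by (subst sums_Suc_iff) simp
    then have "(\<lambda>n. - (sqrt_coeff (Suc n) * z ^ Suc n)) sums (1 - sqrt (1 - z))"
      using sums_minus by fastforce
    then have s: "(\<lambda>n. \<bar>sqrt_coeff (Suc n)\<bar> * z ^ Suc n) sums (1 - sqrt (1 - z))"
      by (simp add: abs_of_nonpos[OF sqrt_coeff_neg])
    have "(\<Sum>n<N. \<bar>sqrt_coeff (Suc n)\<bar> * z ^ Suc n) \<le> 1 - sqrt (1 - z)"
      using sum_le_suminf[OF sums_summable[OF s], of "{..<N}"] z sums_unique[OF s] by simp
    then show ?thesis using z by (smt (verit) real_sqrt_ge_zero)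
  qed
  have "((\<lambda>z. \<Sum>n<N. \<bar>sqrt_coeff (Suc n)\<bar> * z ^ Suc n) \<longlongrightarrow> (\<Sum>n<N. \<bar>sqrt_coeff (Suc n)\<bar> * 1 ^ Suc n)) (at_left (1::real))"
    by (intro tendsto_intros)
  then have "(\<Sum>n<N. \<bar>sqrt_coeff (Suc n)\<bar> * 1 ^ Suc n) \<le> 1"
    by (rule tendsto_upperbound)
      (use 1 in \<open>auto simp: eventually_at_left_field intro!: exI[of _ 0]\<close>)
  then show ?thesis by simp
qed

lemma sqrt_coeff_summable: "summable (\<lambda>n. \<bar>sqrt_coeff n\<bar>)"
proof -
  have "summable (\<lambda>n. \<bar>sqrt_coeff (Suc n)\<bar>)"
    by (rule summableI_nonneg_bounded[where x = 1]) (simp_all only: abs_ge_zero sqrt_coeff_partial)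
  then show ?thesis using summable_Suc_iff[of "\<lambda>n. \<bar>sqrt_coeff n\<bar>"] by blast
qed

lemma sqrt_coeff_suminf: "(\<Sum>n. \<bar>sqrt_coeff (Suc n)\<bar>) \<le> 1"
  using sqrt_coeff_summable summable_Suc_iff[of "\<lambda>n. \<bar>sqrt_coeff n\<bar>"] sqrt_coeff_partial
  by (intro suminf_le_const) blast+

text \<open>Vandermonde's identity for 1/2 + 1/2 = 1: the Cauchy square of the series is 1 -
  z.\<close>

lemma sqrt_coeff_convolution:
  "(\<Sum>i\<le>n. sqrt_coeff i * sqrt_coeff (n - i)) = (if n = 0 then 1 else if n = 1 then -1 else 0)"
proof -
  have "(\<Sum>i\<le>n. sqrt_coeff i * sqrt_coeff (n - i)) = (\<Sum>i\<in>{0..n}. (1/2 gchoose i) * (1/2 gchoose (n - i)) * (-1) ^ n)"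
  proof (rule sum.cong)
    fix i assume "i \<in> {0..n}"
    then have "(-1::real) ^ n = (-1) ^ i * (-1) ^ (n - i)" by (simp flip: power_add)
    then show "sqrt_coeff i * sqrt_coeff (n - i) = (1/2 gchoose i) * (1/2 gchoose (n - i)) * (-1) ^ n"
      by (simp add: sqrt_coeff_def)
  qed auto
  also have "\<dots> = (of_nat 1 gchoose n) * (-1) ^ n"
    by (simp add: sum_distrib_right[symmetric] gbinomial_Vandermonde)
  also have "\<dots> = of_nat (1 choose n) * (-1) ^ n" by (simp only: binomial_gbinomial)
  finally show ?thesis by (auto simp: binomial_eq_0)
qed

definition sqrt_one_minus :: "'a::{real_normed_algebra_1,banach} \<Rightarrow> 'a" where
  "sqrt_one_minus u = (\<Sum>n. sqrt_coeff n *\<^sub>R u ^ n)"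

lemma sqrt_one_minus_norm_term:
  fixes u :: "'a::{real_normed_algebra_1,banach}"
  assumes "norm u \<le> 1"
  shows "norm (sqrt_coeff n *\<^sub>R u ^ n) \<le> \<bar>sqrt_coeff n\<bar>"
proof -
  have "norm (u ^ n) \<le> 1" using norm_power_ineq[of u n] power_le_one[of "norm u" n] assms by simp
  then show ?thesis
    using mult_left_mono[of "norm (u ^ n)" 1 "\<bar>sqrt_coeff n\<bar>"] by (simp only: norm_scaleR abs_ge_zero mult_1_right)
qed

lemma sqrt_one_minus_abs_summable:
  fixes u :: "'a::{real_normed_algebra_1,banach}"
  assumes "norm u \<le> 1"
  shows "summable (\<lambda>n. norm (sqrt_coeff n *\<^sub>R u ^ n))"
  by (rule summable_comparison_test'[OF sqrt_coeff_summable, of 0])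
    (use sqrt_one_minus_norm_term[OF assms] in \<open>simp only: real_norm_def abs_norm_cancel\<close>)

lemma sqrt_one_minus_sums:
  fixes u :: "'a::{real_normed_algebra_1,banach}"
  shows "norm u \<le> 1 \<Longrightarrow> (\<lambda>n. sqrt_coeff n *\<^sub>R u ^ n) sums sqrt_one_minus u"
  unfolding sqrt_one_minus_def
  by (rule summable_sums[OF summable_norm_cancel[OF sqrt_one_minus_abs_summable]])

lemma sqrt_one_minus_square:
  fixes u :: "'a::{real_normed_algebra_1,banach}"
  assumes "norm u \<le> 1"
  shows "sqrt_one_minus u * sqrt_one_minus u = 1 - u"
proof -
  let ?a = "\<lambda>n. sqrt_coeff n *\<^sub>R u ^ n"
  let ?d = "\<lambda>n::nat. (if n = 0 then 1 else if n = 1 then -1 else 0 :: real) *\<^sub>R u ^ n"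
  have "(\<Sum>i\<le>n. ?a i * ?a (n - i)) = ?d n" for n
    unfolding sqrt_coeff_convolution[symmetric] scaleR_sum_left
    by (rule sum.cong) (simp_all add: power_add[symmetric])
  moreover have "(\<lambda>n. \<Sum>i\<le>n. ?a i * ?a (n - i)) sums (sqrt_one_minus u * sqrt_one_minus u)"
    unfolding sqrt_one_minus_def by (intro Cauchy_product_sums sqrt_one_minus_abs_summable assms)
  ultimately have "?d sums (sqrt_one_minus u * sqrt_one_minus u)" by (simp only:)
  moreover have "?d sums (\<Sum>n\<in>{0, 1}. ?d n)"
    by (rule sums_finite) auto
  ultimately have "sqrt_one_minus u * sqrt_one_minus u = (\<Sum>n\<in>{0, 1}. ?d n)"
    by (rule sums_unique2)
  then show ?thesis by simp
qed

text \<open>The coefficients of positive index have absolute sum at most 1. This is the estimate by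
  which roots satisfy \<open>cpos\<close>.\<close>

lemma sqrt_one_minus_near_one:
  fixes u :: "'a::{real_normed_algebra_1,banach}"
  assumes "norm u \<le> 1"
  shows "norm (1 - sqrt_one_minus u) \<le> 1"
proof -
  have "(\<lambda>n. sqrt_coeff (Suc n) *\<^sub>R u ^ Suc n) sums (sqrt_one_minus u - 1)"
    using sqrt_one_minus_sums[OF assms] by (subst sums_Suc_iff) simp
  moreover have 1: "summable (\<lambda>n. \<bar>sqrt_coeff (Suc n)\<bar>)"
    using sqrt_coeff_summable summable_Suc_iff[of "\<lambda>n. \<bar>sqrt_coeff n\<bar>"] by blast
  ultimately have "norm (sqrt_one_minus u - 1) \<le> (\<Sum>n. \<bar>sqrt_coeff (Suc n)\<bar>)"
    using norm_suminf_le[OF sqrt_one_minus_norm_term[OF assms] 1] by (simp only: sums_unique[symmetric])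
  then show ?thesis using sqrt_coeff_suminf by (simp add: norm_minus_commute)
qed

text \<open>Two different arguments are allowed so that \<open>(g * g) * v = v * (f * f)\<close> can
  later be turned into \<open>g * v = v * f\<close>; equal arguments give commutation with the
  root.\<close>

lemma sqrt_one_minus_intertwine:
  fixes u v w :: "'a::{real_normed_algebra_1,banach}"
  assumes "norm u \<le> 1" "norm v \<le> 1" "u * w = w * v"
  shows "sqrt_one_minus u * w = w * sqrt_one_minus v"
proof -
  have "u ^ n * w = w * v ^ n" for n
  proof (induction n)
    case (Suc n)
    have "u ^ Suc n * w = u * w * v ^ n" by (simp only: power_Suc mult.assoc Suc)
    then show ?case by (simp only: assms(3) mult.assoc power_Suc)
  qed simp
  then have "sqrt_coeff n *\<^sub>R u ^ n * w = w * (sqrt_coeff n *\<^sub>R v ^ n)" for n by simp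
  then have "(\<lambda>n. sqrt_coeff n *\<^sub>R u ^ n * w) sums (w * sqrt_one_minus v)"
    using sums_mult[OF sqrt_one_minus_sums[OF assms(2)], of w] by (simp only:)
  then show ?thesis
    using sums_mult2[OF sqrt_one_minus_sums[OF assms(1)], of w] by (rule sums_unique2[symmetric])
qed


section \<open>Positive elements of C*-algebras\<close>

lemma star_scaleR: "star (r *\<^sub>R x) = r *\<^sub>R star (x::'a::star_algebra)"
  by (simp flip: scaleC_of_real add: star_scaleC)

lemma star_power: "star (x ^ n) = star (x::'a::star_algebra) ^ n"
  by (induction n) (simp_all add: star_simps star_mult power_commutes)

lemma norm_star: "norm (star x) = norm (x::'a::cstar_algebra)"
proof -
  have le: "norm x \<le> norm (star x)" for x :: 'a
    using cstar_identity[of x] norm_mult_ineq[of "star x" x]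
    by (cases "norm x = 0") (auto simp: power2_eq_square)
  show ?thesis using le[of x] le[of "star x"] by (simp add: star_star)
qed

lemma bounded_linear_star: "bounded_linear (star :: 'a \<Rightarrow> 'a::cstar_algebra)"
  by (rule bounded_linear_intro[where K = 1]) (simp_all add: star_add star_scaleR norm_star)

lemma star_mult_self_eq_0: "star x * x = 0 \<Longrightarrow> x = (0::'a::cstar_algebra)"
  using cstar_identity[of x] by simp

lemma self_adjoint_square_eq_0: "star x = x \<Longrightarrow> x * x = 0 \<Longrightarrow> x = (0::'a::cstar_algebra)"
  using star_mult_self_eq_0[of x] by simp

lemma star_sqrt_one_minus:
  fixes u :: "'a::unital_cstar_algebra"
  assumes "norm u \<le> 1"
  shows "star (sqrt_one_minus u) = sqrt_one_minus (star u)"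
proof -
  have "(\<lambda>n. star (sqrt_coeff n *\<^sub>R u ^ n)) sums star (sqrt_one_minus u)"
    by (rule bounded_linear.sums[OF bounded_linear_star sqrt_one_minus_sums[OF assms]])
  then have "(\<lambda>n. sqrt_coeff n *\<^sub>R star u ^ n) sums star (sqrt_one_minus u)"
    by (simp only: star_scaleR star_power)
  moreover have "(\<lambda>n. sqrt_coeff n *\<^sub>R star u ^ n) sums sqrt_one_minus (star u)"
    by (rule sqrt_one_minus_sums) (simp add: norm_star assms)
  ultimately show ?thesis by (rule sums_unique2)
qed

text \<open>For self-adjoint \<open>x\<close>, the condition \<open>\<parallel>t - x\<parallel> \<le> t\<close> says that the spectrum of \<open>x\<close> lies in
  \<open>[0, 2t]\<close>; in this form positivity is visibly stable under addition.\<close>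

definition cpos :: "'a::unital_cstar_algebra \<Rightarrow> bool" where
  "cpos x \<longleftrightarrow> star x = x \<and> (\<exists>t\<ge>0. norm (t *\<^sub>R 1 - x) \<le> t)"

lemma cpos_star: "cpos x \<Longrightarrow> star x = x"
  by (simp add: cpos_def)

lemma cposI: "star x = x \<Longrightarrow> norm (t *\<^sub>R 1 - x) \<le> t \<Longrightarrow> cpos x"
  using norm_ge_zero order_trans unfolding cpos_def by blast

lemma cpos_eventually:
  assumes "cpos x"
  obtains t where "0 < t" "\<And>s. t \<le> s \<Longrightarrow> norm (s *\<^sub>R 1 - x) \<le> s"
proof -
  obtain t where t: "t \<ge> 0" "norm (t *\<^sub>R 1 - x) \<le> t" using assms by (auto simp: cpos_def)
  have "norm (s *\<^sub>R 1 - x) \<le> s" if "t + 1 \<le> s" for s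
  proof -
    have "s *\<^sub>R 1 - x = (t *\<^sub>R 1 - x) + (s - t) *\<^sub>R 1" by (simp add: algebra_simps)
    then have "norm (s *\<^sub>R 1 - x) \<le> norm (t *\<^sub>R 1 - x) + norm ((s - t) *\<^sub>R (1::'a))"
      using norm_triangle_ineq by metis
    then show ?thesis using t that by simp
  qed
  then show ?thesis using that[of "t + 1"] t by simp
qed

lemma cpos_add:
  assumes "cpos x" "cpos y" shows "cpos (x + y)"
proof -
  obtain s where s: "norm (s *\<^sub>R 1 - x) \<le> s" using assms(1) by (auto simp: cpos_def)
  obtain t where t: "norm (t *\<^sub>R 1 - y) \<le> t" using assms(2) by (auto simp: cpos_def)
  show ?thesis
  proof (rule cposI)
    have "(s + t) *\<^sub>R 1 - (x + y) = (s *\<^sub>R 1 - x) + (t *\<^sub>R 1 - y)" by (simp add: algebra_simps)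
    then have "norm ((s + t) *\<^sub>R 1 - (x + y)) \<le> norm (s *\<^sub>R 1 - x) + norm (t *\<^sub>R 1 - y)"
      using norm_triangle_ineq by metis
    then show "norm ((s + t) *\<^sub>R 1 - (x + y)) \<le> s + t" using s t by simp
  qed (use assms in \<open>simp add: star_add cpos_star\<close>)
qed

lemma cpos_scaleR:
  assumes "cpos x" "0 \<le> r" shows "cpos (r *\<^sub>R x)"
proof -
  obtain s where s: "norm (s *\<^sub>R 1 - x) \<le> s" using assms(1) by (auto simp: cpos_def)
  show ?thesis
  proof (rule cposI)
    have "(r * s) *\<^sub>R 1 - r *\<^sub>R x = r *\<^sub>R (s *\<^sub>R 1 - x)" by (simp add: algebra_simps)
    then show "norm ((r * s) *\<^sub>R 1 - r *\<^sub>R x) \<le> r * s" using s assms(2) by (simp add: mult_left_mono)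
  qed (use assms in \<open>simp add: star_scaleR cpos_star\<close>)
qed

lemma cpos_one: "cpos 1"
  by (rule cposI[of _ 1]) (simp_all add: star_simps)

lemma cpos_norm_diff:
  assumes "star x = x" "norm x \<le> t" shows "cpos (t *\<^sub>R 1 - x)"
  by (rule cposI[of _ t]) (use assms in \<open>simp_all add: star_simps star_scaleR\<close>)

text \<open>Write x = t (1 - u) with u = 1 - x / t; the condition on \<open>t\<close> says
  \<parallel>u\<parallel> \<le> 1, so the series applies. The root is given explicitly in terms of
  \<open>t\<close> for the sake of \<open>cpos_root_intertwine\<close>.\<close>

lemma cpos_root:
  assumes "star x = x" "0 < t" "norm (t *\<^sub>R 1 - x) \<le> t"
  defines "s \<equiv> sqrt t *\<^sub>R sqrt_one_minus (1 - (1 / t) *\<^sub>R x)"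
  shows "cpos s" "s * s = x"
proof -
  let ?u = "1 - (1 / t) *\<^sub>R x"
  have "?u = (1 / t) *\<^sub>R (t *\<^sub>R 1 - x)" using assms(2) by (simp add: algebra_simps)
  then have u: "norm ?u \<le> 1" using assms(2,3) by simp
  have "star ?u = ?u" using assms(1) by (simp add: star_simps star_scaleR)
  then have "star s = s" by (simp add: s_def star_scaleR star_sqrt_one_minus[OF u])
  moreover have "norm (sqrt t *\<^sub>R 1 - s) \<le> sqrt t"
    using mult_left_mono[OF sqrt_one_minus_near_one[OF u], of "sqrt t"] assms(2)
    by (simp add: s_def scaleR_diff_right[symmetric])
  ultimately show "cpos s" by (rule cposI)
  show "s * s = x" using assms(2) sqrt_one_minus_square[OF u] by (simp add: s_def)
qed

lemma cpos_root_intertwine: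
  fixes x y v :: "'a::unital_cstar_algebra"
  assumes "0 < t" "norm (t *\<^sub>R 1 - x) \<le> t" "norm (t *\<^sub>R 1 - y) \<le> t" "x * v = v * y"
  shows "(sqrt t *\<^sub>R sqrt_one_minus (1 - (1 / t) *\<^sub>R x)) * v = v * (sqrt t *\<^sub>R sqrt_one_minus (1 - (1 / t) *\<^sub>R y))"
proof -
  have u: "norm (1 - (1 / t) *\<^sub>R z) \<le> 1" if "norm (t *\<^sub>R 1 - z) \<le> t" for z :: 'a
  proof -
    have "1 - (1 / t) *\<^sub>R z = (1 / t) *\<^sub>R (t *\<^sub>R 1 - z)" using assms(1) by (simp add: algebra_simps)
    then show ?thesis using assms(1) that by simp
  qed
  have "(1 - (1 / t) *\<^sub>R x) * v = v * (1 - (1 / t) *\<^sub>R y)"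
    using assms(4) by (simp add: left_diff_distrib right_diff_distrib)
  from sqrt_one_minus_intertwine[OF u[OF assms(2)] u[OF assms(3)] this] show ?thesis by simp
qed

lemma cpos_sqrt:
  assumes "cpos x"
  obtains s where "cpos s" "s * s = x" "\<forall>y. x * y = y * x \<longrightarrow> s * y = y * s"
proof -
  obtain t where "0 < t" "norm (t *\<^sub>R 1 - x) \<le> t" using cpos_eventually[OF assms] by blast
  then show ?thesis
    by (intro that[OF cpos_root[OF cpos_star[OF assms]]] allI impI cpos_root_intertwine)
qed

text \<open>The element \<open>w = z + \<i> *\<^sub>C s\<close> satisfies
  \<open>star w * w = 1\<close>, so it has norm 1, and \<open>s\<close> is its imaginary
  part.\<close>

lemma unitary_part_norm_le_1:
  fixes z s :: "'a::unital_cstar_algebra"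
  assumes "star z = z" "star s = s" "z * s = s * z" "z * z + s * s = 1"
  shows "norm s \<le> 1"
proof -
  define w where "w = z + \<i> *\<^sub>C s"
  have sw: "star w = z - \<i> *\<^sub>C s" using assms by (simp add: w_def star_add star_scaleC)
  have "star w * w = z * z + s * s"
    unfolding sw unfolding w_def
    by (simp add: algebra_simps mult_scaleC_left mult_scaleC_right assms(3))
  then have "(norm w)\<^sup>2 = 1" using cstar_identity[of w] assms(4) by simp
  then have n: "norm w = 1" using power2_eq_imp_eq[of "norm w" 1] by simp
  have "w - star w = (2 * \<i>) *\<^sub>C s"
    unfolding sw unfolding w_def by (simp flip: scaleC_add_left)
  then have "norm ((2 * \<i>) *\<^sub>C s) \<le> norm w + norm (star w)"
    using norm_triangle_ineq4 by metis
  then show ?thesis using n by (simp add: norm_scaleC norm_mult norm_star)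
qed

text \<open>Scale \<open>y\<close> to a contraction \<open>z\<close> and let \<open>s\<close> be the
  root of \<open>1 - z * z\<close>. Then \<open>z\<close> and \<open>s\<close> are the real and
  imaginary parts of an element of norm 1, so \<open>s\<close> is a contraction and \<parallel>1 - z
  z\<parallel> = \<parallel>s s\<parallel> \<le> 1.\<close>

lemma cpos_square:
  fixes y :: "'a::unital_cstar_algebra"
  assumes "star y = y" shows "cpos (y * y)"
proof (cases "y = 0")
  case False
  define z where "z = (1 / norm y) *\<^sub>R y"
  have sz: "star z = z" using assms by (simp add: z_def star_scaleR)
  have nz: "norm (z * z) \<le> 1" using norm_mult_ineq[of z z] False by (simp add: z_def)
  define s where "s = sqrt_one_minus (z * z)"
  have s: "star s = s" "s * s = 1 - z * z"
    using sz nz by (simp_all add: s_def star_sqrt_one_minus star_mult sqrt_one_minus_square)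
  have "z * s = s * z"
    using sqrt_one_minus_intertwine[OF nz nz, of z] by (simp add: s_def mult.assoc)
  then have "norm s \<le> 1" using sz s by (intro unitary_part_norm_le_1[of z]) simp_all
  then have "norm (1 *\<^sub>R 1 - z * z) \<le> 1"
    using norm_mult_ineq[of s s] s(2) mult_mono[of "norm s" 1 "norm s" 1] by simp
  then have "cpos (z * z)" by (intro cposI[of _ 1]) (simp_all add: star_mult sz)
  then have "cpos ((norm y)\<^sup>2 *\<^sub>R (z * z))" by (rule cpos_scaleR) simp
  then show ?thesis using False by (simp add: z_def power2_eq_square)
qed (use cpos_scaleR[OF cpos_one, of 0] in simp)

lemma cpos_mult:
  assumes "cpos x" "cpos y" "x * y = y * x" shows "cpos (x * y)"
proof -
  obtain s where s: "cpos s" "s * s = x" "\<forall>y. x * y = y * x \<longrightarrow> s * y = y * s" by (rule cpos_sqrt[OF assms(1)])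
  obtain r where r: "cpos r" "r * r = y" "\<forall>x. y * x = x * y \<longrightarrow> r * x = x * r" by (rule cpos_sqrt[OF assms(2)])
  have rs: "r * s = s * r" using r(3) s(3) assms(3) by metis
  then have "star (s * r) = s * r" by (simp add: star_mult cpos_star s r)
  moreover have "(s * r) * (s * r) = x * y"
  proof -
    have "s * (r * s) * r = s * (s * r) * r" by (simp only: rs)
    then show ?thesis by (simp only: s(2)[symmetric] r(2)[symmetric] mult.assoc)
  qed
  ultimately show ?thesis using cpos_square[of "s * r"] by simp
qed

text \<open>The positive elements k + u and k - u commute, so 1 - (u / k)^2 is positive and has a
  root \<open>c\<close> commuting with \<open>u\<close>; then \<open>c\<close> and u / k are the
  parts of an element of norm 1.\<close>

lemma norm_le_if_cpos:
  fixes u :: "'a::unital_cstar_algebra"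
  assumes "star u = u" "0 \<le> t" "cpos (t *\<^sub>R 1 + u)" "cpos (t *\<^sub>R 1 - u)"
  shows "norm u \<le> t"
proof (rule field_le_epsilon)
  fix e :: real assume e: "0 < e"
  \<comment> \<open>The slack \<open>e\<close> keeps \<open>k\<close> positive also for t = 0, the
    case behind \<open>cpos_antisym\<close>.\<close>
  define k where "k = t + e"
  have k: "k > 0" using e assms(2) by (simp add: k_def)
  have shift: "cpos (k *\<^sub>R 1 + x)" if "cpos (t *\<^sub>R 1 + x)" for x :: 'a
    using cpos_add[OF that cpos_scaleR[OF cpos_one, of e]] e by (simp add: k_def algebra_simps)
  have "cpos ((k *\<^sub>R 1 + u) * (k *\<^sub>R 1 - u))"
    using shift[of u] shift[of "- u"] assms by (intro cpos_mult) (simp_all add: algebra_simps)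
  then have "cpos ((1 / k\<^sup>2) *\<^sub>R ((k *\<^sub>R 1 + u) * (k *\<^sub>R 1 - u)))" by (rule cpos_scaleR) simp
  moreover have "(1 / k\<^sup>2) *\<^sub>R ((k *\<^sub>R 1 + u) * (k *\<^sub>R 1 - u)) = 1 - (1 / k\<^sup>2) *\<^sub>R (u * u)"
    using k by (simp add: algebra_simps power2_eq_square)
  ultimately have "cpos (1 - (1 / k\<^sup>2) *\<^sub>R (u * u))" by simp
  then obtain c where c: "cpos c" "c * c = 1 - (1 / k\<^sup>2) *\<^sub>R (u * u)"
     "\<forall>y. (1 - (1 / k\<^sup>2) *\<^sub>R (u * u)) * y = y * (1 - (1 / k\<^sup>2) *\<^sub>R (u * u)) \<longrightarrow> c * y = y * c"
    by (rule cpos_sqrt)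
  have "(1 - (1 / k\<^sup>2) *\<^sub>R (u * u)) * u = u * (1 - (1 / k\<^sup>2) *\<^sub>R (u * u))"
    by (simp add: algebra_simps)
  then have "c * u = u * c" using c(3) by blast
  then have "c * ((1 / k) *\<^sub>R u) = ((1 / k) *\<^sub>R u) * c" by (simp only: mult_scaleR_left mult_scaleR_right)
  moreover have "c * c + ((1 / k) *\<^sub>R u) * ((1 / k) *\<^sub>R u) = 1"
    by (simp add: c(2) power2_eq_square)
  ultimately have "norm ((1 / k) *\<^sub>R u) \<le> 1"
    using unitary_part_norm_le_1[of c "(1 / k) *\<^sub>R u"] cpos_star[OF c(1)] assms(1) by (simp only: star_scaleR)
  then show "norm u \<le> t + e" using k by (simp add: k_def)
qed

lemma cpos_antisym:
  assumes "cpos x" "cpos (- x)" shows "x = 0"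
  using norm_le_if_cpos[of x 0] assms by (simp add: cpos_star)

lemma cpos_norm_mono:
  fixes h :: "'a::unital_cstar_algebra"
  assumes "cpos h" "cpos (t *\<^sub>R 1 - h)" "0 \<le> t"
  shows "norm h \<le> t"
  using assms cpos_add[OF cpos_scaleR[OF cpos_one assms(3)] assms(1)]
  by (intro norm_le_if_cpos) (auto simp: cpos_star)

text \<open>For d = r - g one has (r + g) d = 0, so the positive elements d r d and d g d add up to
  0 and both vanish. Their difference is d^3, and a self-adjoint nilpotent element is 0.\<close>

lemma cpos_sqrt_unique:
  assumes "cpos r" "cpos g" "r * g = g * r" "r * r = g * g"
  shows "r = g"
proof -
  define d where "d = r - g"
  have sd: "star d = d" using assms by (simp add: d_def star_simps cpos_star)
  have dr: "d * r = r * d" and dg: "d * g = g * d"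
    using assms by (simp_all add: d_def algebra_simps)
  have pos: "cpos (d * x * d)" if "cpos x" "d * x = x * d" for x
  proof -
    have "d * d * x = x * (d * d)" by (metis mult.assoc that(2))
    then have "cpos ((d * d) * x)" using that(1) sd by (intro cpos_mult cpos_square)
    moreover have "d * d * x = d * x * d" by (metis mult.assoc that(2))
    ultimately show ?thesis by simp
  qed
  have "(r + g) * d = 0" using assms(3,4) by (simp add: d_def algebra_simps)
  then have "d * r * d + d * g * d = 0" by (metis distrib_left distrib_right mult.assoc mult_zero_right)
  then have "d * g * d = - (d * r * d)" by (simp add: eq_neg_iff_add_eq_0 add.commute)
  then have z: "d * r * d = 0" using pos[OF assms(1) dr] pos[OF assms(2) dg] cpos_antisym by metis
  then have "d * g * d = 0" using \<open>d * r * d + d * g * d = 0\<close> by simp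
  moreover have "d * (r - g) * d = d * r * d - d * g * d" by (simp only: right_diff_distrib left_diff_distrib)
  ultimately have "d * d * d = 0" using z by (simp flip: d_def)
  then have "(d * d) * (d * d) = 0" by (simp flip: mult.assoc)
  then have "d * d = 0" by (rule self_adjoint_square_eq_0[rotated]) (simp add: star_mult sd)
  then show ?thesis using self_adjoint_square_eq_0[OF sd] by (simp add: d_def)
qed


lemma self_adjoint_parts:
  fixes x :: "'a::star_algebra"
  obtains a b where "star a = a" "star b = b" "x = a + \<i> *\<^sub>C b"
proof
  show "star ((1/2) *\<^sub>C (x + star x)) = (1/2) *\<^sub>C (x + star x)"
    by (simp add: star_scaleC star_add star_star add.commute)
  show "star ((- \<i>/2) *\<^sub>C (x - star x)) = (- \<i>/2) *\<^sub>C (x - star x)"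
    by (simp add: star_scaleC star_simps star_star scaleC_add_right complex_vector.scale_right_diff_distrib)
  have "x = (1/2 + 1/2) *\<^sub>C x" by simp
  also have "\<dots> = (1/2) *\<^sub>C x + (1/2) *\<^sub>C x" by (rule scaleC_add_left)
  finally show "x = (1/2) *\<^sub>C (x + star x) + \<i> *\<^sub>C (- \<i>/2) *\<^sub>C (x - star x)"
    by (simp add: scaleC_add_right complex_vector.scale_right_diff_distrib)
qed

text \<open>If \<open>star v * v = - f\<close> with \<open>f\<close> positive, then \<open>g = v * star v\<close> is positive as well and
  \<open>g v = - v f\<close>. Taking square roots in \<open>g\<^sup>2 v = v f\<^sup>2\<close> gives \<open>g v = v f\<close>, whence \<open>v = 0\<close>.\<close>

lemma star_mult_self_negative:
  fixes v f :: "'a::unital_cstar_algebra"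
  assumes "star v * v = - f" "cpos f"
  shows "v = 0"
proof -
  define g where "g = v * star v"
  obtain a b where ab: "star a = a" "star b = b" "v = a + \<i> *\<^sub>C b" by (rule self_adjoint_parts)
  have sv: "star v = a - \<i> *\<^sub>C b" using ab by (simp add: star_add star_scaleC)
  \<comment> \<open>The two products of \<open>v\<close> with its adjoint add up to twice the sum of
    the squares of its self-adjoint parts; since \<open>star v * v = - f\<close>, this exhibits
    \<open>g\<close> as a sum of positive elements.\<close>
  have "star v * v + g = 2 *\<^sub>R (a * a + b * b)"
    unfolding g_def sv unfolding ab(3)
    by (simp add: algebra_simps mult_scaleC_left mult_scaleC_right scaleR_2)
  then have "g = 2 *\<^sub>R (a * a + b * b) + f" using assms(1) by (simp add: algebra_simps)
  moreover have "cpos (2 *\<^sub>R (a * a + b * b) + f)"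
    by (intro cpos_add cpos_scaleR cpos_square ab assms(2)) simp
  ultimately have g: "cpos g" by simp
  have gv: "g * v = - (v * f)" using assms(1) by (simp add: g_def mult.assoc)
  have "(g * g) * v = - ((g * v) * f)" by (metis gv mult.assoc mult_minus_right)
  also have "\<dots> = v * (f * f)" by (simp add: gv mult.assoc)
  finally have ggv: "(g * g) * v = v * (f * f)" .
  have gg: "cpos (g * g)" and ff: "cpos (f * f)" using g assms(2) by (simp_all add: cpos_square cpos_star)
  obtain s where s: "0 < s" "\<And>r. s \<le> r \<Longrightarrow> norm (r *\<^sub>R 1 - g * g) \<le> r" using cpos_eventually[OF gg] by blast
  obtain t where t: "0 < t" "\<And>r. t \<le> r \<Longrightarrow> norm (r *\<^sub>R 1 - f * f) \<le> r" using cpos_eventually[OF ff] by blast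
  define r where "r = max s t"
  have r: "0 < r" "norm (r *\<^sub>R 1 - g * g) \<le> r" "norm (r *\<^sub>R 1 - f * f) \<le> r"
    using s t by (auto simp: r_def)
  \<comment> \<open>One \<open>r\<close> serves for \<open>g * g\<close> and \<open>f * f\<close>,
    because \<open>cpos_root_intertwine\<close> compares the same power series at both arguments;
    \<open>cpos_sqrt_unique\<close> identifies the values as \<open>g\<close> and
    \<open>f\<close>.\<close>
  define rt where "rt x = sqrt r *\<^sub>R sqrt_one_minus (1 - (1 / r) *\<^sub>R x)" for x :: 'a
  have root: "rt (h * h) = h" if "cpos h" "norm (r *\<^sub>R 1 - h * h) \<le> r" for h
  proof (rule cpos_sqrt_unique)
    have "star (h * h) = h * h" using that by (simp add: star_mult cpos_star)
    then show "cpos (rt (h * h))" "rt (h * h) * rt (h * h) = h * h"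
      using cpos_root[OF _ r(1) that(2)] by (simp_all add: rt_def)
    show "rt (h * h) * h = h * rt (h * h)"
      unfolding rt_def by (rule cpos_root_intertwine[OF r(1) that(2) that(2)]) (simp add: mult.assoc)
  qed (rule that)
  have "rt (g * g) * v = v * rt (f * f)"
    unfolding rt_def by (rule cpos_root_intertwine[OF r ggv])
  then have gv': "g * v = v * f" using root[OF g r(2)] root[OF assms(2) r(3)] by (simp only:)
  have "v * f = - (v * f)" by (rule trans[OF gv'[symmetric] gv])
  then have "v * f + v * f = 0" by (simp only: eq_neg_iff_add_eq_0)
  then have "2 *\<^sub>R (v * f) = 0" by (simp only: scaleR_2)
  then have vf: "v * f = 0" by simp
  have "f * f = - (star v * v) * f" by (simp only: assms(1) minus_minus)
  also have "\<dots> = 0" by (simp add: mult.assoc vf)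
  finally have "f * f = 0" .
  then have "f = 0" by (rule self_adjoint_square_eq_0[OF cpos_star[OF assms(2)]])
  then show ?thesis using star_mult_self_eq_0[of v] assms(1) by simp
qed

text \<open>With \<open>p = \<bar>y\<bar>\<close>, the element \<open>z = p - y\<close> is twice the negative part of \<open>y = star x * x\<close>,
  and \<open>star (x z) (x z) = z y z = - z p z\<close>.\<close>

lemma cpos_star_mult_self: "cpos (star x * (x::'a::unital_cstar_algebra))"
proof -
  define y where "y = star x * x"
  have sy: "star y = y" by (simp add: y_def star_mult star_star)
  obtain p where p: "cpos p" "p * p = y * y" "\<forall>w. (y * y) * w = w * (y * y) \<longrightarrow> p * w = w * p"
    by (rule cpos_sqrt[OF cpos_square[OF sy]])
  have py: "p * y = y * p" using p(3) mult.assoc[of y y y] by blast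
  define z where "z = p - y"
  have sz: "star z = z" using p(1) sy by (simp add: z_def star_simps cpos_star)
  have zp: "z * p = p * z" using py by (simp add: z_def left_diff_distrib right_diff_distrib)
  have zy: "z * y = - (z * p)" using py p(2) by (simp add: z_def left_diff_distrib)
  have "z * z * p = p * (z * z)" by (metis mult.assoc zp)
  then have "cpos (z * z * p)" by (intro cpos_mult cpos_square sz p)
  moreover have "z * z * p = z * p * z" by (metis mult.assoc zp)
  ultimately have f: "cpos (z * p * z)" by simp
  have "star (x * z) * (x * z) = z * y * z" by (simp add: star_mult sz y_def mult.assoc)
  also have "\<dots> = - (z * p * z)" by (simp add: zy)
  finally have e: "star (x * z) * (x * z) = - (z * p * z)" .
  have "x * z = 0" by (rule star_mult_self_negative[OF e f])
  then have zpz: "z * p * z = 0" using e by simp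
  moreover have "z * y * z = 0" using zpz by (simp add: zy)
  moreover have "z * (p - y) * z = z * p * z - z * y * z" by (simp only: right_diff_distrib left_diff_distrib)
  ultimately have "z * z * z = 0" by (simp flip: z_def)
  then have "(z * z) * (z * z) = 0" by (simp add: mult.assoc[symmetric])
  then have "z * z = 0" by (rule self_adjoint_square_eq_0[rotated]) (simp add: star_mult sz)
  then have "z = 0" by (rule self_adjoint_square_eq_0[OF sz])
  then show ?thesis using p(1) by (simp add: z_def y_def)
qed

section \<open>States\<close>

lemma complexify_linear:
  fixes g :: "'a::star_algebra \<Rightarrow> real"
  assumes "linear g"
  shows "clinear (\<lambda>x. complex_of_real (g x) - \<i> * complex_of_real (g (\<i> *\<^sub>C x)))"
proof -
  interpret g: linear g by fact
  have c: "g (c *\<^sub>C x) = Re c * g x + Im c * g (\<i> *\<^sub>C x)" for c x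
  proof -
    have "c *\<^sub>C x = (complex_of_real (Re c) + complex_of_real (Im c) * \<i>) *\<^sub>C x"
      by (rule arg_cong[where f = "\<lambda>d. d *\<^sub>C x"]) (simp add: complex_eq_iff)
    then show ?thesis by (simp only: scaleC_add_left scaleC_scaleC[symmetric] scaleC_of_real g.add g.scale real_scaleR_def)
  qed
  have ic: "g (\<i> *\<^sub>C c *\<^sub>C x) = Re c * g (\<i> *\<^sub>C x) - Im c * g x" for c x
    using c[of "\<i> * c" x] by simp
  show ?thesis
    unfolding clinear_def
  proof (intro conjI allI)
    fix x y :: 'a and r :: complex
    let ?k = "\<lambda>x. complex_of_real (g x) - \<i> * complex_of_real (g (\<i> *\<^sub>C x))"
    show "?k (x + y) = ?k x + ?k y" by (simp add: scaleC_add_right g.add algebra_simps)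
    show "?k (r *\<^sub>C x) = r *\<^sub>C ?k x"
      unfolding ic c[of r] by (simp add: complex_eq_iff algebra_simps)
  qed
qed

text \<open>Here the bound comes from positivity alone: \<parallel>x\<parallel>^2 -
  \<open>star x * x\<close> is the square of a self-adjoint element, so the functional is
  non-negative on it.\<close>

lemma positive_functional_bound:
  fixes \<tau> :: "'a::unital_cstar_algebra \<Rightarrow> complex"
  assumes "positive_functional \<tau>"
  shows "Re (\<tau> (star x * x)) \<le> (norm x)\<^sup>2 * Re (\<tau> 1)"
proof -
  have l: "clinear \<tau>" using assms by (simp add: positive_functional_def)
  have "cpos ((norm x)\<^sup>2 *\<^sub>R 1 - star x * x)"
    by (rule cpos_norm_diff) (simp_all add: star_mult star_star cstar_identity)
  then obtain s where s: "cpos s" "s * s = (norm x)\<^sup>2 *\<^sub>R 1 - star x * x" by (rule cpos_sqrt)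
  then have "star s * s = complex_of_real ((norm x)\<^sup>2) *\<^sub>C 1 - star x * x"
    by (simp only: cpos_star scaleC_of_real)
  then have "0 \<le> Re (\<tau> (complex_of_real ((norm x)\<^sup>2) *\<^sub>C 1 - star x * x))"
    using pos_nonneg[OF assms, of s] by simp
  then show ?thesis by (simp add: clinear_simps[OF l] del: of_real_power)
qed

lemma positive_functional_unit:
  assumes "positive_functional \<tau>"
  shows "Im (\<tau> 1) = 0" "0 \<le> Re (\<tau> 1)"
  using pos_nonneg[OF assms, of 1] by (simp_all add: star_simps)

text \<open>The bound on squares is a hypothesis so that it can come from
  \<open>pos_bounded\<close>, where continuity is known but the algebra may be zero, or from
  \<open>positive_functional_bound\<close>.\<close>

lemma positive_functional_norm_le:
  fixes \<tau> :: "'a::cstar_algebra \<Rightarrow> complex"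
  assumes \<tau>: "positive_functional \<tau>"
    and le: "\<And>x. Re (\<tau> (star x * x)) \<le> (norm x)\<^sup>2 * Re (\<tau> 1)"
  shows "cmod (\<tau> x) \<le> Re (\<tau> 1) * norm x"
proof -
  have "(cmod (\<tau> x))\<^sup>2 \<le> Re (\<tau> 1) * Re (\<tau> (star x * x))"
    using pos_CS[OF \<tau>, of 1 x] by (simp add: star_simps)
  also have "\<dots> \<le> Re (\<tau> 1) * ((norm x)\<^sup>2 * Re (\<tau> 1))"
    by (intro mult_left_mono le positive_functional_unit[OF \<tau>])
  also have "\<dots> = (Re (\<tau> 1) * norm x)\<^sup>2" by (simp add: power2_eq_square)
  finally show ?thesis
    by (rule power2_le_imp_le) (simp add: positive_functional_unit[OF \<tau>])
qed

lemma clinear_bounded_linear: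
  assumes "clinear f" "\<And>x. norm (f x) \<le> K * norm x"
  shows "bounded_linear (f :: 'a::cstar_algebra \<Rightarrow> 'b::cstar_algebra)"
proof (rule bounded_linear_intro)
  show "f (r *\<^sub>R x) = r *\<^sub>R f x" for r x
    using clinear_simps(2)[OF assms(1), of "complex_of_real r" x] by (simp add: scaleC_of_real)
qed (use assms in \<open>simp_all add: clinear_simps mult.commute\<close>)

lemma positive_functional_bounded_linear:
  fixes \<tau> :: "'a::unital_cstar_algebra \<Rightarrow> complex"
  assumes "positive_functional \<tau>"
  shows "bounded_linear \<tau>"
  using assms positive_functional_norm_le[OF assms positive_functional_bound[OF assms]]
  by (intro clinear_bounded_linear[where K = "Re (\<tau> 1)"]) (simp_all add: positive_functional_def)

lemma stateI:
  fixes \<tau> :: "'a::unital_cstar_algebra \<Rightarrow> complex"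
  shows "positive_functional \<tau> \<Longrightarrow> \<tau> 1 = 1 \<Longrightarrow> state \<tau>"
  by (simp add: state_def positive_functional_bounded_linear) (simp add: positive_functional_def)

lemma state_clinear: "state \<phi> \<Longrightarrow> clinear \<phi>"
  and state_bounded_linear: "state \<phi> \<Longrightarrow> bounded_linear \<phi>"
  and state_one: "state \<phi> \<Longrightarrow> \<phi> 1 = 1"
  by (simp_all add: state_def)

lemma state_star: "state \<phi> \<Longrightarrow> \<phi> (star x) = cnj (\<phi> x)"
  using pos_herm[OF state_positive, of \<phi> x 1] by (simp add: star_simps)

lemma state_norm_le:
  fixes \<phi> :: "'a::cstar_algebra \<Rightarrow> complex"
  assumes "state \<phi>" shows "cmod (\<phi> x) \<le> norm x"
  using positive_functional_norm_le[OF state_positive[OF assms] pos_bounded[OF state_positive[OF assms] state_bounded_linear[OF assms]], of x]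
  by (simp add: state_one[OF assms])

text \<open>A functional dominated by the norm and attaining \<open>\<parallel>1 + x\<^sup>*x\<parallel> = 1 + \<parallel>x\<parallel>\<^sup>2\<close> at \<open>1 + x\<^sup>*x\<close> has to
  be \<open>1\<close> at \<open>1\<close> and \<open>\<parallel>x\<parallel>\<^sup>2\<close> at \<open>x\<^sup>*x\<close>.\<close>

theorem norming_state:
  fixes x :: "'a::unital_cstar_algebra"
  obtains \<psi> where "state \<psi>" "\<psi> (star x * x) = complex_of_real ((norm x)\<^sup>2)"
proof -
  define h where "h = star x * x"
  have h: "cpos h" unfolding h_def by (rule cpos_star_mult_self)
  have nh: "norm h = (norm x)\<^sup>2" by (simp add: h_def cstar_identity)
  have "sublinear (norm :: 'a \<Rightarrow> real)" by (simp add: sublinear_def norm_triangle_ineq)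
  then obtain g where g: "linear g" "\<forall>x. g x \<le> norm x" "g (1 + h) = norm (1 + h)"
    by (rule sublinear_above_linear_touching[where v = "1 + h"])
  interpret g: linear g by fact
  have "norm h \<le> norm (1 + h) - 1"
  proof (rule cpos_norm_mono[OF h])
    have "cpos (norm (1 + h) *\<^sub>R 1 - (1 + h))"
      using h by (intro cpos_norm_diff) (simp_all add: star_add star_simps cpos_star)
    then show "cpos ((norm (1 + h) - 1) *\<^sub>R 1 - h)" by (simp add: algebra_simps)
    have "norm (1::'a) \<le> norm (1 + h)"
    proof (rule cpos_norm_mono[OF cpos_one])
      show "cpos (norm (1 + h) *\<^sub>R 1 - (1::'a))"
        using cpos_add[OF \<open>cpos (norm (1 + h) *\<^sub>R 1 - (1 + h))\<close> h] by simp
    qed simp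
    then show "0 \<le> norm (1 + h) - 1" by simp
  qed
  then have g1: "g 1 = 1" and gh: "g h = (norm x)\<^sup>2"
    using g(2)[rule_format, of 1] g(2)[rule_format, of h] g(3) nh by (simp_all add: g.add)
  have gpos: "0 \<le> g y" if "cpos y" for y
  proof -
    obtain t where "norm (t *\<^sub>R 1 - y) \<le> t" using \<open>cpos y\<close> by (auto simp: cpos_def)
    then have "g (t *\<^sub>R 1 - y) \<le> t" using g(2) order_trans by blast
    then show ?thesis by (simp add: g.diff g.scale g1)
  qed
  \<comment> \<open>\<open>g\<close> is only real linear and may be non-zero on \<i> times a
    self-adjoint element; averaging with the adjoint removes this, so that the complexification is
    real on self-adjoint elements.\<close>
  define k where "k y = g ((1/2) *\<^sub>R (y + star y))" for y
  have lk: "linear k"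
    by (rule linearI) (simp_all add: k_def star_add star_scaleR g.add g.scale algebra_simps)
  have ksa: "k y = g y" "k (\<i> *\<^sub>C y) = 0" if "star y = y" for y
    using that by (simp_all add: k_def star_scaleC g.zero flip: scaleR_2)
  define \<psi> where "\<psi> y = complex_of_real (k y) - \<i> * complex_of_real (k (\<i> *\<^sub>C y))" for y
  have \<psi>sa: "\<psi> y = complex_of_real (g y)" if "star y = y" for y
    using ksa[OF that] by (simp add: \<psi>_def)
  have "state \<psi>"
  proof (rule stateI)
    have "clinear \<psi>" unfolding \<psi>_def by (rule complexify_linear[OF lk])
    then show "positive_functional \<psi>"
      using gpos[OF cpos_star_mult_self] by (simp add: positive_functional_def \<psi>sa star_mult star_star complex_nonneg_Reals_iff)
    show "\<psi> 1 = 1" by (simp add: \<psi>sa star_simps g1)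
  qed
  moreover have "\<psi> h = complex_of_real ((norm x)\<^sup>2)" using h by (simp add: \<psi>sa cpos_star gh)
  ultimately show ?thesis using that by (simp add: h_def)
qed


lemma bounded_linear_compression:
  "bounded_linear (\<tau> :: 'a::real_normed_algebra \<Rightarrow> complex) \<Longrightarrow> bounded_linear (\<lambda>z. \<tau> (a * z * b))"
  using bounded_linear_const_mult_comp[of \<tau> a b 1] by simp

lemma positive_functional_compression:
  assumes "positive_functional \<tau>"
  shows "positive_functional (\<lambda>z. \<tau> (star y * z * y))"
proof -
  have l: "clinear \<tau>" using assms by (simp add: positive_functional_def)
  have "star y * (star x * x) * y = star (x * y) * (x * y)" for x by (simp add: star_mult mult.assoc)
  then show ?thesis
    using assms unfolding positive_functional_def
    by (auto simp: clinear_def clinear_simps[OF l] distrib_left distrib_right mult_scaleC_left mult_scaleC_right)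
qed

lemma gns_norm_mult_le:
  fixes \<tau> :: "'a::cstar_algebra \<Rightarrow> complex"
  assumes "positive_functional \<tau>" "bounded_linear \<tau>"
  shows "gns_norm \<tau> (x * y) \<le> norm x * gns_norm \<tau> y"
proof (rule power2_le_imp_le)
  show "(gns_norm \<tau> (x * y))\<^sup>2 \<le> (norm x * gns_norm \<tau> y)\<^sup>2"
    using pos_bounded[OF positive_functional_compression[OF assms(1)] bounded_linear_compression[OF assms(2)], of y x]
    by (simp add: gns_norm_sq[OF assms(1)] power_mult_distrib star_mult mult.assoc)
qed (simp add: gns_norm_nonneg[OF assms(1)])

text \<open>Product functionals are available for states only, so compressions of states have to be
  rescaled; a compression may vanish, whence the second case.\<close>

lemma state_normalize:
  fixes \<phi> :: "'a::cstar_algebra \<Rightarrow> complex"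
  assumes \<phi>: "positive_functional \<phi>" "bounded_linear \<phi>"
  obtains \<psi> :: "'a \<Rightarrow> complex" where "state \<psi>" "\<phi> = (\<lambda>z. of_real (Re (\<phi> 1)) * \<psi> z)" | "\<phi> = (\<lambda>z. 0)"
proof (cases "Re (\<phi> 1) = 0")
  case True
  then have "\<phi> = (\<lambda>z. 0)"
    using positive_functional_norm_le[OF \<phi>(1) pos_bounded[OF \<phi>]] by (intro ext) simp
  then show ?thesis by (rule that(2))
next
  case False
  define k where "k = complex_of_real (inverse (Re (\<phi> 1)))"
  have k: "complex_of_real (Re (\<phi> 1)) * (k * z) = z" for z
    using False by (simp add: k_def)
  have l: "clinear \<phi>" using \<phi> by (simp add: positive_functional_def)
  have 1: "\<phi> 1 = of_real (Re (\<phi> 1))" using positive_functional_unit[OF \<phi>(1)] by (simp add: complex_eq_iff)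
  have "state (\<lambda>z. k * \<phi> z)"
    unfolding state_def
  proof (intro conjI allI)
    show "clinear (\<lambda>z. k * \<phi> z)" by (simp add: clinear_def clinear_simps[OF l] algebra_simps)
    show "bounded_linear (\<lambda>z. k * \<phi> z)" by (rule bounded_linear_compose[OF bounded_linear_mult_right \<phi>(2)])
    show "k * \<phi> (star x * x) \<in> \<real>\<^sub>\<ge>\<^sub>0" for x
      using \<phi>(1) positive_functional_unit(2)[OF \<phi>(1)]
      by (intro nonneg_Reals_mult_I) (simp_all add: k_def positive_functional_def complex_nonneg_Reals_iff)
    show "k * \<phi> 1 = 1" by (subst 1) (use k[of 1] in \<open>simp add: mult.commute\<close>)
  qed
  then show ?thesis by (rule that(1)) (simp only: k)
qed

lemma polarization_eq_0:
  assumes l: "clinear \<tau>" and 0: "\<And>y. \<tau> (star y * x * y) = 0"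
  shows "\<tau> (star y * x * z) = (0::complex)"
proof -
  have "\<tau> (star y * x * z) + \<tau> (star z * x * y) = 0"
    using 0[of "y + z"] 0[of y] 0[of z]
    by (simp add: star_add distrib_left distrib_right clinear_simps[OF l] add.commute)
  moreover have "\<i> * \<tau> (star y * x * z) - \<i> * \<tau> (star z * x * y) = 0"
    using 0[of "y + \<i> *\<^sub>C z"] 0[of y] 0[of z]
    by (simp add: star_add star_scaleC distrib_left distrib_right left_diff_distrib
      mult_scaleC_left mult_scaleC_right clinear_simps[OF l])
  ultimately show ?thesis by (simp add: algebra_simps)
qed

text \<open>Every compression of a state is a multiple of a state, so it kills \<open>x\<close>;
  polarization then makes the two outer factors independent.\<close>

lemma state_compression_eq_0:
  fixes \<phi> :: "'a::cstar_algebra \<Rightarrow> complex"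
  assumes 0: "\<And>\<psi>. state \<psi> \<Longrightarrow> \<psi> x = 0" and "state \<phi>"
  shows "\<phi> (star y * x * z) = 0"
proof (rule polarization_eq_0)
  fix w
  let ?\<phi> = "\<lambda>z. \<phi> (star w * z * w)"
  have "positive_functional ?\<phi>" "bounded_linear ?\<phi>"
    using assms(2) by (simp_all add: positive_functional_compression state_positive
      bounded_linear_compression state_bounded_linear)
  then consider \<psi> where "state \<psi>" "?\<phi> = (\<lambda>z. of_real (Re (?\<phi> 1)) * \<psi> z)" | "?\<phi> = (\<lambda>z. 0)"
    by (rule state_normalize)
  then show "?\<phi> x = 0"
  proof cases
    case 1
    then show ?thesis using 0 fun_cong[OF 1(2), of x] by simp
  next
    case 2
    then show ?thesis by (rule fun_cong)
  qed
qed (rule state_clinear[OF assms(2)])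

lemma states_separate:
  fixes x :: "'a::unital_cstar_algebra"
  assumes "\<And>\<psi>. state \<psi> \<Longrightarrow> \<psi> x = 0"
  shows "x = 0"
proof -
  obtain \<psi> where \<psi>: "state \<psi>" "\<psi> (star x * x) = complex_of_real ((norm x)\<^sup>2)" by (rule norming_state)
  have "\<psi> (star x * x * 1) = 0"
    by (rule state_compression_eq_0[where x = x]) (simp_all add: assms \<psi>(1))
  then show ?thesis using \<psi>(2) by simp
qed

lemma states_separate_eq:
  fixes x y :: "'a::unital_cstar_algebra"
  assumes "\<And>\<psi>. state \<psi> \<Longrightarrow> \<psi> x = \<psi> y"
  shows "x = y"
  using states_separate[of "x - y"] assms by (simp add: clinear_simps state_clinear)

text \<open>A substitute for weak-* compactness of the state space: a linear functional below the
  upper limit of the real parts of the states \<open>h i\<close>.\<close>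

theorem limit_state:
  fixes h :: "'i \<Rightarrow> 'a::unital_cstar_algebra \<Rightarrow> complex"
  assumes F: "F \<noteq> bot" and h: "\<And>i. state (h i)"
  obtains \<psi> where "state \<psi>" "\<forall>x c. ((\<lambda>i. h i x) \<longlongrightarrow> c) F \<longrightarrow> \<psi> x = c"
proof -
  define S where "S x = {t. eventually (\<lambda>i. Re (h i x) \<le> t) F}" for x
  define p where "p x = Inf (S x)" for x
  have Re_bound: "\<bar>Re (h i x)\<bar> \<le> norm x" for i x
    using state_norm_le[OF h, of i x] abs_Re_le_cmod order_trans by blast
  have ne: "norm x \<in> S x" for x using Re_bound by (simp add: S_def abs_le_iff)
  have low: "- norm x \<le> t" if "t \<in> S x" for t x
  proof -
    have "\<exists>i. Re (h i x) \<le> t" using that F by (auto simp: S_def dest: eventually_happens)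
    then show ?thesis using Re_bound[of _ x] by (smt (verit))
  qed
  have le: "p x \<le> t" if "t \<in> S x" for x t
    unfolding p_def by (rule cInf_lower[OF that]) (use low in \<open>auto simp: bdd_below_def\<close>)
  have ge: "c \<le> p x" if "\<And>t. t \<in> S x \<Longrightarrow> c \<le> t" for x c
    unfolding p_def by (rule cInf_greatest) (use that ne in auto)
  have sub: "sublinear p"
    unfolding sublinear_def
  proof (intro conjI allI impI)
    fix x y :: 'a
    have 1: "p (x + y) \<le> s + t" if "s \<in> S x" "t \<in> S y" for s t
    proof (rule le)
      from that have "eventually (\<lambda>i. Re (h i x) \<le> s \<and> Re (h i y) \<le> t) F" by (simp add: S_def eventually_conj_iff)
      then show "s + t \<in> S (x + y)"
        unfolding S_def by (auto simp: clinear_simps[OF state_clinear[OF h]] elim: eventually_mono)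
    qed
    have "p (x + y) - t \<le> p x" if "t \<in> S y" for t
      using 1 that by (intro ge) (simp add: algebra_simps)
    then have "p (x + y) - p x \<le> p y" by (intro ge) (simp add: algebra_simps)
    then show "p (x + y) \<le> p x + p y" by simp
  next
    have scale: "h i (r *\<^sub>R x) = of_real r * h i x" for r i x
      using clinear_simps(2)[OF state_clinear[OF h], of i "complex_of_real r" x] by (simp add: scaleC_of_real)
    have pos: "r * p x \<le> p (r *\<^sub>R x)" if "0 < r" for r x
    proof (rule ge)
      fix t assume "t \<in> S (r *\<^sub>R x)"
      then have "t / r \<in> S x" using that by (simp add: S_def scale field_simps)
      then show "r * p x \<le> t" using le[of "t / r" x] that by (simp add: field_simps)
    qed
    fix r :: real and x :: 'a assume "0 \<le> r"
    show "p (r *\<^sub>R x) = r * p x"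
    proof (cases "r = 0")
      case True
      then show ?thesis using low[of _ 0] le[OF ne[of 0]] ge[of 0 0] by force
    next
      case False
      then show ?thesis using pos[of r x] pos[of "1 / r" "r *\<^sub>R x"] \<open>0 \<le> r\<close>
        by (simp add: field_simps)
    qed
  qed
  obtain g where g: "linear g" "\<forall>x. g x \<le> p x"
    by (rule sublinear_above_linear_touching[OF sub])
  interpret g: linear g by fact
  have g_le: "g x \<le> t" if "t \<in> S x" for x t using g(2) le[OF that] order_trans by blast
  have g_lim: "g x = c" if "((\<lambda>i. Re (h i x)) \<longlongrightarrow> c) F" for x c
  proof -
    have up: "g y \<le> d" if "((\<lambda>i. Re (h i y)) \<longlongrightarrow> d) F" for y d
    proof (rule field_le_epsilon)
      fix e :: real assume "0 < e"
      then have "eventually (\<lambda>i. Re (h i y) < d + e) F" by (intro order_tendstoD(2)[OF that]) simp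
      then show "g y \<le> d + e" by (intro g_le) (auto simp: S_def elim: eventually_mono)
    qed
    have "((\<lambda>i. Re (h i (- x))) \<longlongrightarrow> - c) F"
      using tendsto_minus[OF that] by (simp add: clinear_simps[OF state_clinear[OF h]])
    from up[OF this] up[OF that] show ?thesis by (simp add: g.neg)
  qed
  define \<psi> where "\<psi> x = complex_of_real (g x) - \<i> * complex_of_real (g (\<i> *\<^sub>C x))" for x
  have lim: "\<psi> x = c" if c: "((\<lambda>i. h i x) \<longlongrightarrow> c) F" for x c
  proof -
    have "((\<lambda>i. Re (h i (\<i> *\<^sub>C x))) \<longlongrightarrow> - Im c) F"
      using tendsto_minus[OF tendsto_Im[OF c]] by (simp add: clinear_simps[OF state_clinear[OF h]])
    then show ?thesis using g_lim[OF tendsto_Re[OF c]] g_lim by (simp add: \<psi>_def complex_eq_iff)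
  qed
  have "state \<psi>"
  proof (rule stateI)
    show "\<psi> 1 = 1" by (rule lim) (simp add: state_one[OF h])
    have "\<psi> (star x * x) \<in> \<real>\<^sub>\<ge>\<^sub>0" for x
    proof -
      note sp = pos_nonneg[OF state_positive[OF h], of _ x]
      have "g (- (star x * x)) \<le> 0"
        using sp by (intro g_le) (simp add: S_def clinear_simps[OF state_clinear[OF h]])
      moreover have "g (\<i> *\<^sub>C (star x * x)) = 0"
        using sp by (intro g_lim) (simp add: clinear_simps[OF state_clinear[OF h]])
      ultimately show ?thesis by (simp add: \<psi>_def g.neg complex_nonneg_Reals_iff)
    qed
    then show "positive_functional \<psi>"
      unfolding positive_functional_def using complexify_linear[OF g(1)] by (simp add: \<psi>_def[abs_def])
  qed
  then show ?thesis using that lim by blast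
qed

section \<open>Extension of bounded linear maps by continuity\<close>

lemma in_closure_if_tendsto:
  fixes a :: "nat \<Rightarrow> 'a::real_normed_vector"
  shows "\<forall>n. a n \<in> R \<Longrightarrow> a \<longlonglongrightarrow> x \<Longrightarrow> x \<in> closure R"
  unfolding closure_sequential by blast

lemma subspace_closure:
  fixes R :: "'a::real_normed_vector set"
  assumes "subspace R" shows "subspace (closure R)"
  unfolding subspace_def
proof (intro conjI ballI allI)
  show "0 \<in> closure R" using subspace_0[OF assms] closure_subset by blast
next
  fix x y assume "x \<in> closure R" "y \<in> closure R"
  then obtain a b where ab: "\<forall>n. a n \<in> R" "a \<longlonglongrightarrow> x" "\<forall>n. b n \<in> R" "b \<longlonglongrightarrow> y"
    unfolding closure_sequential by blast
  have "\<forall>n. a n + b n \<in> R" using subspace_add[OF assms] ab by blast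
  moreover have "(\<lambda>n. a n + b n) \<longlonglongrightarrow> x + y" by (intro tendsto_add ab)
  ultimately show "x + y \<in> closure R" by (rule in_closure_if_tendsto)
next
  fix r x assume "x \<in> closure R"
  then obtain a where a: "\<forall>n. a n \<in> R" "a \<longlonglongrightarrow> x" unfolding closure_sequential by blast
  have "\<forall>n. r *\<^sub>R a n \<in> R" using subspace_scale[OF assms] a by blast
  moreover have "(\<lambda>n. r *\<^sub>R a n) \<longlonglongrightarrow> r *\<^sub>R x" by (intro tendsto_scaleR tendsto_const a)
  ultimately show "r *\<^sub>R x \<in> closure R" by (rule in_closure_if_tendsto)
qed

text \<open>Single-valuedness is a consequence of the bound: it passes to the closure of
  \<open>R\<close>, where it is applied at first component 0. Density and completeness make the
  closure total.\<close>

lemma bounded_linear_graph_extension: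
  fixes R :: "('v::real_normed_vector \<times> 'w::banach) set"
  assumes R: "subspace R" and bound: "\<And>x y. (x, y) \<in> R \<Longrightarrow> norm y \<le> K * norm x"
    and dense: "closure (fst ` R) = UNIV"
  obtains h where "bounded_linear h" "\<forall>(x, y)\<in>R. h x = y"
proof -
  let ?S = "closure R"
  have S: "subspace ?S" by (rule subspace_closure[OF R])
  have "closed {p::'v \<times> 'w. norm (snd p) \<le> K * norm (fst p)}"
    by (intro closed_Collect_le continuous_intros)
  then have "?S \<subseteq> {p. norm (snd p) \<le> K * norm (fst p)}"
    by (rule closure_minimal[rotated]) (use bound in auto)
  then have bS: "norm y \<le> K * norm x" if "(x, y) \<in> ?S" for x y using that by auto
  have "\<exists>y. (x, y) \<in> ?S" for x
  proof -
    obtain a where a: "\<And>n. a n \<in> fst ` R" "a \<longlonglongrightarrow> x"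
      using dense closure_sequential[of x "fst ` R"] by auto
    then have "\<forall>n. \<exists>y. (a n, y) \<in> R" by force
    then obtain b where b: "\<And>n. (a n, b n) \<in> R" by metis
    have d: "norm (b m - b n) \<le> \<bar>K\<bar> * norm (a m - a n)" for m n
    proof -
      have "(a m - a n, b m - b n) \<in> R" using subspace_diff[OF R b[of m] b[of n]] by simp
      then have "norm (b m - b n) \<le> K * norm (a m - a n)" by (rule bound)
      also have "\<dots> \<le> \<bar>K\<bar> * norm (a m - a n)" by (intro mult_right_mono) auto
      finally show ?thesis .
    qed
    have "Cauchy b"
    proof (rule metric_CauchyI)
      fix e :: real assume e: "0 < e"
      have "Cauchy a" using a(2) by (rule LIMSEQ_imp_Cauchy)
      then obtain M where M: "\<And>m n. m \<ge> M \<Longrightarrow> n \<ge> M \<Longrightarrow> dist (a m) (a n) < e / (\<bar>K\<bar> + 1)"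
        using e metric_CauchyD[of a "e / (\<bar>K\<bar> + 1)"] by (auto simp: add_nonneg_pos)
      have "dist (b m) (b n) < e" if "m \<ge> M" "n \<ge> M" for m n
      proof -
        have "(\<bar>K\<bar> + 1) * norm (a m - a n) < e"
          using M[OF that] by (simp add: dist_norm pos_less_divide_eq mult.commute)
        moreover have "\<bar>K\<bar> * norm (a m - a n) \<le> (\<bar>K\<bar> + 1) * norm (a m - a n)" by (intro mult_right_mono) auto
        ultimately show ?thesis using d[of m n] unfolding dist_norm by linarith
      qed
      then show "\<exists>M. \<forall>m\<ge>M. \<forall>n\<ge>M. dist (b m) (b n) < e" by blast
    qed
    then obtain y where "b \<longlonglongrightarrow> y" using Cauchy_convergent convergent_def by blast
    then have "(\<lambda>n. (a n, b n)) \<longlonglongrightarrow> (x, y)" using a(2) by (intro tendsto_Pair)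
    moreover have "\<forall>n. (a n, b n) \<in> R" using b by blast
    ultimately have "(x, y) \<in> closure R" by (intro in_closure_if_tendsto)
    then show ?thesis by blast
  qed
  then obtain h where h: "\<And>x. (x, h x) \<in> ?S" by metis
  have uniq: "y = h x" if "(x, y) \<in> ?S" for x y
    using bS[of 0 "y - h x"] subspace_diff[OF S that h[of x]] by simp
  have "bounded_linear h"
  proof (rule bounded_linear_intro)
    show "h (x + y) = h x + h y" for x y
      using uniq[of "x + y" "h x + h y"] subspace_add[OF S h h, of x y] by simp
    show "h (r *\<^sub>R x) = r *\<^sub>R h x" for r x
      using uniq[of "r *\<^sub>R x" "r *\<^sub>R h x"] subspace_scale[OF S h, of r x] by simp
    show "norm (h x) \<le> norm x * K" for x using bS[OF h, of x] by (simp add: mult.commute)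
  qed
  moreover have "\<forall>(x, y)\<in>R. h x = y" using uniq closure_subset[of R] by blast
  ultimately show ?thesis by (rule that)
qed


section \<open>Minimal tensor products\<close>

lemma alg_embed_simps:
  "alg_embed (s + t) = alg_embed s + alg_embed t"
  "alg_embed (s * t) = alg_embed s * alg_embed t"
  "alg_embed (c *\<^sub>C t) = c *\<^sub>C alg_embed t"
  "alg_embed (star t) = star (alg_embed t)"
  "alg_embed 0 = 0" "alg_embed 1 = 1"
  by (simp_all add: alg_embed_def plus_min_tensor_abs times_min_tensor_abs scaleC_min_tensor_abs
    star_min_tensor_abs zero_min_tensor_def one_min_tensor_def)

lemma pure_tensor_simps:
  "(a \<otimes> b) * (c \<otimes> d) = (a * c) \<otimes> (b * d)"
  "star (a \<otimes> b) = star a \<otimes> star b"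
  by (simp_all add: pure_tensor_def alg_pure_simps flip: alg_embed_simps)

lemma pure_tensor_one: "1 \<otimes> 1 = 1"
  by (simp add: pure_tensor_def alg_pure_simps alg_embed_simps)

lemma pure_tensor_linear:
  "(a + a') \<otimes> b = a \<otimes> b + a' \<otimes> b" "a \<otimes> (b + b') = a \<otimes> b + a \<otimes> b'"
  "(c *\<^sub>C a) \<otimes> b = c *\<^sub>C (a \<otimes> b)" "a \<otimes> (c *\<^sub>C b) = c *\<^sub>C (a \<otimes> b)"
  by (simp_all add: pure_tensor_def alg_pure_linear alg_embed_simps)

lemma norm_pure_tensor_le: "norm (a \<otimes> b) \<le> norm a * norm b"
  unfolding pure_tensor_def norm_alg_embed by (rule spatial_norm_le[OF spatial_bounds_pure])

lemma bounded_bilinear_pure_tensor: "bounded_bilinear (\<otimes>)"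
proof
  show "(r *\<^sub>R a) \<otimes> b = r *\<^sub>R (a \<otimes> b)" "a \<otimes> (r *\<^sub>R b) = r *\<^sub>R (a \<otimes> b)" for r a b
    by (simp_all flip: scaleC_of_real add: pure_tensor_linear)
  show "\<exists>K. \<forall>a b. norm (a \<otimes> b) \<le> norm a * norm b * K"
    by (intro exI[of _ 1]) (simp add: norm_pure_tensor_le)
qed (simp_all add: pure_tensor_linear)

definition pures :: "('a::cstar_algebra \<otimes> 'b::cstar_algebra) set" where
  "pures = range (\<lambda>(a, b). a \<otimes> b)"

lemma pureI: "a \<otimes> b \<in> pures"
  unfolding pures_def by (rule range_eqI[of _ _ "(a, b)"]) simp

lemma alg_embed_in_span: "alg_embed t \<in> span pures"
proof (induction t rule: alg_tensor_induct)
  case (add a b t)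
  have "a \<otimes> b \<in> span pures" by (rule span_base[OF pureI])
  then show ?case using add by (simp add: alg_embed_simps span_add flip: pure_tensor_def)
qed (simp add: alg_embed_simps span_zero)

lemma alg_embed_dense: "closure (range alg_embed) = UNIV"
proof -
  have "x \<in> closure (range alg_embed)" for x :: "'a \<otimes> 'b"
    unfolding closure_approachable using alg_embed_approx by blast
  then show ?thesis by blast
qed

lemma pures_dense: "closure (span pures) = UNIV"
  using closure_mono[of "range alg_embed" "span pures"] alg_embed_in_span alg_embed_dense by blast

lemma tensor_closed_induct:
  assumes "closed {x. P x}" "\<And>t. P (alg_embed t)"
  shows "P x"
  using closure_minimal[of "range alg_embed" "{x. P x}"] assms alg_embed_dense by blast

lemma tensor_eqI:
  fixes f g :: "'a::cstar_algebra \<otimes> 'b::cstar_algebra \<Rightarrow> 'c::real_normed_vector"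
  assumes f: "bounded_linear f" and g: "bounded_linear g" and eq: "\<And>a b. f (a \<otimes> b) = g (a \<otimes> b)"
  shows "f x = g x"
proof (rule tensor_closed_induct)
  have "continuous_on UNIV f" "continuous_on UNIV g"
    using f g by (simp_all add: linear_continuous_on)
  then show "closed {x. f x = g x}" by (rule closed_Collect_eq)
  show "f (alg_embed t) = g (alg_embed t)" for t
  proof (induction t rule: alg_tensor_induct)
    case zero
    then show ?case using f g by (simp add: alg_embed_simps linear_simps)
  next
    case (add a b t)
    then show ?case using f g eq
      by (simp add: alg_embed_simps linear_simps(1)[of f] linear_simps(1)[of g] flip: pure_tensor_def)
  qed
qed

text \<open>A relation rather than a map; a norm bound on its pairs makes it single-valued. The real
  span already reaches all algebraic tensors, because a complex scalar can be absorbed in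
  \<open>a\<close>.\<close>

definition tensor_graph :: "('a::cstar_algebra \<Rightarrow> 'b::cstar_algebra \<Rightarrow> 'c::cstar_algebra) \<Rightarrow> ('a \<otimes> 'b \<times> 'c) set" where
  "tensor_graph \<beta> = span (range (\<lambda>(a, b). (a \<otimes> b, \<beta> a b)))"

lemma tensor_graphI: "(a \<otimes> b, \<beta> a b) \<in> tensor_graph \<beta>"
  unfolding tensor_graph_def by (rule span_base, rule range_eqI[of _ _ "(a, b)"]) simp

lemma fst_tensor_graph: "fst ` tensor_graph \<beta> = span pures"
  unfolding tensor_graph_def pures_def
  by (subst linear_span_image[symmetric])
    (simp_all add: image_image case_prod_unfold bounded_linear.linear[OF bounded_linear_fst])

text \<open>This justifies the definite description: the bound on the graph gives existence, density
  of the span of elementary tensors gives uniqueness.\<close>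

lemma tensor_lift:
  fixes \<beta> :: "'a::cstar_algebra \<Rightarrow> 'b::cstar_algebra \<Rightarrow> 'c::cstar_algebra"
  assumes bound: "\<And>x y. (x, y) \<in> tensor_graph \<beta> \<Longrightarrow> norm y \<le> K * norm x"
  shows bounded_linear_tensor_lift: "bounded_linear (tensor_lift \<beta>)"
    and tensor_lift_pure: "tensor_lift \<beta> (a \<otimes> b) = \<beta> a b"
proof -
  have "closure (fst ` tensor_graph \<beta>) = UNIV" by (simp add: fst_tensor_graph pures_dense)
  moreover have "subspace (tensor_graph \<beta>)" unfolding tensor_graph_def by (rule subspace_span)
  ultimately obtain h where h: "bounded_linear h" "\<forall>(x, y)\<in>tensor_graph \<beta>. h x = y"
    using bounded_linear_graph_extension[of "tensor_graph \<beta>" K] bound by metis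
  have h': "h (a \<otimes> b) = \<beta> a b" for a b
    using bspec[OF h(2) tensor_graphI] by simp
  have "tensor_lift \<beta> = h"
    unfolding tensor_lift_def
  proof (rule the_equality)
    fix k assume "bounded_linear k \<and> (\<forall>a b. k (a \<otimes> b) = \<beta> a b)"
    then have "k x = h x" for x by - (rule tensor_eqI[of k h x], simp_all add: h(1) h')
    then show "k = h" by (rule ext)
  qed (simp add: h(1) h')
  then show "bounded_linear (tensor_lift \<beta>)" "tensor_lift \<beta> (a \<otimes> b) = \<beta> a b" by (simp_all add: h(1) h')
qed

lemma bounded_linear_scaleC: "bounded_linear (\<lambda>x. c *\<^sub>C x :: 'c::cstar_algebra)"
proof (rule bounded_linear_intro[where K = "cmod c"])
  show "c *\<^sub>C (r *\<^sub>R x) = r *\<^sub>R (c *\<^sub>C x)" for r and x :: 'c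
    by (simp flip: scaleC_of_real add: mult.commute)
qed (simp_all add: scaleC_add_right norm_scaleC mult.commute)

lemma closed_positive_squares:
  fixes \<tau> :: "'a::cstar_algebra \<Rightarrow> complex"
  assumes "bounded_linear \<tau>"
  shows "closed {x. \<tau> (star x * x) \<in> \<real>\<^sub>\<ge>\<^sub>0}"
proof -
  have "continuous_on UNIV (\<lambda>x. \<tau> (star x * x))"
    by (intro bounded_linear.continuous_on[OF assms] continuous_intros
      bounded_linear.continuous_on[OF bounded_linear_star])
  from closed_vimage[OF closed_nonneg_Reals_complex this] show ?thesis by (simp add: vimage_def)
qed

subsection \<open>Product states\<close>

definition tensor_state :: "('a::cstar_algebra \<Rightarrow> complex) \<Rightarrow> ('b::cstar_algebra \<Rightarrow> complex) \<Rightarrow> 'a \<otimes> 'b \<Rightarrow> complex" where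
  "tensor_state \<phi> \<psi> = tensor_lift (\<lambda>a b. \<phi> a * \<psi> b)"

text \<open>The value is the matrix coefficient of \<open>t\<close> at the GNS vector of 1, which
  has norm 1.\<close>

lemma norm_prod_functional_le:
  assumes "state \<phi>" "state \<psi>"
  shows "cmod (prod_functional \<phi> \<psi> t) \<le> spatial_norm t"
proof -
  note P = state_prod_positive[OF assms]
  let ?q = "gns_norm (prod_functional \<phi> \<psi>)"
  have "prod_functional \<phi> \<psi> 1 = 1"
    using assms by (simp add: prod_functional_pure state_clinear state_one flip: alg_pure_simps(3))
  then have 1: "?q 1 = 1" by (simp add: gns_norm_def star_simps)
  have "cmod (prod_functional \<phi> \<psi> t) \<le> ?q 1 * ?q (t * 1)"
    using gns_CS[OF P, of 1 t] by (simp add: star_simps)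
  also have "\<dots> \<le> spatial_norm t" using spatial_norm_bound[OF assms, of t 1] by (simp add: 1)
  finally show ?thesis .
qed

context
  fixes \<phi> :: "'a::cstar_algebra \<Rightarrow> complex" and \<psi> :: "'b::cstar_algebra \<Rightarrow> complex"
  assumes \<phi>: "state \<phi>" and \<psi>: "state \<psi>"
begin

lemma tensor_state_bound:
  assumes "(x, y) \<in> tensor_graph (\<lambda>a b. \<phi> a * \<psi> b)"
  shows "norm y \<le> 1 * norm x"
proof -
  have L: "clinear (prod_functional \<phi> \<psi>)"
    using \<phi> \<psi> by (simp add: clinear_prod_functional state_clinear)
  \<comment> \<open>The graph of the product functional on algebraic tensors is a real subspace
    containing the generators, hence contains \<open>tensor_graph\<close>; on it the spatial norm
    bounds the value.\<close>
  let ?G = "{(alg_embed t, prod_functional \<phi> \<psi> t) | t. True}"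
  have "subspace ?G"
    unfolding subspace_def
  proof (safe, goal_cases)
    case 1
    show ?case by (intro exI[of _ 0]) (simp add: zero_prod_def alg_embed_simps clinear_simps[OF L])
  next
    case (2 _ _ _ _ s t)
    show ?case by (intro exI[of _ "s + t"]) (simp add: alg_embed_simps clinear_simps[OF L])
  next
    case (3 r _ _ t)
    show ?case
      by (intro exI[of _ "complex_of_real r *\<^sub>C t"])
        (simp add: alg_embed_simps clinear_simps(2)[OF L] scaleR_conv_of_real flip: scaleC_of_real)
  qed
  moreover have "range (\<lambda>(a, b). (a \<otimes> b, \<phi> a * \<psi> b)) \<subseteq> ?G"
  proof clarify
    show "\<exists>t. (a \<otimes> b, \<phi> a * \<psi> b) = (alg_embed t, prod_functional \<phi> \<psi> t) \<and> True" for a b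
      using \<phi> \<psi> by (intro exI[of _ "alg_pure a b"]) (simp add: pure_tensor_def prod_functional_pure state_clinear)
  qed
  ultimately have "(x, y) \<in> ?G" using assms span_minimal unfolding tensor_graph_def by blast
  then show ?thesis using norm_prod_functional_le[OF \<phi> \<psi>] by (auto simp: norm_alg_embed)
qed

lemma bounded_linear_tensor_state: "bounded_linear (tensor_state \<phi> \<psi>)"
  unfolding tensor_state_def by (rule bounded_linear_tensor_lift[OF tensor_state_bound])

lemma tensor_state_pure [simp]: "tensor_state \<phi> \<psi> (a \<otimes> b) = \<phi> a * \<psi> b"
  unfolding tensor_state_def by (rule tensor_lift_pure[OF tensor_state_bound])

lemma tensor_state_alg_embed: "tensor_state \<phi> \<psi> (alg_embed t) = prod_functional \<phi> \<psi> t"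
proof (induction t rule: alg_tensor_induct)
  case zero
  show ?case using bounded_linear_tensor_state
    by (simp add: alg_embed_simps linear_simps clinear_simps clinear_prod_functional state_clinear \<phi> \<psi>)
next
  case (add a b t)
  then show ?case
    by (simp add: alg_embed_simps linear_simps(1)[OF bounded_linear_tensor_state] clinear_simps
      clinear_prod_functional state_clinear \<phi> \<psi> prod_functional_pure flip: pure_tensor_def)
qed

lemma state_tensor_state: "state (tensor_state \<phi> \<psi>)"
  unfolding state_def
proof (intro conjI allI)
  note B = bounded_linear_tensor_state
  show "clinear (tensor_state \<phi> \<psi>)"
    unfolding clinear_def
  proof (intro conjI allI)
    show "tensor_state \<phi> \<psi> (c *\<^sub>C x) = c *\<^sub>C tensor_state \<phi> \<psi> x" for c x
    proof (rule tensor_eqI[of "\<lambda>x. tensor_state \<phi> \<psi> (c *\<^sub>C x)" "\<lambda>x. c *\<^sub>C tensor_state \<phi> \<psi> x"])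
      show "bounded_linear (\<lambda>x. tensor_state \<phi> \<psi> (c *\<^sub>C x))"
        by (rule bounded_linear_compose[OF B bounded_linear_scaleC])
      show "bounded_linear (\<lambda>x. c *\<^sub>C tensor_state \<phi> \<psi> x)"
        by (rule bounded_linear_compose[OF bounded_linear_scaleC B])
      show "tensor_state \<phi> \<psi> (c *\<^sub>C (a \<otimes> b)) = c *\<^sub>C tensor_state \<phi> \<psi> (a \<otimes> b)" for a b
        unfolding pure_tensor_linear(3)[symmetric] tensor_state_pure
        by (simp add: clinear_simps[OF state_clinear[OF \<phi>]])
    qed
  qed (rule linear_simps(1)[OF B])
  show "tensor_state \<phi> \<psi> (star x * x) \<in> \<real>\<^sub>\<ge>\<^sub>0" for x
  proof (rule tensor_closed_induct[of "\<lambda>x. tensor_state \<phi> \<psi> (star x * x) \<in> \<real>\<^sub>\<ge>\<^sub>0"])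
    show "closed {x. tensor_state \<phi> \<psi> (star x * x) \<in> \<real>\<^sub>\<ge>\<^sub>0}"
      by (rule closed_positive_squares[OF B])
    show "tensor_state \<phi> \<psi> (star (alg_embed t) * alg_embed t) \<in> \<real>\<^sub>\<ge>\<^sub>0" for t
      using state_prod_positive[OF \<phi> \<psi>]
      by (simp add: tensor_state_alg_embed positive_functional_def flip: alg_embed_simps)
  qed
  show "tensor_state \<phi> \<psi> 1 = 1"
    by (simp add: state_one \<phi> \<psi> flip: pure_tensor_one)
qed (rule bounded_linear_tensor_state)

lemma gns_norm_alg_embed: "gns_norm (tensor_state \<phi> \<psi>) (alg_embed t) = gns_norm (prod_functional \<phi> \<psi>) t"
  by (simp add: gns_norm_def tensor_state_alg_embed flip: alg_embed_simps)

end

text \<open>Vectors of product states determine the norm of algebraic tensors by definition.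
  Approximating \<open>x\<close> by an algebraic tensor \<open>s\<close> costs e/2 in the operator
  bound and e/2 in the norm.\<close>

lemma norm_tensor_le:
  fixes x :: "'a::cstar_algebra \<otimes> 'b::cstar_algebra"
  assumes "0 \<le> c"
    and le: "\<And>\<phi> \<psi> t. state \<phi> \<Longrightarrow> state \<psi> \<Longrightarrow>
      gns_norm (tensor_state \<phi> \<psi>) (x * alg_embed t) \<le> c * gns_norm (tensor_state \<phi> \<psi>) (alg_embed t)"
  shows "norm x \<le> c"
proof (rule field_le_epsilon)
  fix e :: real assume e: "0 < e"
  obtain s where s: "dist (alg_embed s) x < e / 2" using alg_embed_approx[of "e / 2" x] e by auto
  have "spatial_norm s \<le> c + e / 2"
  proof (rule spatial_norm_le)
    have "gns_norm (prod_functional \<phi> \<psi>) (s * t) \<le> (c + e / 2) * gns_norm (prod_functional \<phi> \<psi>) t"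
      if st: "state \<phi>" "state \<psi>" for \<phi> :: "'a \<Rightarrow> complex" and \<psi> :: "'b \<Rightarrow> complex" and t
    proof -
      note S = state_tensor_state[OF st]
      note P = state_positive[OF S]
      let ?q = "gns_norm (tensor_state \<phi> \<psi>)"
      have "alg_embed (s * t) = x * alg_embed t + (alg_embed s - x) * alg_embed t"
        by (simp add: alg_embed_simps left_diff_distrib)
      then have "?q (alg_embed (s * t)) \<le> ?q (x * alg_embed t) + ?q ((alg_embed s - x) * alg_embed t)"
        using gns_norm_triangle[OF P] by metis
      also have "\<dots> \<le> c * ?q (alg_embed t) + norm (alg_embed s - x) * ?q (alg_embed t)"
        by (intro add_mono le st gns_norm_mult_le[OF P state_bounded_linear[OF S]])
      also have "\<dots> \<le> c * ?q (alg_embed t) + e / 2 * ?q (alg_embed t)"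
        using s by (intro add_left_mono mult_right_mono gns_norm_nonneg[OF P]) (simp add: dist_norm)
      finally show ?thesis by (simp add: gns_norm_alg_embed[OF st] distrib_right)
    qed
    then show "c + e / 2 \<in> spatial_bounds s" using assms(1) e by (simp add: spatial_bounds_def)
  qed
  then have "norm (alg_embed s) \<le> c + e / 2" by (simp add: norm_alg_embed)
  moreover have "norm x \<le> norm (alg_embed s) + norm (alg_embed s - x)"
    using norm_triangle_ineq2[of x "alg_embed s"] by (simp add: norm_minus_commute)
  ultimately show "norm x \<le> c + e" using s by (simp add: dist_norm)
qed


instance min_tensor :: (unital_cstar_algebra, unital_cstar_algebra) unital_cstar_algebra
proof
  obtain \<phi> :: "'a \<Rightarrow> complex" where \<phi>: "state \<phi>" using norming_state[of 1] by blast
  obtain \<psi> :: "'b \<Rightarrow> complex" where \<psi>: "state \<psi>" using norming_state[of 1] by blast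
  note S = state_tensor_state[OF \<phi> \<psi>]
  show "(0::'a \<otimes> 'b) \<noteq> 1"
    using state_one[OF S] clinear_simps(3)[OF state_clinear[OF S]] by auto
qed

text \<open>Identities between functionals of \<open>x\<close> and of its prescribed image
  \<open>y\<close> can thus be checked on generators before the map is known to exist.\<close>

lemma tensor_graph_induct:
  assumes "(x, y) \<in> tensor_graph \<beta>" "bounded_linear f" "bounded_linear g"
    and "\<And>a b. f (a \<otimes> b) = g (\<beta> a b)"
  shows "f x = g y"
proof -
  have "linear (\<lambda>p. f (fst p) - g (snd p))"
    by (intro bounded_linear.linear bounded_linear_sub bounded_linear_compose[OF assms(2) bounded_linear_fst]
      bounded_linear_compose[OF assms(3) bounded_linear_snd])
  moreover have "f (fst p) - g (snd p) = 0" if "p \<in> range (\<lambda>(a, b). (a \<otimes> b, \<beta> a b))" for p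
    using that assms(4) by auto
  ultimately have "f (fst (x, y)) - g (snd (x, y)) = 0"
    using assms(1) unfolding tensor_graph_def by (rule linear_eq_0_on_span)
  then show ?thesis by simp
qed

lemma clinear_tensor_lift:
  assumes "\<And>x y. (x, y) \<in> tensor_graph \<beta> \<Longrightarrow> norm y \<le> K * norm x"
    and "\<And>c a b. \<beta> (c *\<^sub>C a) b = c *\<^sub>C \<beta> a b"
  shows "clinear (tensor_lift \<beta>)"
proof -
  have B: "bounded_linear (tensor_lift \<beta>)" by (rule bounded_linear_tensor_lift[OF assms(1)])
  have pure: "tensor_lift \<beta> (a \<otimes> b) = \<beta> a b" for a b by (rule tensor_lift_pure[OF assms(1)])
  show ?thesis
    unfolding clinear_def
  proof (intro conjI allI)
    show "tensor_lift \<beta> (c *\<^sub>C x) = c *\<^sub>C tensor_lift \<beta> x" for c x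
    proof (rule tensor_eqI[of "\<lambda>x. tensor_lift \<beta> (c *\<^sub>C x)" "\<lambda>x. c *\<^sub>C tensor_lift \<beta> x"])
      show "bounded_linear (\<lambda>x. tensor_lift \<beta> (c *\<^sub>C x))"
        by (rule bounded_linear_compose[OF B bounded_linear_scaleC])
      show "bounded_linear (\<lambda>x. c *\<^sub>C tensor_lift \<beta> x)"
        by (rule bounded_linear_compose[OF bounded_linear_scaleC B])
      show "tensor_lift \<beta> (c *\<^sub>C (a \<otimes> b)) = c *\<^sub>C tensor_lift \<beta> (a \<otimes> b)" for a b
        unfolding pure_tensor_linear(3)[symmetric] pure by (rule assms(2))
    qed
  qed (rule linear_simps(1)[OF B])
qed

subsection \<open>Slice maps\<close>

text \<open>With \<psi> norming \<open>y\<close>, the value of \<mu> \<otimes> \<psi> at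
  \<open>(1 \<otimes> star y) * x\<close> is \<parallel>y\<parallel>^2, while it is at most
  \<parallel>y\<parallel> \<parallel>x\<parallel>.\<close>

lemma slice_left_bound:
  fixes \<mu> :: "'a::cstar_algebra \<Rightarrow> complex" and y :: "'b::unital_cstar_algebra"
  assumes \<mu>: "state \<mu>" and xy: "(x, y) \<in> tensor_graph (\<lambda>a b. \<mu> a *\<^sub>C b)"
  shows "norm y \<le> 1 * norm x"
proof -
  obtain \<psi> where \<psi>: "state \<psi>" "\<psi> (star y * y) = complex_of_real ((norm y)\<^sup>2)" by (rule norming_state)
  have "tensor_state \<mu> \<psi> ((1 \<otimes> star y) * x) = \<psi> (star y * y)"
  proof (rule tensor_graph_induct[OF xy, where f = "\<lambda>x. tensor_state \<mu> \<psi> ((1 \<otimes> star y) * x)" and g = "\<lambda>z. \<psi> (star y * z)"])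
    show "bounded_linear (\<lambda>x. tensor_state \<mu> \<psi> ((1 \<otimes> star y) * x))"
      by (rule bounded_linear_compose[OF bounded_linear_tensor_state[OF \<mu> \<psi>(1)] bounded_linear_mult_right])
    show "bounded_linear (\<lambda>z. \<psi> (star y * z))"
      by (rule bounded_linear_compose[OF state_bounded_linear[OF \<psi>(1)] bounded_linear_mult_right])
  qed (simp add: pure_tensor_simps \<mu> \<psi>(1) mult_scaleC_right clinear_simps[OF state_clinear[OF \<psi>(1)]])
  then have "(norm y)\<^sup>2 = cmod (tensor_state \<mu> \<psi> ((1 \<otimes> star y) * x))" using \<psi>(2) by (simp add: norm_power)
  also have "\<dots> \<le> norm (1 \<otimes> star y :: 'a \<otimes> 'b) * norm x"
    using state_norm_le[OF state_tensor_state[OF \<mu> \<psi>(1)]] norm_mult_ineq order_trans by blast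
  also have "norm (1 \<otimes> star y :: 'a \<otimes> 'b) \<le> norm y"
  proof -
    \<comment> \<open>\<open>'a\<close> is only a \<open>cstar_algebra\<close>, where the unit has
      norm 0 or 1.\<close>
    have "norm (1::'a) * norm (1::'a) = norm (1::'a)" using cstar_identity[of "1::'a"] by (simp add: star_simps power2_eq_square)
    then have "norm (1::'a) \<le> 1" by (cases "norm (1::'a) = 0") auto
    then have "norm (1::'a) * norm (star y) \<le> 1 * norm (star y)" by (intro mult_right_mono) auto
    then show ?thesis using norm_pure_tensor_le[of "1::'a" "star y"] by (simp add: norm_star)
  qed
  finally have "norm y * norm y \<le> norm y * norm x"
    by (simp add: power2_eq_square mult_right_mono)
  then show ?thesis by (cases "norm y = 0") auto
qed

definition slice_right :: "('b::cstar_algebra \<Rightarrow> complex) \<Rightarrow> 'a::cstar_algebra \<otimes> 'b \<Rightarrow> 'a" where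
  "slice_right \<mu> = tensor_lift (\<lambda>a b. \<mu> b *\<^sub>C a)"

lemma slice_right_bound:
  fixes \<mu> :: "'b::unital_cstar_algebra \<Rightarrow> complex" and y :: "'a::unital_cstar_algebra"
  assumes \<mu>: "state \<mu>" and xy: "(x, y) \<in> tensor_graph (\<lambda>a b. \<mu> b *\<^sub>C a)"
  shows "norm y \<le> 1 * norm x"
proof -
  obtain \<psi> where \<psi>: "state \<psi>" "\<psi> (star y * y) = complex_of_real ((norm y)\<^sup>2)" by (rule norming_state)
  have "tensor_state \<psi> \<mu> ((star y \<otimes> 1) * x) = \<psi> (star y * y)"
  proof (rule tensor_graph_induct[OF xy, where f = "\<lambda>x. tensor_state \<psi> \<mu> ((star y \<otimes> 1) * x)" and g = "\<lambda>z. \<psi> (star y * z)"])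
    show "bounded_linear (\<lambda>x. tensor_state \<psi> \<mu> ((star y \<otimes> 1) * x))"
      by (rule bounded_linear_compose[OF bounded_linear_tensor_state[OF \<psi>(1) \<mu>] bounded_linear_mult_right])
    show "bounded_linear (\<lambda>z. \<psi> (star y * z))"
      by (rule bounded_linear_compose[OF state_bounded_linear[OF \<psi>(1)] bounded_linear_mult_right])
  qed (simp add: pure_tensor_simps \<mu> \<psi>(1) mult_scaleC_right clinear_simps[OF state_clinear[OF \<psi>(1)]])
  then have "(norm y)\<^sup>2 = cmod (tensor_state \<psi> \<mu> ((star y \<otimes> 1) * x))" using \<psi>(2) by (simp add: norm_power)
  also have "\<dots> \<le> norm (star y \<otimes> 1 :: 'a \<otimes> 'b) * norm x"
    using state_norm_le[OF state_tensor_state[OF \<psi>(1) \<mu>]] norm_mult_ineq order_trans by blast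
  also have "norm (star y \<otimes> 1 :: 'a \<otimes> 'b) \<le> norm y"
    using norm_pure_tensor_le[of "star y" "1::'b"] by (simp add: norm_star)
  finally have "norm y * norm y \<le> norm y * norm x"
    by (simp add: power2_eq_square mult_right_mono)
  then show ?thesis by (cases "norm y = 0") auto
qed

context
  fixes \<mu> :: "'a::cstar_algebra \<Rightarrow> complex"
  assumes \<mu>: "state \<mu>"
begin

lemma bounded_linear_slice_left: "bounded_linear (slice_left \<mu> :: _ \<Rightarrow> 'b::unital_cstar_algebra)"
  unfolding slice_left_def by (rule bounded_linear_tensor_lift[OF slice_left_bound[OF \<mu>]])

lemma slice_left_pure: "slice_left \<mu> (a \<otimes> b) = \<mu> a *\<^sub>C (b::'b::unital_cstar_algebra)"
  unfolding slice_left_def by (rule tensor_lift_pure[OF slice_left_bound[OF \<mu>]])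

lemma state_slice_left:
  fixes c d :: "'b::unital_cstar_algebra"
  assumes \<psi>: "state \<psi>"
  shows "\<psi> (c * slice_left \<mu> x * d) = tensor_state \<mu> \<psi> ((1 \<otimes> c) * x * (1 \<otimes> d))"
proof (rule tensor_eqI[of "\<lambda>x. \<psi> (c * slice_left \<mu> x * d)" "\<lambda>x. tensor_state \<mu> \<psi> ((1 \<otimes> c) * x * (1 \<otimes> d))"])
  show "bounded_linear (\<lambda>x. \<psi> (c * slice_left \<mu> x * d))"
    by (rule bounded_linear_compose[OF bounded_linear_compression[OF state_bounded_linear[OF \<psi>]] bounded_linear_slice_left])
  show "bounded_linear (\<lambda>x. tensor_state \<mu> \<psi> ((1 \<otimes> c) * x * (1 \<otimes> d)))"
    by (rule bounded_linear_compression[OF bounded_linear_tensor_state[OF \<mu> \<psi>]])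
qed (simp add: slice_left_pure pure_tensor_simps \<mu> \<psi> mult_scaleC_left mult_scaleC_right
    clinear_simps[OF state_clinear[OF \<psi>]])

lemma slice_left_star: "slice_left \<mu> (star x) = star (slice_left \<mu> x :: 'b::unital_cstar_algebra)"
proof (rule tensor_eqI[of "\<lambda>x. slice_left \<mu> (star x)" "\<lambda>x. star (slice_left \<mu> x)"])
  show "bounded_linear (\<lambda>x. slice_left \<mu> (star x) :: 'b)"
    by (rule bounded_linear_compose[OF bounded_linear_slice_left bounded_linear_star])
  show "bounded_linear (\<lambda>x. star (slice_left \<mu> x :: 'b))"
    by (rule bounded_linear_compose[OF bounded_linear_star bounded_linear_slice_left])
qed (simp add: pure_tensor_simps slice_left_pure star_scaleC state_star[OF \<mu>])

end

context
  fixes \<mu> :: "'b::unital_cstar_algebra \<Rightarrow> complex"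
  assumes \<mu>: "state \<mu>"
begin

lemma bounded_linear_slice_right: "bounded_linear (slice_right \<mu> :: _ \<Rightarrow> 'a::unital_cstar_algebra)"
  unfolding slice_right_def by (rule bounded_linear_tensor_lift[OF slice_right_bound[OF \<mu>]])

lemma slice_right_pure: "slice_right \<mu> (a \<otimes> b) = \<mu> b *\<^sub>C (a::'a::unital_cstar_algebra)"
  unfolding slice_right_def by (rule tensor_lift_pure[OF slice_right_bound[OF \<mu>]])

lemma state_slice_right:
  fixes c d :: "'a::unital_cstar_algebra"
  assumes \<psi>: "state \<psi>"
  shows "\<psi> (c * slice_right \<mu> x * d) = tensor_state \<psi> \<mu> ((c \<otimes> 1) * x * (d \<otimes> 1))"
proof (rule tensor_eqI[of "\<lambda>x. \<psi> (c * slice_right \<mu> x * d)" "\<lambda>x. tensor_state \<psi> \<mu> ((c \<otimes> 1) * x * (d \<otimes> 1))"])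
  show "bounded_linear (\<lambda>x. \<psi> (c * slice_right \<mu> x * d))"
    by (rule bounded_linear_compose[OF bounded_linear_compression[OF state_bounded_linear[OF \<psi>]] bounded_linear_slice_right])
  show "bounded_linear (\<lambda>x. tensor_state \<psi> \<mu> ((c \<otimes> 1) * x * (d \<otimes> 1)))"
    by (rule bounded_linear_compression[OF bounded_linear_tensor_state[OF \<psi> \<mu>]])
qed (simp add: slice_right_pure pure_tensor_simps \<mu> \<psi> mult_scaleC_left mult_scaleC_right
    clinear_simps[OF state_clinear[OF \<psi>]])

end

subsection \<open>Tensor products of homomorphisms\<close>

lemma state_compose_hom:
  fixes f :: "'a::unital_cstar_algebra \<Rightarrow> 'b::cstar_algebra"
  assumes "unital_star_hom f" "state \<phi>"
  shows "state (\<lambda>x. \<phi> (f x))"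
proof (rule stateI)
  have f: "clinear f" "\<And>x y. f (x * y) = f x * f y" "\<And>x. f (star x) = star (f x)" "f 1 = 1"
    using assms(1) by (simp_all add: unital_star_hom_def)
  show "positive_functional (\<lambda>x. \<phi> (f x))"
    using assms(2) by (simp add: positive_functional_def clinear_def f clinear_simps[OF f(1)] state_def
      clinear_simps[OF state_clinear[OF assms(2)]])
  show "\<phi> (f 1) = 1" by (simp add: f state_one assms(2))
qed

lemma linear_span_subset:
  assumes "linear L" "\<And>s. s \<in> S \<Longrightarrow> L s \<in> span T" "z \<in> span S"
  shows "L z \<in> span T"
proof -
  have "L z \<in> span (L ` S)" unfolding linear_span_image[OF assms(1)] using assms(3) by (rule imageI)
  moreover have "span (L ` S) \<subseteq> span T" by (rule span_minimal) (use assms(2) in \<open>auto intro: subspace_span\<close>)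
  ultimately show ?thesis by blast
qed

lemma span_graph_star:
  fixes S :: "('a::cstar_algebra \<times> 'b::cstar_algebra) set"
  assumes "\<And>p. p \<in> S \<Longrightarrow> (star (fst p), star (snd p)) \<in> span S" "(x, y) \<in> span S"
  shows "(star x, star y) \<in> span S"
proof -
  have "linear (\<lambda>p::'a \<times> 'b. (star (fst p), star (snd p)))"
    by (rule linearI) (simp_all add: star_add star_scaleR)
  from linear_span_subset[OF this assms] show ?thesis by simp
qed

lemma span_graph_mult:
  fixes S :: "('a::cstar_algebra \<times> 'b::cstar_algebra) set"
  assumes S: "\<And>p q. p \<in> S \<Longrightarrow> q \<in> S \<Longrightarrow> (fst p * fst q, snd p * snd q) \<in> span S"
    and "(x, y) \<in> span S" "(x', y') \<in> span S"
  shows "(x * x', y * y') \<in> span S"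
proof -
  have l: "linear (\<lambda>p::'a \<times> 'b. (fst p * c, snd p * d))" for c d
    by (rule linearI) (simp_all add: distrib_right)
  have r: "linear (\<lambda>p::'a \<times> 'b. (c * fst p, d * snd p))" for c d
    by (rule linearI) (simp_all add: distrib_left)
  have "(fst p * x', snd p * y') \<in> span S" if "p \<in> S" for p
    using linear_span_subset[OF r S[OF that] assms(3)] by simp
  from linear_span_subset[OF l this assms(2)] show ?thesis by simp
qed

context
  fixes f :: "'a::unital_cstar_algebra \<Rightarrow> 'c::cstar_algebra" and g :: "'b::unital_cstar_algebra \<Rightarrow> 'd::cstar_algebra"
  assumes f: "unital_star_hom f" and g: "unital_star_hom g"
begin

abbreviation map_graph :: "('a \<otimes> 'b \<times> 'c \<otimes> 'd) set" where
  "map_graph \<equiv> tensor_graph (\<lambda>a b. f a \<otimes> g b)"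

lemma hom_simps:
  "f (a * a') = f a * f a'" "f (star a) = star (f a)" "f 1 = 1" "clinear f"
  "g (b * b') = g b * g b'" "g (star b) = star (g b)" "g 1 = 1" "clinear g"
  using f g by (simp_all add: unital_star_hom_def)

text \<open>The graph is closed under adjoints and products, so bounds on functionals of
  \<open>star X * X\<close> are available before f \<otimes> g is known to exist.\<close>

lemma map_graph_square:
  assumes "(x, X) \<in> map_graph" shows "(star x * x, star X * X) \<in> map_graph"
proof -
  have "(star x, star X) \<in> map_graph"
    using assms unfolding tensor_graph_def
  proof (rule span_graph_star[rotated])
    fix p assume "p \<in> range (\<lambda>(a, b). (a \<otimes> b, f a \<otimes> g b))"
    then obtain a b where "p = (a \<otimes> b, f a \<otimes> g b)" by auto
    then show "(star (fst p), star (snd p)) \<in> span (range (\<lambda>(a, b). (a \<otimes> b, f a \<otimes> g b)))"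
      using tensor_graphI[of "star a" "star b" "\<lambda>a b. f a \<otimes> g b"]
      by (simp add: tensor_graph_def pure_tensor_simps hom_simps)
  qed
  then show ?thesis
    using assms unfolding tensor_graph_def
  proof (rule span_graph_mult[rotated])
    fix p q assume "p \<in> range (\<lambda>(a, b). (a \<otimes> b, f a \<otimes> g b))" "q \<in> range (\<lambda>(a, b). (a \<otimes> b, f a \<otimes> g b))"
    then obtain a b a' b' where "p = (a \<otimes> b, f a \<otimes> g b)" "q = (a' \<otimes> b', f a' \<otimes> g b')" by auto
    then show "(fst p * fst q, snd p * snd q) \<in> span (range (\<lambda>(a, b). (a \<otimes> b, f a \<otimes> g b)))"
      using tensor_graphI[of "a * a'" "b * b'" "\<lambda>a b. f a \<otimes> g b"]
      by (simp add: tensor_graph_def pure_tensor_simps hom_simps)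
  qed
qed

context
  fixes \<phi> :: "'c \<Rightarrow> complex" and \<psi> :: "'d \<Rightarrow> complex"
  assumes \<phi>: "state \<phi>" and \<psi>: "state \<psi>"
begin

text \<open>The vector functional of \<open>c \<otimes> d\<close>, pulled back along
  \<open>f\<close> and \<open>g\<close>, is a multiple of a product state on the source and hence
  bounded by the norm of \<open>x\<close>; at \<open>star X * X\<close> it bounds the vector
  \<open>X * (c \<otimes> d)\<close>. The constant depends on \<open>c\<close> and
  \<open>d\<close>.\<close>

lemma map_graph_pure_bound:
  "\<exists>K\<ge>0. \<forall>(x, X)\<in>map_graph. gns_norm (tensor_state \<phi> \<psi>) (X * (c \<otimes> d)) \<le> K * norm x"
proof -
  note S = state_tensor_state[OF \<phi> \<psi>]
  let ?\<tau> = "\<lambda>X. tensor_state \<phi> \<psi> (star (c \<otimes> d) * X * (c \<otimes> d))"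
  have B: "bounded_linear ?\<tau>" by (rule bounded_linear_compression[OF state_bounded_linear[OF S]])
  have \<tau>: "?\<tau> (a \<otimes> b) = \<phi> (star c * a * c) * \<psi> (star d * b * d)" for a b
    by (simp add: pure_tensor_simps \<phi> \<psi>)
  have "\<exists>K\<ge>0. \<forall>(x, X)\<in>map_graph. cmod (?\<tau> X) \<le> K * norm x"
  proof -
    have zero: ?thesis if "\<And>a b. ?\<tau> (a \<otimes> b) = 0"
    proof -
      have "?\<tau> X = 0" for X by (rule tensor_eqI[OF B bounded_linear_zero that])
      then show ?thesis by (intro exI[of _ 0]) simp
    qed
    have "positive_functional (\<lambda>z. \<phi> (star c * z * c))" "bounded_linear (\<lambda>z. \<phi> (star c * z * c))"
      by (simp_all add: positive_functional_compression state_positive bounded_linear_compression state_bounded_linear \<phi>)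
    then show ?thesis
    proof (cases rule: state_normalize)
      case (1 \<phi>')
      note \<phi>' = 1
      have "positive_functional (\<lambda>z. \<psi> (star d * z * d))" "bounded_linear (\<lambda>z. \<psi> (star d * z * d))"
        by (simp_all add: positive_functional_compression state_positive bounded_linear_compression state_bounded_linear \<psi>)
      then show ?thesis
      proof (cases rule: state_normalize)
        case (1 \<psi>')
        note sf = state_compose_hom[OF f \<phi>'(1)] and sg = state_compose_hom[OF g 1(1)]
        define k l where "k = Re (\<phi> (star c * 1 * c))" and "l = Re (\<psi> (star d * 1 * d))"
        have kl: "\<phi> (star c * a * c) = of_real k * \<phi>' a" "\<psi> (star d * b * d) = of_real l * \<psi>' b" for a b
          unfolding k_def l_def using fun_cong[OF \<phi>'(2), of a] fun_cong[OF 1(2), of b] by simp_all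
        have "cmod (?\<tau> X) \<le> \<bar>k * l\<bar> * norm x" if "(x, X) \<in> map_graph" for x X
        proof -
          have "of_real (k * l) * tensor_state (\<lambda>x. \<phi>' (f x)) (\<lambda>x. \<psi>' (g x)) x = ?\<tau> X"
          proof (rule tensor_graph_induct[OF that _ B, where f = "\<lambda>x. of_real (k * l) * tensor_state (\<lambda>x. \<phi>' (f x)) (\<lambda>x. \<psi>' (g x)) x"])
            show "bounded_linear (\<lambda>x. of_real (k * l) * tensor_state (\<lambda>x. \<phi>' (f x)) (\<lambda>x. \<psi>' (g x)) x)"
              by (rule bounded_linear_compose[OF bounded_linear_mult_right bounded_linear_tensor_state[OF sf sg]])
            show "of_real (k * l) * tensor_state (\<lambda>x. \<phi>' (f x)) (\<lambda>x. \<psi>' (g x)) (a \<otimes> b) = ?\<tau> (f a \<otimes> g b)" for a b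
              by (simp only: \<tau> kl tensor_state_pure[OF sf sg]) simp
          qed
          then have "cmod (?\<tau> X) = \<bar>k * l\<bar> * cmod (tensor_state (\<lambda>x. \<phi>' (f x)) (\<lambda>x. \<psi>' (g x)) x)"
            by (metis norm_mult norm_of_real)
          then show ?thesis
            using mult_left_mono[OF state_norm_le[OF state_tensor_state[OF sf sg]], of "\<bar>k * l\<bar>" x] by simp
        qed
        then show ?thesis by (intro exI[of _ "\<bar>k * l\<bar>"]) auto
      next
        case 2
        then show ?thesis by (intro zero) (simp only: \<tau> fun_cong[OF 2] mult_zero_right)
      qed
    next
      case 2
      then show ?thesis by (intro zero) (simp only: \<tau> fun_cong[OF 2] mult_zero_left)
    qed
  qed
  then obtain K where K: "K \<ge> 0" "\<And>x X. (x, X) \<in> map_graph \<Longrightarrow> cmod (?\<tau> X) \<le> K * norm x" by auto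
  have "gns_norm (tensor_state \<phi> \<psi>) (X * (c \<otimes> d)) \<le> sqrt K * norm x" if "(x, X) \<in> map_graph" for x X
  proof (rule power2_le_imp_le)
    have "(gns_norm (tensor_state \<phi> \<psi>) (X * (c \<otimes> d)))\<^sup>2 = Re (?\<tau> (star X * X))"
      by (simp add: gns_norm_sq[OF state_positive[OF S]] star_mult mult.assoc)
    also have "\<dots> \<le> K * norm (star x * x)"
      using K(2)[OF map_graph_square[OF that]] complex_Re_le_cmod order_trans by blast
    also have "\<dots> = (sqrt K * norm x)\<^sup>2" using K(1) by (simp add: cstar_identity power_mult_distrib)
    finally show "(gns_norm (tensor_state \<phi> \<psi>) (X * (c \<otimes> d)))\<^sup>2 \<le> (sqrt K * norm x)\<^sup>2" .
  qed (simp add: K(1))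
  then show ?thesis using K(1) by (intro exI[of _ "sqrt K"]) auto
qed

lemma map_graph_alg_bound:
  "\<exists>K\<ge>0. \<forall>(x, X)\<in>map_graph. gns_norm (tensor_state \<phi> \<psi>) (X * alg_embed t) \<le> K * norm x"
proof (induction t rule: alg_tensor_induct)
  case zero
  show ?case
    using state_tensor_state[OF \<phi> \<psi>]
    by (intro exI[of _ 0]) (simp add: alg_embed_simps gns_norm_def star_simps clinear_simps state_clinear)
next
  case (add c d t)
  note P = state_positive[OF state_tensor_state[OF \<phi> \<psi>]]
  obtain K where K: "K \<ge> 0" "\<And>x X. (x, X) \<in> map_graph \<Longrightarrow> gns_norm (tensor_state \<phi> \<psi>) (X * (c \<otimes> d)) \<le> K * norm x"
    using map_graph_pure_bound[of c d] by auto
  obtain L where L: "L \<ge> 0" "\<And>x X. (x, X) \<in> map_graph \<Longrightarrow> gns_norm (tensor_state \<phi> \<psi>) (X * alg_embed t) \<le> L * norm x"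
    using add by auto
  have "gns_norm (tensor_state \<phi> \<psi>) (X * alg_embed (alg_pure c d + t)) \<le> (K + L) * norm x"
    if "(x, X) \<in> map_graph" for x X
  proof -
    have "X * alg_embed (alg_pure c d + t) = X * (c \<otimes> d) + X * alg_embed t"
      by (simp add: alg_embed_simps distrib_left pure_tensor_def)
    then show ?thesis
      using gns_norm_triangle[OF P, of "X * (c \<otimes> d)" "X * alg_embed t"] K(2)[OF that] L(2)[OF that]
      by (simp add: distrib_right)
  qed
  then show ?case using K(1) L(1) by (intro exI[of _ "K + L"]) auto
qed

text \<open>The constant depending on \<open>t\<close> improves to \<open>1\<close> because \<open>\<sigma> x = \<langle>X t, t\<rangle>\<close> extends to a
  bounded positive functional on the C*-algebra \<open>'a \<otimes> 'b\<close>.\<close>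

lemma map_graph_gns_bound:
  assumes "(x, X) \<in> map_graph"
  shows "gns_norm (tensor_state \<phi> \<psi>) (X * alg_embed t) \<le> norm x * gns_norm (tensor_state \<phi> \<psi>) (alg_embed t)"
proof -
  note S = state_tensor_state[OF \<phi> \<psi>]
  note P = state_positive[OF S]
  define y where "y = (alg_embed t :: 'c \<otimes> 'd)"
  obtain K where K: "K \<ge> 0" "\<And>x X. (x, X) \<in> map_graph \<Longrightarrow> gns_norm (tensor_state \<phi> \<psi>) (X * y) \<le> K * norm x"
    using map_graph_alg_bound[of t] by (auto simp: y_def)
  let ?\<tau> = "\<lambda>X. tensor_state \<phi> \<psi> (star y * X * y)"
  let ?\<beta> = "\<lambda>a b. ?\<tau> (f a \<otimes> g b)"
  have B: "bounded_linear ?\<tau>" by (rule bounded_linear_compression[OF state_bounded_linear[OF S]])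
  have bd: "norm s \<le> (gns_norm (tensor_state \<phi> \<psi>) y * K) * norm x" if xs: "(x, s) \<in> tensor_graph ?\<beta>" for x s
  proof -
    have l: "linear (\<lambda>p::'a \<otimes> 'b \<times> 'c \<otimes> 'd. (fst p, ?\<tau> (snd p)))"
      by (intro bounded_linear.linear bounded_linear_Pair bounded_linear_fst
        bounded_linear_compose[OF B bounded_linear_snd])
    \<comment> \<open>\<open>?\<beta>\<close> is \<open>?\<tau>\<close> after the prescribed map, so
      each pair of its graph comes from a pair of \<open>map_graph\<close>.\<close>
    have eq: "tensor_graph ?\<beta> = (\<lambda>p. (fst p, ?\<tau> (snd p))) ` map_graph"
      unfolding tensor_graph_def linear_span_image[OF l, symmetric] by (simp add: image_image case_prod_unfold)
    obtain p where p: "(x, s) = (fst p, ?\<tau> (snd p))" "p \<in> map_graph" using xs unfolding eq by (rule imageE)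
    define X where "X = snd p"
    have X: "(x, X) \<in> map_graph" and s: "s = ?\<tau> X" using p by (simp_all add: X_def)
    have "norm s \<le> gns_norm (tensor_state \<phi> \<psi>) y * gns_norm (tensor_state \<phi> \<psi>) (X * y)"
      using gns_CS[OF P, of y "X * y"] by (simp add: s mult.assoc)
    also have "\<dots> \<le> gns_norm (tensor_state \<phi> \<psi>) y * (K * norm x)"
      by (intro mult_left_mono K(2)[OF X] gns_norm_nonneg[OF P])
    finally show ?thesis by (simp add: mult.assoc)
  qed
  define \<sigma> where "\<sigma> = tensor_lift ?\<beta>"
  have bl: "bounded_linear \<sigma>" unfolding \<sigma>_def by (rule bounded_linear_tensor_lift[OF bd])
  have \<sigma>: "\<sigma> x = ?\<tau> X" if "(x, X) \<in> map_graph" for x X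
    by (rule tensor_graph_induct[OF that bl B]) (simp add: \<sigma>_def tensor_lift_pure[OF bd])
  have cl: "clinear \<sigma>"
    unfolding \<sigma>_def by (rule clinear_tensor_lift[OF bd])
      (simp_all add: clinear_simps[OF hom_simps(4)] pure_tensor_linear mult_scaleC_left mult_scaleC_right
        clinear_simps[OF state_clinear[OF S]])
  have "\<sigma> (star x * x) \<in> \<real>\<^sub>\<ge>\<^sub>0" for x
  proof (rule tensor_closed_induct[OF closed_positive_squares[OF bl]])
    fix u :: "('a, 'b) alg_tensor"
    have "alg_embed u \<in> fst ` map_graph" unfolding fst_tensor_graph by (rule alg_embed_in_span)
    then obtain U where "(alg_embed u, U) \<in> map_graph" by (elim imageE) (metis prod.collapse)
    from \<sigma>[OF map_graph_square[OF this]] show "\<sigma> (star (alg_embed u) * alg_embed u) \<in> \<real>\<^sub>\<ge>\<^sub>0"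
      using positive_functional_compression[OF P, of y] by (simp add: positive_functional_def)
  qed
  then have pos: "positive_functional \<sigma>" using cl by (simp add: positive_functional_def)
  have "(1, 1) \<in> map_graph"
    using tensor_graphI[of 1 1 "\<lambda>a b. f a \<otimes> g b"] by (simp add: hom_simps pure_tensor_one)
  then have "Re (?\<tau> (star X * X)) \<le> (norm x)\<^sup>2 * Re (?\<tau> 1)"
    using pos_bounded[OF pos bl, of x] \<sigma> map_graph_square[OF assms] by simp
  then have "(gns_norm (tensor_state \<phi> \<psi>) (X * y))\<^sup>2 \<le> (norm x * gns_norm (tensor_state \<phi> \<psi>) y)\<^sup>2"
    by (simp add: gns_norm_sq[OF P] star_mult mult.assoc power_mult_distrib)
  then show ?thesis
    unfolding y_def by (rule power2_le_imp_le) (simp add: gns_norm_nonneg[OF P])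
qed

end

lemma map_graph_norm_le: "(x, X) \<in> map_graph \<Longrightarrow> norm X \<le> 1 * norm x"
  using map_graph_gns_bound by (intro norm_tensor_le) simp_all

lemma bounded_linear_tensor_map: "bounded_linear (tensor_map f g)"
  unfolding tensor_map_def by (rule bounded_linear_tensor_lift[OF map_graph_norm_le])

lemma tensor_map_pure: "tensor_map f g (a \<otimes> b) = f a \<otimes> g b"
  unfolding tensor_map_def by (rule tensor_lift_pure[OF map_graph_norm_le])

end


subsection \<open>The associativity isomorphism\<close>

text \<open>A self-adjoint operator is bounded by its numerical radius, here in the GNS seminorm:
  evaluate the form at \<open>y + b\<close> and \<open>y - b\<close> and use the parallelogram law.
  With b = T y / K the term of \<open>b\<close> absorbs half of the left-hand side.\<close>

lemma form_bound_operator_bound: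
  fixes \<tau> :: "'a::cstar_algebra \<Rightarrow> complex"
  assumes \<tau>: "state \<tau>" and T: "star T = T" and K: "0 < K"
    and bound: "\<And>z. \<bar>Re (\<tau> (star z * T * z))\<bar> \<le> K * (gns_norm \<tau> z)\<^sup>2"
  shows "gns_norm \<tau> (T * y) \<le> K * gns_norm \<tau> y"
proof -
  note P = state_positive[OF \<tau>] and l = clinear_simps[OF state_clinear[OF \<tau>]]
  define u where "u = T * y"
  define b where "b = complex_of_real (1 / K) *\<^sub>C u"
  let ?F = "\<lambda>z. Re (\<tau> (star z * T * z))"
  have herm: "Re (\<tau> (star y * T * b)) = Re (\<tau> (star b * T * y))"
    using state_star[OF \<tau>, of "star b * T * y"] by (simp add: star_mult star_star T mult.assoc)
  have "\<tau> (star b * T * y) = complex_of_real (1 / K) * \<tau> (star u * u)"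
    by (simp add: b_def star_scaleC mult_scaleC_left l u_def mult.assoc)
  then have bu: "Re (\<tau> (star b * T * y)) = (1 / K) * (gns_norm \<tau> u)\<^sup>2"
    by (simp add: gns_norm_sq[OF P])
  have "?F (y + b) - ?F (y - b) = 2 * Re (\<tau> (star y * T * b)) + 2 * Re (\<tau> (star b * T * y))"
    by (simp add: star_add star_simps distrib_left distrib_right left_diff_distrib right_diff_distrib l)
  then have "4 * ((1 / K) * (gns_norm \<tau> u)\<^sup>2) = ?F (y + b) - ?F (y - b)"
    unfolding herm bu by simp
  also have "\<dots> \<le> K * (gns_norm \<tau> (y + b))\<^sup>2 + K * (gns_norm \<tau> (y - b))\<^sup>2"
    using bound[of "y + b"] bound[of "y - b"] by linarith
  also have "\<dots> = 2 * K * ((gns_norm \<tau> y)\<^sup>2 + (gns_norm \<tau> b)\<^sup>2)"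
    by (simp add: gns_norm_sq[OF P] star_add star_simps distrib_left distrib_right left_diff_distrib right_diff_distrib l)
  also have "(gns_norm \<tau> b)\<^sup>2 = (1 / K)\<^sup>2 * (gns_norm \<tau> u)\<^sup>2"
    unfolding b_def using K by (simp add: gns_norm_scaleC[OF P] power_divide norm_divide)
  finally have "(gns_norm \<tau> u)\<^sup>2 \<le> (K * gns_norm \<tau> y)\<^sup>2"
    using K by (simp add: field_simps power2_eq_square)
  then show ?thesis
    unfolding u_def by (rule power2_le_imp_le) (use K in \<open>simp add: gns_norm_nonneg[OF P]\<close>)
qed

text \<open>Since product states are norming, the hypothesis gives \<open>\<parallel>K - d\<parallel> \<le> K\<close> for \<open>K = \<parallel>d\<parallel>\<close>.\<close>

lemma nonneg_if_product_states_nonneg: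
  fixes d :: "'a::cstar_algebra \<otimes> 'b::cstar_algebra"
  assumes d: "star d = d"
    and nonneg: "\<And>\<phi> \<psi> y. state \<phi> \<Longrightarrow> state \<psi> \<Longrightarrow> 0 \<le> Re (tensor_state \<phi> \<psi> (star y * d * y))"
    and \<omega>: "state \<omega>"
  shows "0 \<le> Re (\<omega> d)"
proof (cases "d = 0")
  case True
  then show ?thesis by (simp add: clinear_simps[OF state_clinear[OF \<omega>]])
next
  case False
  define K where "K = norm d"
  have K: "0 < K" using False by (simp add: K_def)
  define T where "T = complex_of_real K *\<^sub>C 1 - d"
  have "norm T \<le> K"
  proof (rule norm_tensor_le)
    fix \<phi> :: "'a \<Rightarrow> complex" and \<psi> :: "'b \<Rightarrow> complex" and t
    assume st: "state \<phi>" "state \<psi>"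
    note S = state_tensor_state[OF st]
    note P = state_positive[OF S] and l = clinear_simps[OF state_clinear[OF S]]
    have "\<bar>Re (tensor_state \<phi> \<psi> (star z * T * z))\<bar> \<le> K * (gns_norm (tensor_state \<phi> \<psi>) z)\<^sup>2" for z
    proof -
      have e: "Re (tensor_state \<phi> \<psi> (star z * T * z)) =
          K * (gns_norm (tensor_state \<phi> \<psi>) z)\<^sup>2 - Re (tensor_state \<phi> \<psi> (star z * d * z))"
        by (simp add: T_def left_diff_distrib right_diff_distrib mult_scaleC_left mult_scaleC_right l gns_norm_sq[OF P])
      have "Re (tensor_state \<phi> \<psi> (star z * (d * z))) \<le> gns_norm (tensor_state \<phi> \<psi>) z * gns_norm (tensor_state \<phi> \<psi>) (d * z)"
        by (rule order_trans[OF complex_Re_le_cmod gns_CS[OF P]])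
      also have "\<dots> \<le> gns_norm (tensor_state \<phi> \<psi>) z * (K * gns_norm (tensor_state \<phi> \<psi>) z)"
        unfolding K_def
        by (intro mult_left_mono gns_norm_mult_le[OF P state_bounded_linear[OF S]] gns_norm_nonneg[OF P])
      also have "\<dots> = K * (gns_norm (tensor_state \<phi> \<psi>) z)\<^sup>2" by (simp add: power2_eq_square)
      finally have "Re (tensor_state \<phi> \<psi> (star z * d * z)) \<le> K * (gns_norm (tensor_state \<phi> \<psi>) z)\<^sup>2"
        by (simp only: mult.assoc)
      moreover have "0 \<le> K * (gns_norm (tensor_state \<phi> \<psi>) z)\<^sup>2" using K by simp
      ultimately show ?thesis unfolding e using nonneg[OF st, of z] by linarith
    qed
    then show "gns_norm (tensor_state \<phi> \<psi>) (T * alg_embed t) \<le> K * gns_norm (tensor_state \<phi> \<psi>) (alg_embed t)"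
      using K by (intro form_bound_operator_bound[OF S]) (simp_all add: T_def star_simps star_scaleC d)
  qed (use K in simp)
  then have "Re (\<omega> T) \<le> K"
    using state_norm_le[OF \<omega>, of T] complex_Re_le_cmod[of "\<omega> T"] by linarith
  then show ?thesis by (simp add: T_def clinear_simps[OF state_clinear[OF \<omega>]] state_one[OF \<omega>])
qed

lemma bounded_linear_eq_on_dense_span:
  assumes "bounded_linear f" "bounded_linear g" "closure (span S) = UNIV" "\<And>x. x \<in> S \<Longrightarrow> f x = g x"
  shows "f = g"
proof -
  have "f x = g x" if "x \<in> span S" for x
    by (rule linear_eq_on_span[OF bounded_linear.linear[OF assms(1)] bounded_linear.linear[OF assms(2)] assms(4) that])
  then have "span S \<subseteq> {x. f x = g x}" by blast
  moreover have "closed {x. f x = g x}"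
    by (rule closed_Collect_eq[OF linear_continuous_on[OF assms(1)] linear_continuous_on[OF assms(2)]])
  ultimately have "closure (span S) \<subseteq> {x. f x = g x}" by (rule closure_minimal)
  then show ?thesis using assms(3) by auto
qed

lemma pure_tensors_dense:
  assumes "\<And>a b. a \<otimes> b \<in> closure (span S)"
  shows "closure (span S) = UNIV"
proof -
  have "pures \<subseteq> closure (span S)" using assms by (auto simp: pures_def)
  then have "span pures \<subseteq> closure (span S)"
    by (intro span_minimal subspace_closure subspace_span)
  then have "closure (span pures) \<subseteq> closure (span S)" by (rule closure_minimal) simp
  then show ?thesis by (simp add: pures_dense top.extremum_uniqueI)
qed

lemma dense_span_all:
  assumes "closure (span X) = UNIV" "bounded_linear h" "\<And>x. x \<in> X \<Longrightarrow> h x \<in> closure (span S)"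
  shows "h y \<in> closure (span S)"
proof -
  have "closed (h -` closure (span S))"
    by (rule closed_vimage[OF closed_closure linear_continuous_on[OF assms(2)]])
  moreover have "span X \<subseteq> h -` closure (span S)"
  proof (rule span_minimal)
    show "subspace (h -` closure (span S))"
      by (rule linear_subspace_vimage[OF bounded_linear.linear[OF assms(2)] subspace_closure[OF subspace_span]])
  qed (use assms(3) in blast)
  ultimately have "closure (span X) \<subseteq> h -` closure (span S)" by (intro closure_minimal)
  then show ?thesis using assms(1) by blast
qed

text \<open>In \<open>tensor_graph\<close> the left factor would run through the completed product;
  images are prescribed only for triples of elements, so the graph has its own generators.\<close>

definition assoc_gens :: "((('a::cstar_algebra \<otimes> 'b::cstar_algebra) \<otimes> 'c::cstar_algebra) \<times> ('a \<otimes> 'b \<otimes> 'c)) set" where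
  "assoc_gens = range (\<lambda>(a, b, c). ((a \<otimes> b) \<otimes> c, a \<otimes> b \<otimes> c))"

lemma assoc_gensI: "((a \<otimes> b) \<otimes> c, a \<otimes> b \<otimes> c) \<in> assoc_gens"
  unfolding assoc_gens_def by (rule range_eqI[of _ _ "(a, b, c)"]) simp

lemma assoc_gensE:
  assumes "p \<in> assoc_gens" obtains a b c where "p = ((a \<otimes> b) \<otimes> c, a \<otimes> b \<otimes> c)"
  using assms by (auto simp: assoc_gens_def)

text \<open>Density is shown one factor at a time: for fixed \<open>c\<close>,
  \<open>x \<otimes> c\<close> depends continuously on \<open>x\<close>, and \<open>x\<close> is a
  limit of sums of elementary tensors.\<close>

lemma fst_assoc_gens_dense: "closure (span (fst ` assoc_gens)) = UNIV"
proof (rule pure_tensors_dense)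
  fix x :: "'a \<otimes> 'b" and c :: 'c
  show "x \<otimes> c \<in> closure (span (fst ` assoc_gens))"
  proof (rule dense_span_all[OF pures_dense, where h = "\<lambda>x. x \<otimes> c"])
    show "bounded_linear (\<lambda>x. x \<otimes> c)"
      by (rule bounded_bilinear.bounded_linear_left[OF bounded_bilinear_pure_tensor])
    fix x :: "'a \<otimes> 'b" assume "x \<in> pures"
    then obtain a b where "x = a \<otimes> b" by (auto simp: pures_def)
    then have "x \<otimes> c \<in> fst ` assoc_gens" using imageI[OF assoc_gensI[of a b c], of fst] by simp
    then show "x \<otimes> c \<in> closure (span (fst ` assoc_gens))"
      by (rule subsetD[OF closure_subset span_base])
  qed
qed

lemma snd_assoc_gens_dense: "closure (span (snd ` assoc_gens)) = UNIV"
proof (rule pure_tensors_dense)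
  fix a :: 'a and x :: "'b \<otimes> 'c"
  show "a \<otimes> x \<in> closure (span (snd ` assoc_gens))"
  proof (rule dense_span_all[OF pures_dense, where h = "\<lambda>x. a \<otimes> x"])
    show "bounded_linear (\<lambda>x. a \<otimes> x)"
      by (rule bounded_bilinear.bounded_linear_right[OF bounded_bilinear_pure_tensor])
    fix x :: "'b \<otimes> 'c" assume "x \<in> pures"
    then obtain b c where "x = b \<otimes> c" by (auto simp: pures_def)
    then have "a \<otimes> x \<in> snd ` assoc_gens" using imageI[OF assoc_gensI[of a b c], of snd] by simp
    then show "a \<otimes> x \<in> closure (span (snd ` assoc_gens))"
      by (rule subsetD[OF closure_subset span_base])
  qed
qed

lemma assoc_graph_star: "(z, w) \<in> span assoc_gens \<Longrightarrow> (star z, star w) \<in> span assoc_gens"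
  by (erule span_graph_star[rotated], erule assoc_gensE) (simp add: pure_tensor_simps span_base assoc_gensI)

lemma assoc_graph_mult:
  assumes "(z, w) \<in> span assoc_gens" "(z', w') \<in> span assoc_gens"
  shows "(z * z', w * w') \<in> span assoc_gens"
proof (rule span_graph_mult[OF _ assms])
  fix p q :: "(('a \<otimes> 'b) \<otimes> 'c) \<times> ('a \<otimes> 'b \<otimes> 'c)"
  assume "p \<in> assoc_gens" "q \<in> assoc_gens"
  then show "(fst p * fst q, snd p * snd q) \<in> span assoc_gens"
    by (elim assoc_gensE) (simp add: pure_tensor_simps span_base assoc_gensI)
qed

lemma continuous_on_gns_norm:
  fixes \<tau> :: "'a::cstar_algebra \<Rightarrow> complex"
  assumes "bounded_linear \<tau>"
  shows "continuous_on UNIV (gns_norm \<tau>)"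
proof -
  have "continuous_on UNIV (\<lambda>x. star x * x :: 'a)"
    by (intro continuous_on_mult linear_continuous_on[OF bounded_linear_star] continuous_on_id)
  then have "continuous_on UNIV (\<lambda>x. \<tau> (star x * x))"
    by (rule continuous_on_compose2[OF linear_continuous_on[OF assms, of UNIV]]) simp
  then have "continuous_on UNIV (\<lambda>x. sqrt (Re (\<tau> (star x * x))))"
    by (intro continuous_on_real_sqrt continuous_on_Re)
  then show ?thesis unfolding gns_norm_def[abs_def] .
qed

context
  fixes \<phi> :: "'a::cstar_algebra \<Rightarrow> complex" and \<psi> :: "'b::cstar_algebra \<Rightarrow> complex" and \<omega> :: "'c::cstar_algebra \<Rightarrow> complex"
  assumes \<phi>: "state \<phi>" and \<psi>: "state \<psi>" and \<omega>: "state \<omega>"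
begin

lemma tensor_state_assoc_graph:
  assumes "(z, w) \<in> span assoc_gens"
  shows "tensor_state \<phi> (tensor_state \<psi> \<omega>) w = tensor_state (tensor_state \<phi> \<psi>) \<omega> z"
proof -
  note S1 = state_tensor_state[OF \<psi> \<omega>] and S2 = state_tensor_state[OF \<phi> \<psi>]
  have "linear (\<lambda>p. tensor_state \<phi> (tensor_state \<psi> \<omega>) (snd p) - tensor_state (tensor_state \<phi> \<psi>) \<omega> (fst p))"
    by (intro bounded_linear.linear bounded_linear_sub
      bounded_linear_compose[OF bounded_linear_tensor_state[OF \<phi> S1] bounded_linear_snd]
      bounded_linear_compose[OF bounded_linear_tensor_state[OF S2 \<omega>] bounded_linear_fst])
  moreover have "tensor_state \<phi> (tensor_state \<psi> \<omega>) (snd p) - tensor_state (tensor_state \<phi> \<psi>) \<omega> (fst p) = 0"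
    if "p \<in> assoc_gens" for p
    using that by (elim assoc_gensE) (simp add: \<phi> \<psi> \<omega> S1 S2)
  ultimately have "tensor_state \<phi> (tensor_state \<psi> \<omega>) (snd (z, w)) - tensor_state (tensor_state \<phi> \<psi>) \<omega> (fst (z, w)) = 0"
    using assms by (rule linear_eq_0_on_span)
  then show ?thesis by simp
qed

text \<open>Along the graph the two bracketings of a triple product state have the same GNS
  seminorm, so for \<open>y\<close> in the range of the graph the claim is the bound for
  multiplication by \<open>z\<close>. Both sides are continuous in \<open>y\<close>.\<close>

lemma assoc_graph_gns_bound:
  assumes zw: "(z, w) \<in> span assoc_gens"
  shows "gns_norm (tensor_state \<phi> (tensor_state \<psi> \<omega>)) (w * y) \<le> norm z * gns_norm (tensor_state \<phi> (tensor_state \<psi> \<omega>)) y"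
proof -
  note S1 = state_tensor_state[OF \<phi> state_tensor_state[OF \<psi> \<omega>]]
  note S2 = state_tensor_state[OF state_tensor_state[OF \<phi> \<psi>] \<omega>]
  let ?t = "tensor_state \<phi> (tensor_state \<psi> \<omega>)" and ?s = "tensor_state (tensor_state \<phi> \<psi>) \<omega>"
  let ?C = "{y. gns_norm ?t (w * y) \<le> norm z * gns_norm ?t y}"
  have gns_eq: "gns_norm ?t w' = gns_norm ?s z'" if "(z', w') \<in> span assoc_gens" for z' w'
    using tensor_state_assoc_graph[OF assoc_graph_mult[OF assoc_graph_star[OF that] that]]
    by (simp add: gns_norm_def)
  have in_C: "w' \<in> ?C" if "(z', w') \<in> span assoc_gens" for z' w'
    using gns_norm_mult_le[OF state_positive[OF S2] state_bounded_linear[OF S2], of z z']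
    by (simp add: gns_eq[OF that] gns_eq[OF assoc_graph_mult[OF zw that]])
  have "snd ` span (assoc_gens :: ((('a \<otimes> 'b) \<otimes> 'c) \<times> _) set) \<subseteq> ?C"
  proof (rule image_subsetI)
    fix p :: "(('a \<otimes> 'b) \<otimes> 'c) \<times> _" assume "p \<in> span assoc_gens"
    then have "(fst p, snd p) \<in> span assoc_gens" by simp
    then show "snd p \<in> ?C" by (rule in_C)
  qed
  then have "span (snd ` assoc_gens) \<subseteq> ?C"
    by (simp only: linear_span_image[OF bounded_linear.linear[OF bounded_linear_snd]])
  moreover have "closed ?C"
  proof (rule closed_Collect_le)
    note c = continuous_on_gns_norm[OF state_bounded_linear[OF S1]]
    show "continuous_on UNIV (\<lambda>y. norm z * gns_norm ?t y)"
      by (rule continuous_on_mult[OF continuous_on_const c])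
    show "continuous_on UNIV (\<lambda>y. gns_norm ?t (w * y))"
      by (rule continuous_on_compose2[OF c linear_continuous_on[OF bounded_linear_mult_right]]) simp
  qed
  ultimately have "closure (span (snd ` assoc_gens)) \<subseteq> ?C" by (rule closure_minimal)
  then show ?thesis by (simp only: snd_assoc_gens_dense) blast
qed

end

text \<open>For a state \<open>\<omega>\<close> of \<open>'b \<otimes> 'c\<close> that is not a product state, the inequality to be shown is
  \<open>\<omega> d \<ge> 0\<close> for a slice \<open>d\<close> of \<open>star y * (\<parallel>z\<parallel>\<^sup>2 - star w * w) * y\<close>, and this reduces to product states.\<close>

lemma assoc_graph_norm_le:
  fixes z :: "('a::unital_cstar_algebra \<otimes> 'b::unital_cstar_algebra) \<otimes> 'c::unital_cstar_algebra"
  assumes zw: "(z, w) \<in> span assoc_gens"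
  shows "norm w \<le> norm z"
proof (rule norm_tensor_le)
  fix \<phi> :: "'a \<Rightarrow> complex" and \<omega> :: "'b \<otimes> 'c \<Rightarrow> complex" and t
  assume \<phi>: "state \<phi>" and \<omega>: "state \<omega>"
  define y where "y = (alg_embed t :: 'a \<otimes> 'b \<otimes> 'c)"
  define D where "D = complex_of_real ((norm z)\<^sup>2) *\<^sub>C 1 - star w * w"
  have D_eq: "Re (\<tau> (star v * D * v)) = (norm z)\<^sup>2 * (gns_norm \<tau> v)\<^sup>2 - (gns_norm \<tau> (w * v))\<^sup>2" if "state \<tau>" for \<tau> v
    using that
    by (simp add: D_def left_diff_distrib right_diff_distrib mult_scaleC_left mult_scaleC_right
      clinear_simps[OF state_clinear] gns_norm_sq[OF state_positive] star_mult mult.assoc del: of_real_power)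
  define d where "d = slice_left \<phi> (star y * D * y)"
  have sD: "star (star y * D * y) = star y * D * y"
    by (simp add: D_def star_mult star_simps star_scaleC star_star mult.assoc del: of_real_power)
  have "0 \<le> Re (\<omega> d)"
  proof (rule nonneg_if_product_states_nonneg[OF _ _ \<omega>])
    show "star d = d" unfolding d_def by (simp only: slice_left_star[OF \<phi>, symmetric] sD)
    fix \<psi> :: "'b \<Rightarrow> complex" and \<omega>' :: "'c \<Rightarrow> complex" and e
    assume st: "state \<psi>" "state \<omega>'"
    note S = state_tensor_state[OF \<phi> state_tensor_state[OF st]]
    \<comment> \<open>Compressing the slice by \<open>e\<close> amounts to multiplying the vector
      \<open>y\<close> by \<open>1 \<otimes> e\<close> before slicing, so
      \<open>assoc_graph_gns_bound\<close> applies.\<close>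
    let ?v = "y * (1 \<otimes> e)"
    have "tensor_state \<psi> \<omega>' (star e * d * e) = tensor_state \<phi> (tensor_state \<psi> \<omega>') (star ?v * D * ?v)"
      unfolding d_def state_slice_left[OF \<phi> state_tensor_state[OF st]]
      by (simp add: star_mult pure_tensor_simps star_simps mult.assoc)
    moreover have "0 \<le> Re (tensor_state \<phi> (tensor_state \<psi> \<omega>') (star ?v * D * ?v))"
      using power_mono[OF assoc_graph_gns_bound[OF \<phi> st zw, of ?v] gns_norm_nonneg[OF state_positive[OF S]], of 2]
      by (simp add: D_eq[OF S] power_mult_distrib)
    ultimately show "0 \<le> Re (tensor_state \<psi> \<omega>' (star e * d * e))" by simp
  qed
  also have "\<omega> d = tensor_state \<phi> \<omega> (star y * D * y)"
    using state_slice_left[OF \<phi> \<omega>, of 1 "star y * D * y" 1] by (simp add: d_def pure_tensor_one)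
  finally have "(gns_norm (tensor_state \<phi> \<omega>) (w * y))\<^sup>2 \<le> (norm z * gns_norm (tensor_state \<phi> \<omega>) y)\<^sup>2"
    by (simp add: D_eq[OF state_tensor_state[OF \<phi> \<omega>]] power_mult_distrib)
  then show "gns_norm (tensor_state \<phi> \<omega>) (w * alg_embed t) \<le> norm z * gns_norm (tensor_state \<phi> \<omega>) (alg_embed t)"
    unfolding y_def
    by (rule power2_le_imp_le) (simp add: gns_norm_nonneg[OF state_positive[OF state_tensor_state[OF \<phi> \<omega>]]])
qed simp

lemma tensor_assoc:
  shows bounded_linear_tensor_assoc: "bounded_linear (tensor_assoc ::
      ('a::unital_cstar_algebra \<otimes> 'b::unital_cstar_algebra) \<otimes> 'c::unital_cstar_algebra \<Rightarrow> 'a \<otimes> 'b \<otimes> 'c)"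
    and tensor_assoc_pure: "tensor_assoc ((a \<otimes> b) \<otimes> c) = (a::'a) \<otimes> (b::'b) \<otimes> (c::'c)"
proof -
  let ?R = "span assoc_gens :: ((('a \<otimes> 'b) \<otimes> 'c) \<times> ('a \<otimes> 'b \<otimes> 'c)) set"
  have "fst ` ?R = span (fst ` assoc_gens)"
    by (rule linear_span_image[symmetric]) (rule bounded_linear.linear[OF bounded_linear_fst])
  then have dense: "closure (fst ` ?R) = UNIV" by (simp add: fst_assoc_gens_dense)
  have bound: "norm w \<le> 1 * norm z" if "(z, w) \<in> ?R" for z w
    using assoc_graph_norm_le[OF that] by simp
  obtain h where h: "bounded_linear h" "\<forall>(z, w)\<in>?R. h z = w"
    using bounded_linear_graph_extension[OF subspace_span bound dense] by metis
  have h': "h ((a \<otimes> b) \<otimes> c) = a \<otimes> b \<otimes> c" for a b c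
    using bspec[OF h(2) span_base[OF assoc_gensI]] by simp
  have eq: "(tensor_assoc :: ('a \<otimes> 'b) \<otimes> 'c \<Rightarrow> 'a \<otimes> 'b \<otimes> 'c) = h"
    unfolding tensor_assoc_def
  proof (rule the_equality)
    fix k :: "('a \<otimes> 'b) \<otimes> 'c \<Rightarrow> 'a \<otimes> 'b \<otimes> 'c"
    assume k: "bounded_linear k \<and> (\<forall>a b c. k ((a \<otimes> b) \<otimes> c) = a \<otimes> b \<otimes> c)"
    show "k = h"
    proof (rule bounded_linear_eq_on_dense_span[OF _ h(1) fst_assoc_gens_dense])
      fix x :: "('a \<otimes> 'b) \<otimes> 'c" assume "x \<in> fst ` assoc_gens"
      then show "k x = h x" using k h' by (elim imageE assoc_gensE) simp
    qed (use k in blast)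
  qed (simp add: h(1) h')
  show "bounded_linear (tensor_assoc :: ('a \<otimes> 'b) \<otimes> 'c \<Rightarrow> 'a \<otimes> 'b \<otimes> 'c)"
    unfolding eq by (rule h(1))
  show "tensor_assoc ((a \<otimes> b) \<otimes> c) = a \<otimes> b \<otimes> c" unfolding eq by (rule h')
qed

lemma tensor_assoc_eqI:
  fixes f :: "('a::unital_cstar_algebra \<otimes> 'b::unital_cstar_algebra) \<otimes> 'c::unital_cstar_algebra \<Rightarrow> 'd::real_normed_vector"
  assumes f: "bounded_linear f" and g: "bounded_linear g" and eq: "\<And>a b c. g (a \<otimes> b \<otimes> c) = f ((a \<otimes> b) \<otimes> c)"
  shows "g (tensor_assoc x) = f x"
proof -
  have "(\<lambda>x. g (tensor_assoc x)) = f"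
  proof (rule bounded_linear_eq_on_dense_span[OF _ f fst_assoc_gens_dense])
    show "bounded_linear (\<lambda>x. g (tensor_assoc x))"
      by (rule bounded_linear_compose[OF g bounded_linear_tensor_assoc])
    fix x :: "('a \<otimes> 'b) \<otimes> 'c" assume "x \<in> fst ` assoc_gens"
    then show "g (tensor_assoc x) = f x" by (elim imageE assoc_gensE) (simp add: tensor_assoc_pure eq)
  qed
  then show ?thesis by (rule fun_cong)
qed


text \<open>The norm is tested on matrix coefficients, which carry elements on both sides of
  \<open>x\<close>. They are inserted one leg at a time: a slice killed by all states is 0 and may
  be multiplied by arbitrary elements.\<close>

lemma product_states_separate:
  fixes x :: "'a::unital_cstar_algebra \<otimes> 'b::unital_cstar_algebra"
  assumes "\<And>\<phi> \<psi>. state \<phi> \<Longrightarrow> state \<psi> \<Longrightarrow> tensor_state \<phi> \<psi> x = 0"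
  shows "x = 0"
proof -
  have right: "tensor_state \<phi> \<psi> ((1 \<otimes> c) * x * (1 \<otimes> d)) = 0" if st: "state \<phi>" "state \<psi>" for \<phi> \<psi> c d
  proof -
    have "slice_left \<phi> x = 0"
    proof (rule states_separate)
      fix \<omega> :: "'b \<Rightarrow> complex" assume "state \<omega>"
      then show "\<omega> (slice_left \<phi> x) = 0"
        using state_slice_left[OF st(1), of \<omega> 1 x 1] assms[OF st(1)] by (simp add: pure_tensor_one)
    qed
    then show ?thesis
      using state_slice_left[OF st, of c x d] by (simp add: clinear_simps[OF state_clinear[OF st(2)]])
  qed
  have pure: "tensor_state \<phi> \<psi> ((a \<otimes> c) * x * (b \<otimes> d)) = 0" if st: "state \<phi>" "state \<psi>" for \<phi> \<psi> a b c d
  proof -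
    let ?x = "(1 \<otimes> c) * x * (1 \<otimes> d)"
    have "slice_right \<psi> ?x = 0"
    proof (rule states_separate)
      fix \<omega> :: "'a \<Rightarrow> complex" assume "state \<omega>"
      then show "\<omega> (slice_right \<psi> ?x) = 0"
        using state_slice_right[OF st(2), of \<omega> 1 ?x 1] right[OF _ st(2)] by (simp add: pure_tensor_one)
    qed
    then have "tensor_state \<phi> \<psi> ((a \<otimes> 1) * ?x * (b \<otimes> 1)) = 0"
      using state_slice_right[OF st(2) st(1), of a ?x b] by (simp add: clinear_simps[OF state_clinear[OF st(1)]])
    moreover have "(a \<otimes> 1) * ?x * (b \<otimes> 1) = ((a \<otimes> 1) * (1 \<otimes> c)) * x * ((1 \<otimes> d) * (b \<otimes> 1))"
      by (simp only: mult.assoc)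
    ultimately show ?thesis by (simp add: pure_tensor_simps)
  qed
  have "norm x \<le> 0"
  proof (rule norm_tensor_le)
    fix \<phi> :: "'a \<Rightarrow> complex" and \<psi> :: "'b \<Rightarrow> complex" and t
    assume st: "state \<phi>" "state \<psi>"
    note B = bounded_linear_tensor_state[OF st]
    have 1: "tensor_state \<phi> \<psi> ((a \<otimes> c) * x * z) = 0" for a c z
      by (rule tensor_eqI[OF bounded_linear_compose[OF B bounded_linear_mult_right] bounded_linear_zero])
        (rule pure[OF st])
    have "tensor_state \<phi> \<psi> (y * (x * z)) = 0" for y z
      by (rule tensor_eqI[OF bounded_linear_compose[OF B bounded_linear_mult_left] bounded_linear_zero])
        (use 1 in \<open>simp add: mult.assoc\<close>)
    then show "gns_norm (tensor_state \<phi> \<psi>) (x * alg_embed t) \<le> 0 * gns_norm (tensor_state \<phi> \<psi>) (alg_embed t)"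
      by (simp add: gns_norm_def)
  qed simp
  then show ?thesis by simp
qed

lemma unital_star_hom_bounded_linear:
  fixes f :: "'a::unital_cstar_algebra \<Rightarrow> 'b::unital_cstar_algebra"
  assumes f: "unital_star_hom f"
  shows "bounded_linear f"
proof (rule clinear_bounded_linear)
  show "clinear f" using f by (simp add: unital_star_hom_def)
  fix x
  obtain \<psi> where \<psi>: "state \<psi>" "\<psi> (star (f x) * f x) = complex_of_real ((norm (f x))\<^sup>2)"
    by (rule norming_state)
  have "star (f x) * f x = f (star x * x)" using f by (simp add: unital_star_hom_def)
  then have "(norm (f x))\<^sup>2 = cmod (\<psi> (f (star x * x)))" using \<psi>(2) by (simp add: norm_power)
  also have "\<dots> \<le> norm (star x * x)"
    by (rule state_norm_le[OF state_compose_hom[OF f \<psi>(1)]])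
  finally have "(norm (f x))\<^sup>2 \<le> (norm x)\<^sup>2" by (simp add: cstar_identity)
  then show "norm (f x) \<le> 1 * norm x" using power2_le_imp_le by fastforce
qed

section \<open>Fixed points of maps of states\<close>

lemma state_average:
  assumes "finite I" "I \<noteq> {}" "\<And>i. i \<in> I \<Longrightarrow> state (\<phi> i)"
  shows "state (\<lambda>a. of_real (1 / card I) * (\<Sum>i\<in>I. \<phi> i a))"
  unfolding state_def
proof (intro conjI allI)
  show "clinear (\<lambda>a. of_real (1 / card I) * (\<Sum>i\<in>I. \<phi> i a))"
    unfolding clinear_def
    by (auto simp: clinear_simps[OF state_clinear[OF assms(3)]] sum.distrib sum_distrib_left[symmetric] distrib_left)
  show "bounded_linear (\<lambda>a. of_real (1 / card I) * (\<Sum>i\<in>I. \<phi> i a))"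
    by (intro bounded_linear_compose[OF bounded_linear_mult_right] bounded_linear_sum state_bounded_linear assms(3))
  show "of_real (1 / card I) * (\<Sum>i\<in>I. \<phi> i (star x * x)) \<in> \<real>\<^sub>\<ge>\<^sub>0" for x
  proof (rule nonneg_Reals_mult_I)
    have "\<phi> i (star x * x) \<in> \<real>\<^sub>\<ge>\<^sub>0" if "i \<in> I" for i using assms(3)[OF that] by (simp add: state_def)
    then show "(\<Sum>i\<in>I. \<phi> i (star x * x)) \<in> \<real>\<^sub>\<ge>\<^sub>0"
      by (simp add: complex_nonneg_Reals_iff sum_nonneg)
  qed simp
  have "(\<Sum>i\<in>I. \<phi> i 1) = of_nat (card I)" using state_one[OF assms(3)] by simp
  then show "of_real (1 / card I) * (\<Sum>i\<in>I. \<phi> i 1) = 1" using assms(1,2) by simp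
qed

text \<open>\<open>limit_state\<close> recovers a value only where the Cesaro means converge, which
  telescoping ensures at \<open>T a - a\<close>.\<close>

lemma fixed_state:
  fixes T :: "'a::unital_cstar_algebra \<Rightarrow> 'a"
  assumes T: "\<And>\<phi>. state \<phi> \<Longrightarrow> state (\<lambda>a. \<phi> (T a))"
  obtains \<phi> where "state \<phi>" "\<forall>a. \<phi> (T a) = \<phi> a"
proof -
  obtain \<phi> :: "'a \<Rightarrow> complex" where \<phi>: "state \<phi>" using norming_state[of 1] by blast
  have iter: "state (\<lambda>a. \<phi> ((T ^^ k) a))" for k
  proof (induction k)
    case (Suc k)
    from T[OF this] show ?case by (simp add: funpow_swap1)
  qed (simp add: \<phi>)
  \<comment> \<open>\<open>{..n}\<close> has n + 1 elements, so every mean is defined and the error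
    below is at most 2 \<parallel>a\<parallel> / (n + 1).\<close>
  define s where "s n a = of_real (1 / card {..n}) * (\<Sum>k\<in>{..n}. \<phi> ((T ^^ k) a))" for n :: nat and a
  have s: "state (s n)" for n unfolding s_def by (rule state_average) (simp_all add: iter)
  obtain \<psi> where \<psi>: "state \<psi>" "\<forall>x c. ((\<lambda>n. s n x) \<longlonglongrightarrow> c) \<longrightarrow> \<psi> x = c"
    by (rule limit_state[OF sequentially_bot s])
  have "\<psi> (T a - a) = 0" for a
  proof -
    have eq: "s n (T a - a) = of_real (1 / real (Suc n)) * (\<phi> ((T ^^ Suc n) a) - \<phi> a)" for n
    proof -
      have "(\<Sum>k\<le>n. \<phi> ((T ^^ k) (T a))) - (\<Sum>k\<le>n. \<phi> ((T ^^ k) a)) = \<phi> ((T ^^ Suc n) a) - \<phi> a"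
        using sum_telescope[of "\<lambda>k. - \<phi> ((T ^^ k) a)" n] by (simp add: sum_subtractf funpow_swap1)
      then show ?thesis
        by (simp add: clinear_simps[OF state_clinear[OF s]]) (simp add: s_def diff_divide_distrib[symmetric])
    qed
    have "(\<lambda>n. s n (T a - a)) \<longlonglongrightarrow> 0"
    proof (rule Lim_null_comparison)
      show "\<forall>\<^sub>F n in sequentially. norm (s n (T a - a)) \<le> (2 * norm a) * inverse (real (Suc n))"
      proof (intro always_eventually allI)
        fix n
        have "norm (\<phi> ((T ^^ Suc n) a) - \<phi> a) \<le> 2 * norm a"
          using norm_triangle_ineq4[of "\<phi> ((T ^^ Suc n) a)" "\<phi> a"] state_norm_le[OF iter[of "Suc n"], of a]
            state_norm_le[OF \<phi>, of a] by linarith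
        then have "norm (\<phi> ((T ^^ Suc n) a) - \<phi> a) * inverse (real (Suc n)) \<le> (2 * norm a) * inverse (real (Suc n))"
          by (intro mult_right_mono) simp_all
        then show "norm (s n (T a - a)) \<le> (2 * norm a) * inverse (real (Suc n))"
          unfolding eq norm_mult norm_of_real by (simp only: inverse_eq_divide abs_of_nonneg mult.commute) simp
      qed
      show "(\<lambda>n. (2 * norm a) * inverse (real (Suc n))) \<longlonglongrightarrow> 0"
        using tendsto_mult_left[OF LIMSEQ_inverse_real_of_nat, of "2 * norm a"] by simp
    qed
    then show ?thesis using \<psi>(2) by blast
  qed
  then have "\<forall>a. \<psi> (T a) = \<psi> a" by (simp add: clinear_simps[OF state_clinear[OF \<psi>(1)]])
  then show ?thesis by (rule that[OF \<psi>(1)])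
qed

lemma common_fixed_state:
  fixes T :: "'i \<Rightarrow> 'a::unital_cstar_algebra \<Rightarrow> 'a"
  assumes fin: "\<And>F. finite F \<Longrightarrow> F \<subseteq> I \<Longrightarrow> \<exists>\<phi>. state \<phi> \<and> (\<forall>i\<in>F. \<forall>a. \<phi> (T i a) = \<phi> a)"
  obtains \<phi> where "state \<phi>" "\<forall>i\<in>I. \<forall>a. \<phi> (T i a) = \<phi> a"
proof -
  \<comment> \<open>\<open>limit_state\<close> wants a state at every index, so sets that are
    infinite or not inside \<open>I\<close> get the state that \<open>fin\<close> gives for
    \<open>{}\<close>.\<close>
  have "\<exists>\<phi>. state \<phi> \<and> (finite F \<and> F \<subseteq> I \<longrightarrow> (\<forall>i\<in>F. \<forall>a. \<phi> (T i a) = \<phi> a))" for F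
    using fin[of F] fin[of "{}"] by blast
  then obtain h where h: "\<And>F. state (h F)" "\<And>F i a. finite F \<Longrightarrow> F \<subseteq> I \<Longrightarrow> i \<in> F \<Longrightarrow> h F (T i a) = h F a"
    by metis
  obtain \<psi> where \<psi>: "state \<psi>" "\<forall>x c. ((\<lambda>F. h F x) \<longlongrightarrow> c) (finite_subsets_at_top I) \<longrightarrow> \<psi> x = c"
    by (rule limit_state[OF finite_subsets_at_top_neq_bot h(1)])
  have "\<psi> (T i a - a) = 0" if "i \<in> I" for i a
  proof -
    have "h F (T i a - a) = 0" if "finite F" "{i} \<subseteq> F" "F \<subseteq> I" for F
      using h(2)[OF that(1,3), of i a] that(2) by (simp add: clinear_simps[OF state_clinear[OF h(1)]])
    then have "\<forall>\<^sub>F F in finite_subsets_at_top I. h F (T i a - a) = 0"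
      unfolding eventually_finite_subsets_at_top using \<open>i \<in> I\<close> by (intro exI[of _ "{i}"]) auto
    then have "((\<lambda>F. h F (T i a - a)) \<longlongrightarrow> 0) (finite_subsets_at_top I)" by (rule tendsto_eventually)
    then show ?thesis using \<psi>(2) by blast
  qed
  then have "\<forall>i\<in>I. \<forall>a. \<psi> (T i a) = \<psi> a" by (simp add: clinear_simps[OF state_clinear[OF \<psi>(1)]])
  then show ?thesis by (rule that[OF \<psi>(1)])
qed

section \<open>Convolution\<close>

definition convolve :: "('b::unital_cstar_algebra \<Rightarrow> 'b \<otimes> 'a::unital_cstar_algebra) \<Rightarrow>
    ('b \<Rightarrow> complex) \<Rightarrow> ('a \<Rightarrow> complex) \<Rightarrow> 'b \<Rightarrow> complex" where
  "convolve \<alpha> \<nu> \<omega> b = tensor_state \<nu> \<omega> (\<alpha> b)"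

lemma state_convolve:
  assumes "unital_star_hom \<alpha>" "state \<nu>" "state \<omega>"
  shows "state (convolve \<alpha> \<nu> \<omega>)"
  using state_compose_hom[OF assms(1) state_tensor_state[OF assms(2,3)]] by (simp add: convolve_def[abs_def])

lemma convolve_slice_right:
  "state \<nu> \<Longrightarrow> state \<omega> \<Longrightarrow> convolve \<alpha> \<nu> \<omega> b = \<nu> (slice_right \<omega> (\<alpha> b))"
  using state_slice_right[of \<omega> \<nu> 1 "\<alpha> b" 1] by (simp add: convolve_def pure_tensor_one)

lemma convolve_slice_left:
  "state \<nu> \<Longrightarrow> state \<omega> \<Longrightarrow> convolve \<alpha> \<nu> \<omega> b = \<omega> (slice_left \<nu> (\<alpha> b))"
  using state_slice_left[of \<nu> \<omega> 1 "\<alpha> b" 1] by (simp add: convolve_def pure_tensor_one)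

text \<open>Complex linearity enters because the density conditions are stated with
  \<open>cspan\<close>, unlike the real spans of the tensor graphs.\<close>

lemma cspan_dense_eq:
  assumes f: "bounded_linear f" "clinear f" and g: "bounded_linear g" "clinear g"
    and dense: "closure (cspan S) = UNIV" and eq: "\<And>x. x \<in> S \<Longrightarrow> f x = g x"
  shows "f = g"
proof -
  have "f x = g x" if "x \<in> cspan S" for x
    using that
  proof (induction x rule: complex_vector.span_induct_alt)
    case base
    show ?case using f(2) g(2) by (simp add: clinear_simps)
  next
    case (step c x y)
    then show ?case by (simp add: clinear_simps[OF f(2)] clinear_simps[OF g(2)] eq)
  qed
  then have "cspan S \<subseteq> {x. f x = g x}" by blast
  moreover have "closed {x. f x = g x}"
    by (rule closed_Collect_eq[OF linear_continuous_on[OF f(1)] linear_continuous_on[OF g(1)]])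
  ultimately have "closure (cspan S) \<subseteq> {x. f x = g x}" by (rule closure_minimal)
  then show ?thesis using dense by auto
qed

text \<open>The terms are non-negative with sum 0, so each vanishes, and Cauchy-Schwarz kills
  \<open>y * x\<close>. This is how invariance under an average descends to its members.\<close>

lemma average_null_vector:
  assumes F: "finite F" "\<And>i. i \<in> F \<Longrightarrow> state (\<tau> i)"
    and null: "(\<Sum>i\<in>F. \<tau> i (star x * x)) = 0" and "i \<in> F"
  shows "\<tau> i (y * x) = 0"
proof -
  have nn: "0 \<le> Re (\<tau> j (star x * x))" if "j \<in> F" for j
    using pos_nonneg[OF state_positive[OF F(2)[OF that]]] by blast
  have "(\<Sum>i\<in>F. Re (\<tau> i (star x * x))) = 0" using null by (simp flip: Re_sum)
  then have "Re (\<tau> i (star x * x)) = 0"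
    using \<open>i \<in> F\<close> sum_nonneg_eq_0_iff[OF F(1), of "\<lambda>i. Re (\<tau> i (star x * x))"] nn by blast
  then show ?thesis
    using pos_CS[OF state_positive[OF F(2)[OF \<open>i \<in> F\<close>]], of "star y" x] by (simp add: star_star)
qed

lemma tensor_state_average_right:
  assumes \<nu>: "state \<nu>" and F: "finite F" "F \<noteq> {}" "\<And>\<rho>. \<rho> \<in> F \<Longrightarrow> state \<rho>"
  shows "tensor_state \<nu> (\<lambda>a. of_real (1 / card F) * (\<Sum>\<rho>\<in>F. \<rho> a)) x = of_real (1 / card F) * (\<Sum>\<rho>\<in>F. tensor_state \<nu> \<rho> x)"
proof (rule tensor_eqI[where g = "\<lambda>x. of_real (1 / card F) * (\<Sum>\<rho>\<in>F. tensor_state \<nu> \<rho> x)"])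
  have S: "state (\<lambda>a. of_real (1 / card F) * (\<Sum>\<rho>\<in>F. \<rho> a))" by (rule state_average[OF F])
  show "bounded_linear (tensor_state \<nu> (\<lambda>a. of_real (1 / card F) * (\<Sum>\<rho>\<in>F. \<rho> a)))"
    by (rule bounded_linear_tensor_state[OF \<nu> S])
  show "bounded_linear (\<lambda>x. of_real (1 / card F) * (\<Sum>\<rho>\<in>F. tensor_state \<nu> \<rho> x))"
    by (rule bounded_linear_compose[OF bounded_linear_mult_right])
      (intro bounded_linear_sum bounded_linear_tensor_state[OF \<nu>] F(3))
  have "(\<Sum>\<rho>\<in>F. tensor_state \<nu> \<rho> (a \<otimes> b)) = (\<Sum>\<rho>\<in>F. \<nu> a * \<rho> b)" for a b
    by (rule sum.cong[OF refl]) (rule tensor_state_pure[OF \<nu> F(3)])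
  then show "tensor_state \<nu> (\<lambda>a. of_real (1 / card F) * (\<Sum>\<rho>\<in>F. \<rho> a)) (a \<otimes> b) =
    of_real (1 / card F) * (\<Sum>\<rho>\<in>F. tensor_state \<nu> \<rho> (a \<otimes> b))" for a b
    unfolding tensor_state_pure[OF \<nu> S]
    by (simp add: sum_distrib_left[symmetric])
qed

lemma tensor_state_average_left:
  assumes \<nu>: "state \<nu>" and F: "finite F" "F \<noteq> {}" "\<And>\<rho>. \<rho> \<in> F \<Longrightarrow> state \<rho>"
  shows "tensor_state (\<lambda>a. of_real (1 / card F) * (\<Sum>\<rho>\<in>F. \<rho> a)) \<nu> x = of_real (1 / card F) * (\<Sum>\<rho>\<in>F. tensor_state \<rho> \<nu> x)"
proof (rule tensor_eqI[where g = "\<lambda>x. of_real (1 / card F) * (\<Sum>\<rho>\<in>F. tensor_state \<rho> \<nu> x)"])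
  have S: "state (\<lambda>a. of_real (1 / card F) * (\<Sum>\<rho>\<in>F. \<rho> a))" by (rule state_average[OF F])
  show "bounded_linear (tensor_state (\<lambda>a. of_real (1 / card F) * (\<Sum>\<rho>\<in>F. \<rho> a)) \<nu>)"
    by (rule bounded_linear_tensor_state[OF S \<nu>])
  show "bounded_linear (\<lambda>x. of_real (1 / card F) * (\<Sum>\<rho>\<in>F. tensor_state \<rho> \<nu> x))"
    by (rule bounded_linear_compose[OF bounded_linear_mult_right])
      (intro bounded_linear_sum bounded_linear_tensor_state[OF _ \<nu>] F(3))
  have "(\<Sum>\<rho>\<in>F. tensor_state \<rho> \<nu> (a \<otimes> b)) = (\<Sum>\<rho>\<in>F. \<rho> a * \<nu> b)" for a b
    by (rule sum.cong[OF refl]) (rule tensor_state_pure[OF F(3) \<nu>])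
  then show "tensor_state (\<lambda>a. of_real (1 / card F) * (\<Sum>\<rho>\<in>F. \<rho> a)) \<nu> (a \<otimes> b) =
    of_real (1 / card F) * (\<Sum>\<rho>\<in>F. tensor_state \<rho> \<nu> (a \<otimes> b))" for a b
    unfolding tensor_state_pure[OF S \<nu>]
    by (simp add: sum_distrib_right[symmetric])
qed


section \<open>Actions of compact quantum groups\<close>

lemma tensor_map_hom_id:
  fixes f :: "'a::unital_cstar_algebra \<Rightarrow> 'c::unital_cstar_algebra"
  assumes "unital_star_hom f"
  shows "bounded_linear (tensor_map f (id :: 'b \<Rightarrow> 'b::unital_cstar_algebra))"
    and "tensor_map f id (a \<otimes> (b::'b)) = f a \<otimes> b"
    and "bounded_linear (tensor_map (id :: 'b \<Rightarrow> 'b) f)"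
    and "tensor_map id f ((b::'b) \<otimes> a) = b \<otimes> f a"
proof -
  have "unital_star_hom (id :: 'b \<Rightarrow> 'b)" by (simp add: unital_star_hom_def clinear_def)
  then show "bounded_linear (tensor_map f (id :: 'b \<Rightarrow> 'b))" "tensor_map f id (a \<otimes> (b::'b)) = f a \<otimes> b"
    "bounded_linear (tensor_map (id :: 'b \<Rightarrow> 'b) f)" "tensor_map id f ((b::'b) \<otimes> a) = b \<otimes> f a"
    using assms by (simp_all add: bounded_linear_tensor_map tensor_map_pure)
qed

context quantum_group_action
begin

lemma bounded_linear_action: "bounded_linear \<alpha>"
  by (rule unital_star_hom_bounded_linear[OF action_hom])

lemma bounded_linear_comult: "bounded_linear \<Delta>"
  by (rule unital_star_hom_bounded_linear[OF comult_hom])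

lemma action_simps:
  "\<alpha> (x * y) = \<alpha> x * \<alpha> y" "\<alpha> (star x) = star (\<alpha> x)" "\<alpha> 1 = 1" "clinear \<alpha>"
  using action_hom by (simp_all add: unital_star_hom_def)

lemma comult_simps:
  "\<Delta> (a * b) = \<Delta> a * \<Delta> b" "\<Delta> (star a) = star (\<Delta> a)" "\<Delta> 1 = 1" "clinear \<Delta>"
  using comult_hom by (simp_all add: unital_star_hom_def)

context
  fixes \<nu> :: "'b \<Rightarrow> complex" and \<omega> \<mu> :: "'a \<Rightarrow> complex"
  assumes \<nu>: "state \<nu>" and \<omega>: "state \<omega>" and \<mu>: "state \<mu>"
begin

text \<open>Coassociativity with the last leg sliced by \<mu>. The factor \<open>c\<close> on the
  first leg is carried along for the null vector and for the density argument.\<close>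

lemma action_slice_right:
  "tensor_state \<nu> \<omega> ((c \<otimes> 1) * \<alpha> (slice_right \<mu> (\<alpha> b))) =
   tensor_state \<nu> (convolve \<Delta> \<omega> \<mu>) ((c \<otimes> 1) * \<alpha> b)"
proof -
  note S1 = state_tensor_state[OF \<nu> \<omega>] and S2 = state_tensor_state[OF \<omega> \<mu>]
    and S3 = state_convolve[OF comult_hom \<omega> \<mu>]
  note h = bounded_linear_mult_right
  let ?F = "\<lambda>w. tensor_state \<nu> (tensor_state \<omega> \<mu>) ((c \<otimes> 1) * w)"
  let ?G = "\<lambda>z. tensor_state (tensor_state \<nu> \<omega>) \<mu> (((c \<otimes> 1) \<otimes> 1) * z)"
  have F: "bounded_linear ?F" by (rule bounded_linear_compose[OF bounded_linear_tensor_state[OF \<nu> S2] h])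
  have G: "bounded_linear ?G" by (rule bounded_linear_compose[OF bounded_linear_tensor_state[OF S1 \<mu>] h])
  have FG: "?F (tensor_assoc z) = ?G z" for z
    by (rule tensor_assoc_eqI[OF G F]) (simp add: pure_tensor_simps \<nu> \<omega> \<mu> S1 S2 flip: pure_tensor_one)
  have "tensor_state \<nu> \<omega> ((c \<otimes> 1) * \<alpha> (slice_right \<mu> x)) = ?G (tensor_map \<alpha> id x)" for x
  proof (rule tensor_eqI[where f = "\<lambda>x. tensor_state \<nu> \<omega> ((c \<otimes> 1) * \<alpha> (slice_right \<mu> x))"])
    show "bounded_linear (\<lambda>x. tensor_state \<nu> \<omega> ((c \<otimes> 1) * \<alpha> (slice_right \<mu> x)))"
      by (rule bounded_linear_compose[OF bounded_linear_compose[OF bounded_linear_tensor_state[OF \<nu> \<omega>] h]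
        bounded_linear_compose[OF bounded_linear_action bounded_linear_slice_right[OF \<mu>]]])
    show "bounded_linear (\<lambda>x. ?G (tensor_map \<alpha> id x))"
      by (rule bounded_linear_compose[OF G tensor_map_hom_id(1)[OF action_hom]])
    show "tensor_state \<nu> \<omega> ((c \<otimes> 1) * \<alpha> (slice_right \<mu> (x \<otimes> a))) = ?G (tensor_map \<alpha> id (x \<otimes> a))" for x a
      by (simp add: slice_right_pure[OF \<mu>] tensor_map_hom_id(2)[OF action_hom] pure_tensor_simps
        tensor_state_pure[OF S1 \<mu>] clinear_simps[OF action_simps(4)] clinear_simps[OF state_clinear[OF S1]] mult_scaleC_right)
  qed
  moreover have "?F (tensor_map id \<Delta> x) = tensor_state \<nu> (convolve \<Delta> \<omega> \<mu>) ((c \<otimes> 1) * x)" for x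
  proof (rule tensor_eqI[where g = "\<lambda>x. tensor_state \<nu> (convolve \<Delta> \<omega> \<mu>) ((c \<otimes> 1) * x)"])
    show "bounded_linear (\<lambda>x. ?F (tensor_map id \<Delta> x))"
      by (rule bounded_linear_compose[OF F tensor_map_hom_id(3)[OF comult_hom]])
    show "bounded_linear (\<lambda>x. tensor_state \<nu> (convolve \<Delta> \<omega> \<mu>) ((c \<otimes> 1) * x))"
      by (rule bounded_linear_compose[OF bounded_linear_tensor_state[OF \<nu> S3] h])
    show "?F (tensor_map id \<Delta> (x \<otimes> a)) = tensor_state \<nu> (convolve \<Delta> \<omega> \<mu>) ((c \<otimes> 1) * (x \<otimes> a))" for x a
      by (simp add: tensor_map_hom_id(4)[OF comult_hom] pure_tensor_simps tensor_state_pure[OF \<nu> S2]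
        tensor_state_pure[OF \<nu> S3]) (simp add: convolve_def)
  qed
  ultimately show ?thesis using FG[of "tensor_map \<alpha> id (\<alpha> b)"] by (simp add: action_coassociative)
qed

text \<open>Coassociativity with the first leg sliced by \<nu>, which turns the action into the
  comultiplication.\<close>

lemma comult_slice_left:
  "tensor_state \<omega> \<mu> ((1 \<otimes> c) * \<Delta> (slice_left \<nu> (\<alpha> b))) =
   tensor_state (convolve \<alpha> \<nu> \<omega>) \<mu> ((1 \<otimes> c) * \<alpha> b)"
proof -
  note S1 = state_tensor_state[OF \<nu> \<omega>] and S2 = state_tensor_state[OF \<omega> \<mu>]
    and S3 = state_convolve[OF action_hom \<nu> \<omega>]
  note h = bounded_linear_mult_right
  let ?F = "\<lambda>w. tensor_state \<nu> (tensor_state \<omega> \<mu>) ((1 \<otimes> 1 \<otimes> c) * w)"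
  let ?G = "\<lambda>z. tensor_state (tensor_state \<nu> \<omega>) \<mu> ((1 \<otimes> c) * z)"
  have F: "bounded_linear ?F" by (rule bounded_linear_compose[OF bounded_linear_tensor_state[OF \<nu> S2] h])
  have G: "bounded_linear ?G" by (rule bounded_linear_compose[OF bounded_linear_tensor_state[OF S1 \<mu>] h])
  have FG: "?F (tensor_assoc z) = ?G z" for z
    by (rule tensor_assoc_eqI[OF G F]) (simp add: pure_tensor_simps \<nu> \<omega> \<mu> S1 S2 flip: pure_tensor_one)
  have "tensor_state \<omega> \<mu> ((1 \<otimes> c) * \<Delta> (slice_left \<nu> x)) = ?F (tensor_map id \<Delta> x)" for x
  proof (rule tensor_eqI[where f = "\<lambda>x. tensor_state \<omega> \<mu> ((1 \<otimes> c) * \<Delta> (slice_left \<nu> x))"])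
    show "bounded_linear (\<lambda>x. tensor_state \<omega> \<mu> ((1 \<otimes> c) * \<Delta> (slice_left \<nu> x)))"
      by (rule bounded_linear_compose[OF bounded_linear_compose[OF bounded_linear_tensor_state[OF \<omega> \<mu>] h]
        bounded_linear_compose[OF bounded_linear_comult bounded_linear_slice_left[OF \<nu>]]])
    show "bounded_linear (\<lambda>x. ?F (tensor_map id \<Delta> x))"
      by (rule bounded_linear_compose[OF F tensor_map_hom_id(3)[OF comult_hom]])
    show "tensor_state \<omega> \<mu> ((1 \<otimes> c) * \<Delta> (slice_left \<nu> (x \<otimes> a))) = ?F (tensor_map id \<Delta> (x \<otimes> a))" for x a
      by (simp add: slice_left_pure[OF \<nu>] tensor_map_hom_id(4)[OF comult_hom] pure_tensor_simps
        tensor_state_pure[OF \<nu> S2] clinear_simps[OF comult_simps(4)] clinear_simps[OF state_clinear[OF S2]] mult_scaleC_right)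
  qed
  moreover have "?G (tensor_map \<alpha> id x) = tensor_state (convolve \<alpha> \<nu> \<omega>) \<mu> ((1 \<otimes> c) * x)" for x
  proof (rule tensor_eqI[where g = "\<lambda>x. tensor_state (convolve \<alpha> \<nu> \<omega>) \<mu> ((1 \<otimes> c) * x)"])
    show "bounded_linear (\<lambda>x. ?G (tensor_map \<alpha> id x))"
      by (rule bounded_linear_compose[OF G tensor_map_hom_id(1)[OF action_hom]])
    show "bounded_linear (\<lambda>x. tensor_state (convolve \<alpha> \<nu> \<omega>) \<mu> ((1 \<otimes> c) * x))"
      by (rule bounded_linear_compose[OF bounded_linear_tensor_state[OF S3 \<mu>] h])
    show "?G (tensor_map \<alpha> id (x \<otimes> a)) = tensor_state (convolve \<alpha> \<nu> \<omega>) \<mu> ((1 \<otimes> c) * (x \<otimes> a))" for x a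
      by (simp add: tensor_map_hom_id(2)[OF action_hom] pure_tensor_simps tensor_state_pure[OF S1 \<mu>]
        tensor_state_pure[OF S3 \<mu>]) (simp add: convolve_def)
  qed
  ultimately show ?thesis using FG[of "tensor_map \<alpha> id (\<alpha> b)"] by (simp add: action_coassociative)
qed

lemma convolve_assoc: "convolve \<alpha> (convolve \<alpha> \<nu> \<omega>) \<mu> = convolve \<alpha> \<nu> (convolve \<Delta> \<omega> \<mu>)"
proof
  fix b
  have "convolve \<alpha> (convolve \<alpha> \<nu> \<omega>) \<mu> b = tensor_state \<omega> \<mu> (\<Delta> (slice_left \<nu> (\<alpha> b)))"
    using comult_slice_left[of 1 b] by (simp add: convolve_def pure_tensor_one)
  also have "\<dots> = convolve \<Delta> \<omega> \<mu> (slice_left \<nu> (\<alpha> b))" by (simp add: convolve_def)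
  also have "\<dots> = convolve \<alpha> \<nu> (convolve \<Delta> \<omega> \<mu>) b"
    by (simp add: convolve_slice_left[OF \<nu> state_convolve[OF comult_hom \<omega> \<mu>]])
  finally show "convolve \<alpha> (convolve \<alpha> \<nu> \<omega>) \<mu> b = convolve \<alpha> \<nu> (convolve \<Delta> \<omega> \<mu>) b" .
qed

end

text \<open>With \<open>b = (\<nu> \<otimes> id) \<alpha> b\<^sub>0\<close>, invariance under the average \<open>\<omega>\<close> of \<open>F\<close> gives
  \<open>(\<omega> \<otimes> \<mu>) (x\<^sup>* x) = 0\<close> for \<open>x = \<Delta> b - 1 \<otimes> b\<close>, hence \<open>(\<rho> \<otimes> \<mu>) ((1 \<otimes> c) x) = 0\<close> for every \<open>\<rho> \<in> F\<close>.\<close>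

lemma convolve_invariant_right:
  assumes F: "finite F" "F \<noteq> {}" "\<And>\<rho>. \<rho> \<in> F \<Longrightarrow> state \<rho>"
    and \<nu>: "state \<nu>" and \<mu>: "state \<mu>"
  defines "\<omega> \<equiv> \<lambda>a. of_real (1 / card F) * (\<Sum>\<rho>\<in>F. \<rho> a)"
  assumes inv\<nu>: "convolve \<alpha> \<nu> \<omega> = \<nu>" and inv\<mu>: "convolve \<Delta> \<omega> \<mu> = \<mu>" and \<rho>: "\<rho> \<in> F"
  shows "convolve \<alpha> \<nu> \<rho> = \<nu>"
proof -
  have \<omega>: "state \<omega>" unfolding \<omega>_def by (rule state_average[OF F])
  note sF = F(3)[OF \<rho>] and S = state_tensor_state[OF \<omega> \<mu>]
  note l = clinear_simps[OF state_clinear[OF S]]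
  have key: "tensor_state (convolve \<alpha> \<nu> \<rho>) \<mu> ((1 \<otimes> c) * \<alpha> b) = tensor_state \<nu> \<mu> ((1 \<otimes> c) * \<alpha> b)" for c b
  proof -
    define d where "d = slice_left \<nu> (\<alpha> b)"
    define x where "x = \<Delta> d - 1 \<otimes> d"
    \<comment> \<open>\<open>comult_slice_left\<close> moves the average onto \<nu>, which absorbs
      it by \<open>inv\<nu>\<close>, so the mixed term equals the diagonal ones.\<close>
    have cross: "tensor_state \<omega> \<mu> ((1 \<otimes> star d) * \<Delta> d) = \<mu> (star d * d)"
      using comult_slice_left[OF \<nu> \<omega> \<mu>, of "star d" b] state_slice_left[OF \<nu> \<mu>, of "star d" "\<alpha> b" 1]
      by (simp add: inv\<nu> d_def pure_tensor_one)
    have "star x * x = \<Delta> (star d * d) - star (\<Delta> d) * (1 \<otimes> d) - (1 \<otimes> star d) * \<Delta> d + 1 \<otimes> (star d * d)"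
      by (simp add: x_def star_simps comult_simps pure_tensor_simps left_diff_distrib right_diff_distrib)
    moreover have "tensor_state \<omega> \<mu> (\<Delta> (star d * d)) = \<mu> (star d * d)"
      using fun_cong[OF inv\<mu>, of "star d * d"] by (simp add: convolve_def)
    moreover have "tensor_state \<omega> \<mu> (star (\<Delta> d) * (1 \<otimes> d)) = \<mu> (star d * d)"
      using state_star[OF S, of "(1 \<otimes> star d) * \<Delta> d"] cross state_star[OF \<mu>, of "star d * d"]
      by (simp add: star_mult star_star pure_tensor_simps star_simps)
    ultimately have "tensor_state \<omega> \<mu> (star x * x) = 0"
      using cross by (simp add: l tensor_state_pure[OF \<omega> \<mu>] state_one[OF \<omega>])
    then have "of_real (1 / card F) * (\<Sum>\<rho>\<in>F. tensor_state \<rho> \<mu> (star x * x)) = 0"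
      by (simp only: \<omega>_def tensor_state_average_left[OF \<mu> F])
    then have "(\<Sum>\<rho>\<in>F. tensor_state \<rho> \<mu> (star x * x)) = 0" using F(1,2) by simp
    then have "tensor_state \<rho> \<mu> ((1 \<otimes> c) * x) = 0"
      by (rule average_null_vector[where \<tau> = "\<lambda>\<rho>. tensor_state \<rho> \<mu>", OF F(1) _ _ \<rho>, rotated])
        (rule state_tensor_state[OF F(3) \<mu>])
    then have "tensor_state \<rho> \<mu> ((1 \<otimes> c) * \<Delta> d) = \<mu> (c * d)"
      by (simp add: x_def right_diff_distrib clinear_simps[OF state_clinear[OF state_tensor_state[OF sF \<mu>]]]
        pure_tensor_simps tensor_state_pure[OF sF \<mu>] state_one[OF sF])
    then show ?thesis
      using comult_slice_left[OF \<nu> sF \<mu>, of c b] state_slice_left[OF \<nu> \<mu>, of c "\<alpha> b" 1]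
      by (simp add: d_def pure_tensor_one)
  qed
  note C = state_convolve[OF action_hom \<nu> sF]
  note S1 = state_tensor_state[OF C \<mu>] and S2 = state_tensor_state[OF \<nu> \<mu>]
  have "tensor_state (convolve \<alpha> \<nu> \<rho>) \<mu> = tensor_state \<nu> \<mu>"
  proof (rule cspan_dense_eq[OF state_bounded_linear[OF S1] state_clinear[OF S1]
        state_bounded_linear[OF S2] state_clinear[OF S2] action_density])
    fix z assume "z \<in> {\<alpha> b * (1 \<otimes> a) | a b. True}"
    \<comment> \<open>The density condition has the value of \<alpha> as left factor,
      \<open>key\<close> as right factor; adjoints exchange the two.\<close>
    then obtain a b where "z = star ((1 \<otimes> star a) * \<alpha> (star b))"
      by (auto simp: star_mult pure_tensor_simps star_simps star_star action_simps)
    then show "tensor_state (convolve \<alpha> \<nu> \<rho>) \<mu> z = tensor_state \<nu> \<mu> z"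
      using key[of "star a" "star b"] state_star[OF S1] state_star[OF S2] by simp
  qed
  then show ?thesis
    using tensor_state_pure[OF C \<mu>, of _ 1] tensor_state_pure[OF \<nu> \<mu>, of _ 1] by (simp add: state_one[OF \<mu>] fun_eq_iff)
qed

lemma convolve_right_fixed:
  assumes "state \<omega>"
  obtains \<nu> where "state \<nu>" "convolve \<alpha> \<nu> \<omega> = \<nu>"
proof -
  have "state (\<lambda>b. \<phi> (slice_right \<omega> (\<alpha> b)))" if "state \<phi>" for \<phi>
    using state_convolve[OF action_hom that assms] by (simp add: convolve_slice_right[OF that assms, abs_def])
  then obtain \<nu> where \<nu>: "state \<nu>" "\<forall>b. \<nu> (slice_right \<omega> (\<alpha> b)) = \<nu> b" by (rule fixed_state)
  have "convolve \<alpha> \<nu> \<omega> = \<nu>" using \<nu>(2) by (simp add: fun_eq_iff convolve_slice_right[OF \<nu>(1) assms])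
  with \<nu>(1) show ?thesis by (rule that)
qed

lemma convolve_left_fixed:
  assumes "state \<omega>"
  obtains \<mu> where "state \<mu>" "convolve \<Delta> \<omega> \<mu> = \<mu>"
proof -
  have "state (\<lambda>b. \<phi> (slice_left \<omega> (\<Delta> b)))" if "state \<phi>" for \<phi>
    using state_convolve[OF comult_hom assms that] by (simp add: convolve_slice_left[OF assms that, abs_def])
  then obtain \<mu> where \<mu>: "state \<mu>" "\<forall>b. \<mu> (slice_left \<omega> (\<Delta> b)) = \<mu> b" by (rule fixed_state)
  have "convolve \<Delta> \<omega> \<mu> = \<mu>" using \<mu>(2) by (simp add: fun_eq_iff convolve_slice_left[OF assms \<mu>(1)])
  with \<mu>(1) show ?thesis by (rule that)
qed

text \<open>Besides \<nu>, the Cauchy-Schwarz argument needs a state \<mu> of the quantum group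
  fixed from the other side by the same average. Both depend on the finite set; only \<nu> is passed
  to the limit.\<close>

lemma exists_right_invariant:
  obtains \<nu> where "state \<nu>" "\<forall>\<rho>. state \<rho> \<longrightarrow> convolve \<alpha> \<nu> \<rho> = \<nu>"
proof -
  have "\<exists>\<nu>. state \<nu> \<and> (\<forall>\<rho>\<in>F. \<forall>b. \<nu> (slice_right \<rho> (\<alpha> b)) = \<nu> b)"
    if F: "finite F" "F \<subseteq> Collect state" for F
  proof (cases "F = {}")
    case True
    then show ?thesis using norming_state[of 1] by blast
  next
    case False
    have sF: "\<And>\<rho>. \<rho> \<in> F \<Longrightarrow> state \<rho>" using F(2) by blast
    let ?\<omega> = "\<lambda>a. of_real (1 / card F) * (\<Sum>\<rho>\<in>F. \<rho> a)"
    have \<omega>: "state ?\<omega>" by (rule state_average[OF F(1) False sF])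
    obtain \<nu> where \<nu>: "state \<nu>" "convolve \<alpha> \<nu> ?\<omega> = \<nu>" by (rule convolve_right_fixed[OF \<omega>])
    obtain \<mu> where \<mu>: "state \<mu>" "convolve \<Delta> ?\<omega> \<mu> = \<mu>" by (rule convolve_left_fixed[OF \<omega>])
    have "convolve \<alpha> \<nu> \<rho> = \<nu>" if "\<rho> \<in> F" for \<rho>
      by (rule convolve_invariant_right[OF F(1) False sF \<nu>(1) \<mu>(1) \<nu>(2) \<mu>(2) that])
    then show ?thesis using \<nu>(1) convolve_slice_right[OF \<nu>(1) sF] by metis
  qed
  then obtain \<nu> where \<nu>: "state \<nu>" "\<forall>\<rho>\<in>Collect state. \<forall>b. \<nu> (slice_right \<rho> (\<alpha> b)) = \<nu> b"
    by (rule common_fixed_state)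
  then have "\<forall>\<rho>. state \<rho> \<longrightarrow> convolve \<alpha> \<nu> \<rho> = \<nu>" by (simp add: fun_eq_iff convolve_slice_right[OF \<nu>(1)])
  with \<nu>(1) show ?thesis by (rule that)
qed

end

section \<open>Left-invariant states of the quantum group\<close>

context compact_quantum_group
begin

lemma comult_action: "quantum_group_action \<Delta> \<Delta>"
proof (intro quantum_group_action.intro quantum_group_action_axioms.intro)
  have "{\<Delta> b * (1 \<otimes> a) | a b. True} = {\<Delta> a * (1 \<otimes> b) | a b. True}" by blast
  then show "closure (cspan {\<Delta> b * (1 \<otimes> a) | a b. True}) = UNIV" using density_right by simp
qed (simp_all add: compact_quantum_group_axioms comult_hom coassociative)

text \<open>The mirror image of \<open>convolve_invariant_right\<close>: slicing the last leg leaves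
  \<open>d\<close> in the first one, so the null vector is \<Delta> d - d \<otimes> 1, and the
  conclusion rests on \<open>density_left\<close>, a condition without counterpart for
  actions.\<close>

lemma convolve_invariant_left:
  assumes F: "finite F" "F \<noteq> {}" "\<And>\<rho>. \<rho> \<in> F \<Longrightarrow> state \<rho>"
    and \<nu>: "state \<nu>" and \<mu>: "state \<mu>"
  defines "\<omega> \<equiv> \<lambda>a. of_real (1 / card F) * (\<Sum>\<rho>\<in>F. \<rho> a)"
  assumes inv\<nu>: "convolve \<Delta> \<nu> \<omega> = \<nu>" and inv\<mu>: "convolve \<Delta> \<omega> \<mu> = \<mu>" and \<rho>: "\<rho> \<in> F"
  shows "convolve \<Delta> \<rho> \<mu> = \<mu>"
proof -
  interpret self: quantum_group_action \<Delta> \<Delta> by (rule comult_action)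
  have \<omega>: "state \<omega>" unfolding \<omega>_def by (rule state_average[OF F])
  note sF = F(3)[OF \<rho>] and S = state_tensor_state[OF \<nu> \<omega>]
  note l = clinear_simps[OF state_clinear[OF S]]
  have key: "tensor_state \<nu> (convolve \<Delta> \<rho> \<mu>) ((c \<otimes> 1) * \<Delta> b) = tensor_state \<nu> \<mu> ((c \<otimes> 1) * \<Delta> b)" for c b
  proof -
    define d where "d = slice_right \<mu> (\<Delta> b)"
    define x where "x = \<Delta> d - d \<otimes> 1"
    have cross: "tensor_state \<nu> \<omega> ((star d \<otimes> 1) * \<Delta> d) = \<nu> (star d * d)"
      using self.action_slice_right[OF \<nu> \<omega> \<mu>, of "star d" b] state_slice_right[OF \<mu> \<nu>, of "star d" "\<Delta> b" 1]
      by (simp add: inv\<mu> d_def pure_tensor_one)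
    have "star x * x = \<Delta> (star d * d) - star (\<Delta> d) * (d \<otimes> 1) - (star d \<otimes> 1) * \<Delta> d + (star d * d) \<otimes> 1"
      by (simp add: x_def star_simps self.comult_simps pure_tensor_simps left_diff_distrib right_diff_distrib)
    moreover have "tensor_state \<nu> \<omega> (\<Delta> (star d * d)) = \<nu> (star d * d)"
      using fun_cong[OF inv\<nu>, of "star d * d"] by (simp add: convolve_def)
    moreover have "tensor_state \<nu> \<omega> (star (\<Delta> d) * (d \<otimes> 1)) = \<nu> (star d * d)"
      using state_star[OF S, of "(star d \<otimes> 1) * \<Delta> d"] cross state_star[OF \<nu>, of "star d * d"]
      by (simp add: star_mult star_star pure_tensor_simps star_simps)
    ultimately have "tensor_state \<nu> \<omega> (star x * x) = 0"
      using cross by (simp add: l tensor_state_pure[OF \<nu> \<omega>] state_one[OF \<omega>])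
    then have "of_real (1 / card F) * (\<Sum>\<rho>\<in>F. tensor_state \<nu> \<rho> (star x * x)) = 0"
      by (simp only: \<omega>_def tensor_state_average_right[OF \<nu> F])
    then have "(\<Sum>\<rho>\<in>F. tensor_state \<nu> \<rho> (star x * x)) = 0" using F(1,2) by simp
    then have "tensor_state \<nu> \<rho> ((c \<otimes> 1) * x) = 0"
      by (rule average_null_vector[where \<tau> = "\<lambda>\<rho>. tensor_state \<nu> \<rho>", OF F(1) _ _ \<rho>, rotated])
        (rule state_tensor_state[OF \<nu> F(3)])
    then have "tensor_state \<nu> \<rho> ((c \<otimes> 1) * \<Delta> d) = \<nu> (c * d)"
      by (simp add: x_def right_diff_distrib clinear_simps[OF state_clinear[OF state_tensor_state[OF \<nu> sF]]]
        pure_tensor_simps tensor_state_pure[OF \<nu> sF] state_one[OF sF])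
    then show ?thesis
      using self.action_slice_right[OF \<nu> sF \<mu>, of c b] state_slice_right[OF \<mu> \<nu>, of c "\<Delta> b" 1]
      by (simp add: d_def pure_tensor_one)
  qed
  note C = state_convolve[OF comult_hom sF \<mu>]
  note S1 = state_tensor_state[OF \<nu> C] and S2 = state_tensor_state[OF \<nu> \<mu>]
  have "tensor_state \<nu> (convolve \<Delta> \<rho> \<mu>) = tensor_state \<nu> \<mu>"
  proof (rule cspan_dense_eq[OF state_bounded_linear[OF S1] state_clinear[OF S1]
        state_bounded_linear[OF S2] state_clinear[OF S2] density_left])
    fix z assume "z \<in> {\<Delta> a * (b \<otimes> 1) | a b. True}"
    then obtain a b where "z = star ((star b \<otimes> 1) * \<Delta> (star a))"
      by (auto simp: star_mult pure_tensor_simps star_simps star_star self.comult_simps)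
    then show "tensor_state \<nu> (convolve \<Delta> \<rho> \<mu>) z = tensor_state \<nu> \<mu> z"
      using key[of "star b" "star a"] state_star[OF S1] state_star[OF S2] by simp
  qed
  then show ?thesis
    using tensor_state_pure[OF \<nu> C, of 1] tensor_state_pure[OF \<nu> \<mu>, of 1] by (simp add: state_one[OF \<nu>] fun_eq_iff)
qed

lemma exists_left_invariant:
  obtains \<mu> where "state \<mu>" "\<forall>\<rho>. state \<rho> \<longrightarrow> convolve \<Delta> \<rho> \<mu> = \<mu>"
proof -
  interpret self: quantum_group_action \<Delta> \<Delta> by (rule comult_action)
  have "\<exists>\<mu>. state \<mu> \<and> (\<forall>\<rho>\<in>F. \<forall>b. \<mu> (slice_left \<rho> (\<Delta> b)) = \<mu> b)"
    if F: "finite F" "F \<subseteq> Collect state" for F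
  proof (cases "F = {}")
    case True
    then show ?thesis using norming_state[of 1] by blast
  next
    case False
    have sF: "\<And>\<rho>. \<rho> \<in> F \<Longrightarrow> state \<rho>" using F(2) by blast
    let ?\<omega> = "\<lambda>a. of_real (1 / card F) * (\<Sum>\<rho>\<in>F. \<rho> a)"
    have \<omega>: "state ?\<omega>" by (rule state_average[OF F(1) False sF])
    obtain \<nu> where \<nu>: "state \<nu>" "convolve \<Delta> \<nu> ?\<omega> = \<nu>" by (rule self.convolve_right_fixed[OF \<omega>])
    obtain \<mu> where \<mu>: "state \<mu>" "convolve \<Delta> ?\<omega> \<mu> = \<mu>" by (rule self.convolve_left_fixed[OF \<omega>])
    have "convolve \<Delta> \<rho> \<mu> = \<mu>" if "\<rho> \<in> F" for \<rho>
      by (rule convolve_invariant_left[OF F(1) False sF \<nu>(1) \<mu>(1) \<nu>(2) \<mu>(2) that])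
    then show ?thesis using \<mu>(1) convolve_slice_left[OF sF \<mu>(1)] by metis
  qed
  then obtain \<mu> where \<mu>: "state \<mu>" "\<forall>\<rho>\<in>Collect state. \<forall>b. \<mu> (slice_left \<rho> (\<Delta> b)) = \<mu> b"
    by (rule common_fixed_state)
  then have "\<forall>\<rho>. state \<rho> \<longrightarrow> convolve \<Delta> \<rho> \<mu> = \<mu>" by (simp add: fun_eq_iff convolve_slice_left[OF _ \<mu>(1)])
  with \<mu>(1) show ?thesis by (rule that)
qed

end

section \<open>Invariant states and fixed points of an action\<close>

context quantum_group_action
begin

text \<open>States separate the points of \<open>'a\<close>, so invariance can be tested by
  convolution, the form to which \<open>convolve_assoc\<close> applies.\<close>

lemma invariant_state_iff:
  "invariant_state \<alpha> \<nu> \<longleftrightarrow> state \<nu> \<and> (\<forall>\<rho>. state \<rho> \<longrightarrow> convolve \<alpha> \<nu> \<rho> = \<nu>)"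
proof (cases "state \<nu>")
  case True
  have "slice_left \<nu> (\<alpha> b) = \<nu> b *\<^sub>C 1 \<longleftrightarrow> (\<forall>\<rho>. state \<rho> \<longrightarrow> convolve \<alpha> \<nu> \<rho> b = \<nu> b)" for b
  proof
    assume "slice_left \<nu> (\<alpha> b) = \<nu> b *\<^sub>C 1"
    then show "\<forall>\<rho>. state \<rho> \<longrightarrow> convolve \<alpha> \<nu> \<rho> b = \<nu> b"
      by (simp add: convolve_slice_left[OF True] clinear_simps state_clinear state_one)
  next
    assume *: "\<forall>\<rho>. state \<rho> \<longrightarrow> convolve \<alpha> \<nu> \<rho> b = \<nu> b"
    show "slice_left \<nu> (\<alpha> b) = \<nu> b *\<^sub>C 1"
    proof (rule states_separate_eq)
      fix \<rho> :: "'a \<Rightarrow> complex" assume "state \<rho>"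
      then show "\<rho> (slice_left \<nu> (\<alpha> b)) = \<rho> (\<nu> b *\<^sub>C 1)"
        using * convolve_slice_left[OF True, of \<rho> \<alpha> b] by (simp add: clinear_simps state_clinear state_one)
    qed
  qed
  then show ?thesis using True by (auto simp: invariant_state_def fun_eq_iff)
qed (simp add: invariant_state_def)

text \<open>The witness is the convolution of \<open>\<nu>\<close> with a right-invariant state of the quantum group.\<close>

lemma invariant_state_extends:
  assumes \<nu>: "state \<nu>"
  obtains \<nu>' where "invariant_state \<alpha> \<nu>'" "\<forall>b. \<alpha> b = b \<otimes> 1 \<longrightarrow> \<nu>' b = \<nu> b"
proof -
  interpret self: quantum_group_action \<Delta> \<Delta> by (rule comult_action)
  obtain h where h: "state h" "\<forall>\<rho>. state \<rho> \<longrightarrow> convolve \<Delta> h \<rho> = h"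
    by (rule self.exists_right_invariant)
  have "invariant_state \<alpha> (convolve \<alpha> \<nu> h)"
    unfolding invariant_state_iff
    using h by (simp add: state_convolve[OF action_hom \<nu>] convolve_assoc[OF \<nu> h(1)])
  moreover have "\<forall>b. \<alpha> b = b \<otimes> 1 \<longrightarrow> convolve \<alpha> \<nu> h b = \<nu> b"
    by (simp add: convolve_def tensor_state_pure[OF \<nu> h(1)] state_one[OF h(1)])
  ultimately show ?thesis by (rule that)
qed

text \<open>Tested on product states, \<open>action_slice_right\<close> produces
  \<open>convolve \<Delta> \<omega> h\<close>, which left-invariance collapses to
  \<open>h\<close>.\<close>

lemma fixed_point_slice_right:
  assumes h: "state h" "\<forall>\<rho>. state \<rho> \<longrightarrow> convolve \<Delta> \<rho> h = h"
  shows "\<alpha> (slice_right h (\<alpha> b)) = slice_right h (\<alpha> b) \<otimes> 1"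
proof -
  let ?e = "slice_right h (\<alpha> b)"
  have "\<alpha> ?e - ?e \<otimes> 1 = 0"
  proof (rule product_states_separate)
    fix \<nu> :: "'b \<Rightarrow> complex" and \<omega> :: "'a \<Rightarrow> complex" assume st: "state \<nu>" "state \<omega>"
    have "tensor_state \<nu> \<omega> (\<alpha> ?e) = tensor_state \<nu> h (\<alpha> b)"
      using action_slice_right[OF st h(1), of 1 b] h(2) st(2) by (simp add: pure_tensor_one)
    also have "\<dots> = \<nu> ?e"
      using convolve_slice_right[OF st(1) h(1), of \<alpha> b] by (simp add: convolve_def)
    finally show "tensor_state \<nu> \<omega> (\<alpha> ?e - ?e \<otimes> 1) = 0"
      by (simp add: clinear_simps[OF state_clinear[OF state_tensor_state[OF st]]] tensor_state_pure[OF st] state_one[OF st(2)])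
  qed
  then show ?thesis by simp
qed

lemma scalars_fixed: "\<alpha> (c *\<^sub>C 1) = (c *\<^sub>C 1) \<otimes> 1"
  by (simp add: clinear_simps[OF action_simps(4)] action_simps pure_tensor_linear pure_tensor_one)

end

theorem theorem3p5:
  fixes \<Delta> :: "'a::unital_cstar_algebra \<Rightarrow> 'a \<otimes> 'a"
    and \<alpha> :: "'b::unital_cstar_algebra \<Rightarrow> 'b \<otimes> 'a"
  assumes "compact_quantum_group \<Delta>"
    and "quantum_group_action \<Delta> \<alpha>"
  shows "ergodic \<alpha> \<longleftrightarrow> (\<exists>!\<mu>. invariant_state \<alpha> \<mu>)"
proof
  interpret quantum_group_action \<Delta> \<alpha> by (rule assms(2))
  {
    assume erg: "ergodic \<alpha>"
    obtain h where h: "state h" "\<forall>\<rho>. state \<rho> \<longrightarrow> convolve \<Delta> \<rho> h = h" by (rule exists_left_invariant)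
    have "slice_right h (\<alpha> b) \<in> range (\<lambda>c. c *\<^sub>C 1)" for b
      using fixed_point_slice_right[OF h, of b] erg by (auto simp: ergodic_def)
    then have "\<exists>c. slice_right h (\<alpha> b) = c *\<^sub>C 1" for b by blast
    \<comment> \<open>\<open>m\<close> is the only candidate; its invariance is not read off from
      \<open>h\<close> but follows once some invariant state is known to exist.\<close>
    then obtain m where m: "\<And>b. slice_right h (\<alpha> b) = m b *\<^sub>C 1" by metis
    have unique: "\<mu> = m" if "invariant_state \<alpha> \<mu>" for \<mu>
    proof
      fix b
      have \<mu>: "state \<mu>" "convolve \<alpha> \<mu> h = \<mu>" using that h(1) by (simp_all add: invariant_state_iff)
      then show "\<mu> b = m b"
        using convolve_slice_right[OF \<mu>(1) h(1), of \<alpha> b] by (simp add: m clinear_simps[OF state_clinear[OF \<mu>(1)]] state_one)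
    qed
    obtain \<nu> :: "'b \<Rightarrow> complex" where "state \<nu>" using norming_state[of 1] by blast
    then obtain \<mu> where "invariant_state \<alpha> \<mu>" using invariant_state_extends by blast
    then show "\<exists>!\<mu>. invariant_state \<alpha> \<mu>" using unique by blast
  }
  assume "\<exists>!\<mu>. invariant_state \<alpha> \<mu>"
  then obtain \<mu> where \<mu>: "\<And>\<nu>. invariant_state \<alpha> \<nu> \<Longrightarrow> \<nu> = \<mu>" by blast
  have "b = \<mu> b *\<^sub>C 1" if "\<alpha> b = b \<otimes> 1" for b
  proof (rule states_separate_eq)
    fix \<nu> :: "'b \<Rightarrow> complex" assume \<nu>: "state \<nu>"
    obtain \<nu>' where "invariant_state \<alpha> \<nu>'" "\<forall>b. \<alpha> b = b \<otimes> 1 \<longrightarrow> \<nu>' b = \<nu> b"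
      by (rule invariant_state_extends[OF \<nu>])
    then have "\<nu> b = \<mu> b" using \<mu> that by metis
    then show "\<nu> b = \<nu> (\<mu> b *\<^sub>C 1)" by (simp add: clinear_simps[OF state_clinear[OF \<nu>]] state_one[OF \<nu>])
  qed
  then show "ergodic \<alpha>" unfolding ergodic_def using scalars_fixed by auto
qed

end
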